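(* Let $\mathbb{F}$ be an algebraically closed field of characteristic $2$. Let $n\geq 6$ be even and let $V$ be a simple $\mathbb{F}\mathsf{S}_n$-module. Then one of the following statements holds: (i) $d_3(V)>d_1(V)$. (ii) $V\cong D^{\alpha_n}$ is the basic spin module or $V\cong \mathbf{1}$ is the trivial module, in which cases we have $d_3(V)=d_1(V)$.
   Context: $\mathsf{S}_n$ is the symmetric group on $\Omega=\{1,\ldots,n\}$. For $1\le r\le n$, $M_r=\mathbb{F}\Omega_r$ denotes the permutation $\mathbb{F}\mathsf{S}_n$-module on the set $\Omega_r$ of $r$-element subsets of $\Omega$, and $\mathsf{S}_{n-r,r}=\mathsf{S}_{\{1,\ldots,n-r\}}\times \mathsf{S}_{\{n-r+1,\ldots,n\}}$ is the stabilizer of an element of $\Omega_r$. For an $\mathbb{F}\mathsf{S}_n$-module $V$ put $$d_r(V)=\dim \mathrm{Hom}_{\mathbb{F}\mathsf{S}_n}(M_r,\mathrm{End}_{\mathbb{F}}(V))=\dim \mathrm{End}_{\mathbb{F}\mathsf{S}_{n-r,r}}\big(\mathrm{Res}^{\mathsf{S}_n}_{\mathsf{S}_{n-r,r}}V\big).$$ For a $2$-regular partition $\lambda$ of $n$ (i.e. with distinct non-zero parts), $D^\lambda$ is the irreducible $\mathbb{F}\mathsf{S}_n$-module labeled by $\lambda$ in the standard (James) labeling, i.e. the simple head of the Specht module $S^\lambda$. For $n=2k$ even, $\alpha_n=(k+1,k-1)$, and $D^{\alpha_n}$ is called the basic spin module. *)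

theory Defs
  imports
    "Jordan_Normal_Form.VS_Connect"
    "HOL-Algebra.QuotRing"
    "HOL-Algebra.Sym_Groups"
begin

hide_const (open) Multiset.mult

section \<open>Modules for a group over a field\<close>

text \<open>
  An \<open>FG\<close>-module, for a field \<open>F\<close> (the type \<open>'f\<close>) and a group \<open>G\<close>, is a vector space over \<open>F\<close>
  together with a linear action of \<open>G\<close>. As for modules in HOL-Algebra, the
  record fields \<open>mult\<close> and \<open>one\<close> are inherited from rings and carry no meaning.
\<close>

record ('f, 'g, 'v) grp_module = "('f, 'v) module" +
  act :: "'g \<Rightarrow> 'v \<Rightarrow> 'v"

locale group_module = vectorspace class_ring V + G: group G
  for G :: "'g monoid" and V :: "('f::field, 'g, 'v) grp_module" +
  assumes act_linear: "g \<in> carrier G \<Longrightarrow> act V g \<in> LinearCombinations.module_hom class_ring V V"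
    and act_one: "v \<in> carrier V \<Longrightarrow> act V \<one>\<^bsub>G\<^esub> v = v"
    and act_mult: "\<lbrakk>g \<in> carrier G; h \<in> carrier G; v \<in> carrier V\<rbrakk>
      \<Longrightarrow> act V (g \<otimes>\<^bsub>G\<^esub> h) v = act V g (act V h v)"

definition grp_submodule ::
    "'g monoid \<Rightarrow> ('f::field, 'g, 'v) grp_module \<Rightarrow> 'v set \<Rightarrow> bool" where
  "grp_submodule G V W \<longleftrightarrow>
     VectorSpace.subspace class_ring W V \<and> (\<forall>g\<in>carrier G. \<forall>w\<in>W. act V g w \<in> W)"

definition simple_module :: "'g monoid \<Rightarrow> ('f::field, 'g, 'v) grp_module \<Rightarrow> bool" where
  "simple_module G V \<longleftrightarrow>
     group_module G V \<and> carrier V \<noteq> {\<zero>\<^bsub>V\<^esub>} \<and>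
     (\<forall>W. grp_submodule G V W \<longrightarrow> W = {\<zero>\<^bsub>V\<^esub>} \<or> W = carrier V)"

text \<open>
  Maps are extensional outside the carrier, so that equality of functions in the spaces below is
  equality of maps on the carrier.
\<close>

definition lin_maps ::
    "('f::field, 'g, 'v) grp_module \<Rightarrow> ('f, 'g, 'w) grp_module \<Rightarrow> ('v \<Rightarrow> 'w) set" where
  "lin_maps V W = LinearCombinations.module_hom class_ring V W \<inter> extensional (carrier V)"

definition grp_hom ::
    "'g monoid \<Rightarrow> ('f::field, 'g, 'v) grp_module \<Rightarrow> ('f, 'g, 'w) grp_module \<Rightarrow> ('v \<Rightarrow> 'w) set" where
  "grp_hom G V W =
     {f \<in> lin_maps V W. \<forall>g\<in>carrier G. \<forall>v\<in>carrier V. f (act V g v) = act W g (f v)}"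

definition grp_iso ::
    "'g monoid \<Rightarrow> ('f::field, 'g, 'v) grp_module \<Rightarrow> ('f, 'g, 'w) grp_module \<Rightarrow> bool" where
  "grp_iso G V W \<longleftrightarrow> (\<exists>f\<in>grp_hom G V W. bij_betw f (carrier V) (carrier W))"

text \<open>\<open>Hom\<^sub>F(V, W)\<close> with the action \<open>(g \<cdot> f) v = g (f (g\<inverse> v))\<close>.\<close>

definition Hom_module ::
    "'g monoid \<Rightarrow> ('f::field, 'g, 'v) grp_module \<Rightarrow> ('f, 'g, 'w) grp_module
      \<Rightarrow> ('f, 'g, 'v \<Rightarrow> 'w) grp_module" where
  "Hom_module G V W =
     \<lparr>carrier = lin_maps V W,
      mult = (\<lambda>f h. \<lambda>v\<in>carrier V. \<zero>\<^bsub>W\<^esub>),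
      one = (\<lambda>v\<in>carrier V. \<zero>\<^bsub>W\<^esub>),
      zero = (\<lambda>v\<in>carrier V. \<zero>\<^bsub>W\<^esub>),
      add = (\<lambda>f h. \<lambda>v\<in>carrier V. f v \<oplus>\<^bsub>W\<^esub> h v),
      smult = (\<lambda>c f. \<lambda>v\<in>carrier V. c \<odot>\<^bsub>W\<^esub> f v),
      act = (\<lambda>g f. \<lambda>v\<in>carrier V. act W g (f (act V (inv\<^bsub>G\<^esub> g) v)))\<rparr>"

abbreviation End_module ::
    "'g monoid \<Rightarrow> ('f::field, 'g, 'v) grp_module \<Rightarrow> ('f, 'g, 'v \<Rightarrow> 'v) grp_module" where
  "End_module G V \<equiv> Hom_module G V V"

definition dim_grp_hom ::
    "'g monoid \<Rightarrow> ('f::field, 'g, 'v) grp_module \<Rightarrow> ('f, 'g, 'w) grp_module \<Rightarrow> nat" where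
  "dim_grp_hom G V W =
     vectorspace.dim class_ring ((Hom_module G V W)\<lparr>carrier := grp_hom G V W\<rparr>)"

definition trivial_module :: "('f::field, 'g, 'f) grp_module" where
  "trivial_module =
     \<lparr>carrier = UNIV, mult = (*), one = 1, zero = 0, add = (+), smult = (*), act = (\<lambda>g v. v)\<rparr>"

text \<open>
  The permutation module \<open>FX\<close> of a finite \<open>G\<close>-set \<open>X\<close> with action \<open>\<alpha>\<close>: the formal sum
  \<open>\<Sum>\<^bsub>x\<in>X\<^esub> f x \<cdot> x\<close> is represented by its coefficient function \<open>f\<close>, whence the inverse in the
  action.
\<close>

definition perm_module ::
    "'g monoid \<Rightarrow> 'x set \<Rightarrow> ('g \<Rightarrow> 'x \<Rightarrow> 'x) \<Rightarrow> ('f::field, 'g, 'x \<Rightarrow> 'f) grp_module" where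
  "perm_module G X \<alpha> =
     \<lparr>carrier = extensional X,
      mult = (\<lambda>f h. \<lambda>x\<in>X. 0),
      one = (\<lambda>x\<in>X. 0),
      zero = (\<lambda>x\<in>X. 0),
      add = (\<lambda>f h. \<lambda>x\<in>X. f x + h x),
      smult = (\<lambda>c f. \<lambda>x\<in>X. c * f x),
      act = (\<lambda>g f. \<lambda>x\<in>X. f (\<alpha> (inv\<^bsub>G\<^esub> g) x))\<rparr>"

text \<open>
  The unions in \<open>smult\<close> and \<open>act\<close> collapse to the single coset of the image of any representative
  (compare \<^const>\<open>rcoset_mult\<close>).
\<close>

definition quot_module ::
    "('f::field, 'g, 'v) grp_module \<Rightarrow> 'v set \<Rightarrow> ('f, 'g, 'v set) grp_module" where
  "quot_module V W =
     \<lparr>carrier = A_RCOSETS V W,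
      mult = (\<lambda>A B. W),
      one = W,
      zero = W,
      add = set_add V,
      smult = (\<lambda>c A. \<Union>a\<in>A. W +>\<^bsub>V\<^esub> (c \<odot>\<^bsub>V\<^esub> a)),
      act = (\<lambda>g A. \<Union>a\<in>A. W +>\<^bsub>V\<^esub> act V g a)\<rparr>"

definition maximal_submodule ::
    "'g monoid \<Rightarrow> ('f::field, 'g, 'v) grp_module \<Rightarrow> 'v set \<Rightarrow> bool" where
  "maximal_submodule G V W \<longleftrightarrow>
     grp_submodule G V W \<and> W \<noteq> carrier V \<and>
     (\<forall>U. grp_submodule G V U \<and> W \<subseteq> U \<longrightarrow> U = W \<or> U = carrier V)"

definition module_radical :: "'g monoid \<Rightarrow> ('f::field, 'g, 'v) grp_module \<Rightarrow> 'v set" where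
  "module_radical G V = {v \<in> carrier V. \<forall>W. maximal_submodule G V W \<longrightarrow> v \<in> W}"

definition head ::
    "'g monoid \<Rightarrow> ('f::field, 'g, 'v) grp_module \<Rightarrow> ('f, 'g, 'v set) grp_module" where
  "head G V = quot_module V (module_radical G V)"


section \<open>Specht modules and their heads\<close>

text \<open>
  Partitions are lists of parts in weakly decreasing order. Boxes, rows and columns are numbered
  from 0; the entries of tableaux are \<open>1, \<dots>, n\<close>, where \<open>n\<close> is the sum of the parts.
\<close>

definition diagram :: "nat list \<Rightarrow> (nat \<times> nat) set" where
  "diagram la = {(i, j). i < length la \<and> j < la ! i}"

definition tableaux :: "nat list \<Rightarrow> (nat \<times> nat \<Rightarrow> nat) set" where
  "tableaux la = {t \<in> extensional (diagram la). bij_betw t (diagram la) {1..sum_list la}}"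

definition row_entries :: "nat list \<Rightarrow> (nat \<times> nat \<Rightarrow> nat) \<Rightarrow> nat \<Rightarrow> nat set" where
  "row_entries la t i = t ` {b \<in> diagram la. fst b = i}"

definition column_entries :: "nat list \<Rightarrow> (nat \<times> nat \<Rightarrow> nat) \<Rightarrow> nat \<Rightarrow> nat set" where
  "column_entries la t j = t ` {b \<in> diagram la. snd b = j}"

definition tableau_act ::
    "nat list \<Rightarrow> (nat \<Rightarrow> nat) \<Rightarrow> (nat \<times> nat \<Rightarrow> nat) \<Rightarrow> (nat \<times> nat \<Rightarrow> nat)" where
  "tableau_act la p t = compose (diagram la) p t"

text \<open>The tabloid of \<open>t\<close> is its class under row equivalence.\<close>

definition tabloid :: "nat list \<Rightarrow> (nat \<times> nat \<Rightarrow> nat) \<Rightarrow> (nat \<times> nat \<Rightarrow> nat) set" where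
  "tabloid la t = {s \<in> tableaux la. \<forall>i. row_entries la s i = row_entries la t i}"

definition tabloid_module ::
    "nat list \<Rightarrow> ('f::field, nat \<Rightarrow> nat, (nat \<times> nat \<Rightarrow> nat) set \<Rightarrow> 'f) grp_module" where
  "tabloid_module la =
     perm_module (sym_group (sum_list la)) (tabloid la ` tableaux la) (\<lambda>p T. tableau_act la p ` T)"

definition column_stabilizer :: "nat list \<Rightarrow> (nat \<times> nat \<Rightarrow> nat) \<Rightarrow> (nat \<Rightarrow> nat) set" where
  "column_stabilizer la t =
     {p \<in> carrier (sym_group (sum_list la)). \<forall>j. p ` column_entries la t j = column_entries la t j}"

text \<open>The polytabloid \<open>\<Sum>\<^bsub>p\<in>C\<^sub>t\<^esub> sgn p \<cdot> p{t}\<close> as an element of the tabloid module.\<close>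

definition polytabloid ::
    "nat list \<Rightarrow> (nat \<times> nat \<Rightarrow> nat) \<Rightarrow> (nat \<times> nat \<Rightarrow> nat) set \<Rightarrow> 'f::field" where
  "polytabloid la t =
     (\<lambda>T\<in>tabloid la ` tableaux la.
        \<Sum>p\<in>column_stabilizer la t. if tabloid la (tableau_act la p t) = T then of_int (sign p) else 0)"

definition specht_module ::
    "nat list \<Rightarrow> ('f::field, nat \<Rightarrow> nat, (nat \<times> nat \<Rightarrow> nat) set \<Rightarrow> 'f) grp_module" where
  "specht_module la =
     (tabloid_module la)
       \<lparr>carrier := LinearCombinations.module.span class_ring (tabloid_module la) (polytabloid la ` tableaux la)\<rparr>"

text \<open>
  The module \<open>D\<^sup>\<lambda>\<close> in the labelling of James. It is simple if no \<open>p\<close> parts of \<open>\<lambda>\<close> are equal, where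
  \<open>p\<close> is the characteristic; for other \<open>\<lambda>\<close> the definition has no significance.
\<close>

definition D_module ::
    "nat list \<Rightarrow> ('f::field, nat \<Rightarrow> nat, ((nat \<times> nat \<Rightarrow> nat) set \<Rightarrow> 'f) set) grp_module" where
  "D_module la = head (sym_group (sum_list la)) (specht_module la)"

definition basic_spin_partition :: "nat \<Rightarrow> nat list" where
  "basic_spin_partition n = [n div 2 + 1, n div 2 - 1]"


section \<open>The invariants \<open>d\<^sub>r(V)\<close>\<close>

definition subset_module :: "nat \<Rightarrow> nat \<Rightarrow> ('f::field, nat \<Rightarrow> nat, nat set \<Rightarrow> 'f) grp_module" where
  "subset_module n r =
     perm_module (sym_group n) {A. A \<subseteq> {1..n} \<and> card A = r} (\<lambda>p A. p ` A)"

definition d_inv :: "nat \<Rightarrow> nat \<Rightarrow> ('f::field, nat \<Rightarrow> nat, 'v) grp_module \<Rightarrow> nat" where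
  "d_inv n r V = dim_grp_hom (sym_group n) (subset_module n r) (End_module (sym_group n) V)"

end

theory Submission
  imports Defs "HOL-Library.Function_Algebras"
begin

text \<open>The characteristic is 2 throughout. Write \<open>M\<^sub>r\<close> for the permutation module on the
  \<open>r\<close>-element subsets, \<open>E\<close> for the endomorphisms of \<open>V\<close>, and \<open>t\<^sub>a\<^sub>b\<close> for the action of the
  transposition of \<open>a\<close> and \<open>b\<close>.

  The map \<open>M\<^sub>3 \<rightarrow> M\<^sub>1\<close> that sends a triple to the sum of its points is onto, because
  \<open>{a,b,c} + {a,b,d} + {a,c,d}\<close> goes to \<open>3a + 2b + 2c + 2d = a\<close>. Composition with it embeds
  \<open>Hom(M\<^sub>1, E)\<close> into \<open>Hom(M\<^sub>3, E)\<close>, so \<open>d\<^sub>1 \<le> d\<^sub>3\<close> (\<open>d_inv_1_3\<close>). If \<open>d\<^sub>1 = d\<^sub>3\<close>, then every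
  homomorphism \<open>M\<^sub>3 \<rightarrow> E\<close> factors through \<open>M\<^sub>1\<close>. For the homomorphism
  \<open>{a,b,c} \<mapsto> t\<^sub>a\<^sub>b + t\<^sub>b\<^sub>c + t\<^sub>a\<^sub>c\<close> this gives \<open>t\<^sub>b\<^sub>x + t\<^sub>b\<^sub>y + t\<^sub>c\<^sub>x + t\<^sub>c\<^sub>y = 0\<close>
  (\<open>transposition_relation\<close>). Hence \<open>z = t\<^sub>a\<^sub>b + t\<^sub>b\<^sub>c + t\<^sub>a\<^sub>c\<close> is the same operator for all triples and
  is central. As \<open>z\<^sup>3 = z\<close>, it is the scalar 0 or 1; in the second case \<open>V\<close> is trivial
  (\<open>z_zero_or_trivial\<close>).

  A simple module with \<open>z = 0\<close> is called a spin module below. For \<open>n = 2k\<close> there is only one, for the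
  following reason. The operators \<open>\<tau>\<^sub>i = t\<^sub>2\<^sub>i\<^sub>-\<^sub>1\<^sub>,\<^sub>2\<^sub>i\<close> commute, and modifications \<open>s\<^sub>i\<close> of
  \<open>t\<^sub>2\<^sub>i\<^sub>,\<^sub>n\<close> commute as well and satisfy \<open>\<tau>\<^sub>i s\<^sub>j = s\<^sub>j \<tau>\<^sub>i + \<delta>\<^sub>i\<^sub>j\<close>. As in a Fock space, the
  products of distinct \<open>s\<^sub>i\<close> applied to a vector fixed by all \<open>\<tau>\<^sub>i\<close> form a basis, on which the action of
  all transpositions is given by formulas that depend on \<open>k\<close> only (\<open>spin_rep_unique\<close>). The vectors fixed
  by all \<open>\<tau>\<^sub>i\<close> form a line, so that commuting operators are scalars (\<open>schur\<close>). Moreover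
  \<open>\<Sum>\<^sub>c t\<^sub>a\<^sub>c\<close> is a scalar, and for a set \<open>A\<close> of odd size this allows to express every \<open>t\<^sub>a\<^sub>b\<close> by
  transpositions in the stabilizer of \<open>A\<close>. Hence the stabilizer has only scalar endomorphisms as
  well and \<open>d\<^sub>1 = d\<^sub>3 = 1\<close> (\<open>commute_of_stabilizer\<close>, \<open>spin_module_d_inv\<close>).

  It remains to see that \<open>D\<^sup>(\<^sup>k\<^sup>+\<^sup>1\<^sup>,\<^sup>k\<^sup>-\<^sup>1\<^sup>)\<close> is a spin module. Tabloids are \<open>(k-1)\<close>-element
  subsets, and a polytabloid is the indicator function of the transversals of its \<open>k - 1\<close> columns of length
  two. By the argument of James, a proper submodule of the Specht module \<open>S\<close> lies in the radical \<open>R\<close> of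
  the standard bilinear form on \<open>S\<close> (\<open>submodule_dichotomy\<close>), so that \<open>S/R\<close> is the simple head
  once \<open>R \<noteq> S\<close>. Elements of \<open>S\<close> have vanishing sums over all sets that contain a
  given set of fewer than \<open>k - 1\<close> points, and a count of pairs of sets shows that such functions are orthogonal
  to \<open>z S\<close> (\<open>triple_sum_orthogonal\<close>). So \<open>z\<close> maps \<open>S\<close> to \<open>R\<close> and vanishes on the head.\<close>

abbreviation swap :: "'a \<Rightarrow> 'a \<Rightarrow> 'a \<Rightarrow> 'a" where
  "swap \<equiv> Transposition.transpose"

section \<open>Representations in characteristic 2\<close>

lemma transpose_conj:
  "swap a b \<circ> swap c d =
   swap (swap a b c) (swap a b d)
     \<circ> swap a b"
  by (auto simp: fun_eq_iff Transposition.transpose_def)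

text \<open>The representation space is a subspace of a type, so that the library of vector spaces over type
  classes applies; the ambient type may be larger, as for spaces of functions.\<close>

locale char2_rep = vector_space scale
  for scale :: "'f::field \<Rightarrow> 'b::ab_group_add \<Rightarrow> 'b" (infixr \<open>*s\<close> 75) +
  fixes n :: nat and C :: "'b set" and \<rho> :: "(nat \<Rightarrow> nat) \<Rightarrow> 'b \<Rightarrow> 'b"
  assumes char2: "CHAR('f) = 2"
    and C_subspace: "subspace C"
    and rho_closed: "p permutes {1..n} \<Longrightarrow> x \<in> C \<Longrightarrow> \<rho> p x \<in> C"
    and rho_add: "p permutes {1..n} \<Longrightarrow> x \<in> C \<Longrightarrow> y \<in> C \<Longrightarrow> \<rho> p (x + y) = \<rho> p x + \<rho> p y"
    and rho_scale: "p permutes {1..n} \<Longrightarrow> x \<in> C \<Longrightarrow> \<rho> p (c *s x) = c *s \<rho> p x"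
    and rho_id: "x \<in> C \<Longrightarrow> \<rho> id x = x"
    and rho_comp: "p permutes {1..n} \<Longrightarrow> q permutes {1..n} \<Longrightarrow> x \<in> C \<Longrightarrow> \<rho> (p \<circ> q) x = \<rho> p (\<rho> q x)"
begin

lemma dbl [simp]: "x + x = (0::'b)"
proof -
  have "(1 + 1 :: 'f) = of_nat CHAR('f)" using char2 by simp
  hence "(1 + 1 :: 'f) = 0" by (metis of_nat_CHAR)
  moreover have "x + x = (1 + 1 :: 'f) *s x" by (simp only: scale_left_distrib scale_one)
  ultimately show ?thesis by simp
qed

lemma dbl_left [simp]: "x + (x + y) = (y::'b)"
  by (simp flip: add.assoc)

lemma eq_if_add_zero: "x + y = 0 \<Longrightarrow> x = (y::'b)"
  by (metis add.right_neutral dbl_left)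

lemma C_add [simp, intro]: "x \<in> C \<Longrightarrow> y \<in> C \<Longrightarrow> x + y \<in> C"
  and C_scale [simp, intro]: "x \<in> C \<Longrightarrow> c *s x \<in> C"
  and C_zero [simp, intro]: "0 \<in> C"
  and C_sum: "(\<And>i. i \<in> I \<Longrightarrow> g i \<in> C) \<Longrightarrow> sum g I \<in> C"
  using C_subspace by (auto simp: subspace_add subspace_scale subspace_0 intro: subspace_sum)

definition t :: "nat \<Rightarrow> nat \<Rightarrow> 'b \<Rightarrow> 'b" where
  "t a b = \<rho> (swap a b)"

definition D :: "nat set" where "D = {1..n}"

lemma finite_D [simp]: "finite D" and card_D [simp]: "card D = n"
  unfolding D_def by simp_all

lemma t_perm: "a \<in> D \<Longrightarrow> b \<in> D \<Longrightarrow> swap a b permutes {1..n}"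
  unfolding D_def by (rule permutes_swap_id)

lemma t_closed [simp, intro]: "a \<in> D \<Longrightarrow> b \<in> D \<Longrightarrow> x \<in> C \<Longrightarrow> t a b x \<in> C"
  unfolding t_def by (rule rho_closed[OF t_perm])

lemma t_add: "a \<in> D \<Longrightarrow> b \<in> D \<Longrightarrow> x \<in> C \<Longrightarrow> y \<in> C \<Longrightarrow> t a b (x + y) = t a b x + t a b y"
  unfolding t_def by (rule rho_add[OF t_perm])

lemma t_scale: "a \<in> D \<Longrightarrow> b \<in> D \<Longrightarrow> x \<in> C \<Longrightarrow> t a b (c *s x) = c *s t a b x"
  unfolding t_def by (rule rho_scale[OF t_perm])

lemma t_zero [simp]: "a \<in> D \<Longrightarrow> b \<in> D \<Longrightarrow> t a b 0 = 0"
  using t_scale[of a b 0 0] by simp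

lemma t_sum: "a \<in> D \<Longrightarrow> b \<in> D \<Longrightarrow> (\<And>i. i \<in> I \<Longrightarrow> g i \<in> C) \<Longrightarrow> t a b (sum g I) = (\<Sum>i\<in>I. t a b (g i))"
  by (induction I rule: infinite_finite_induct) (auto simp: t_add C_sum)

lemma t_sq [simp]: "a \<in> D \<Longrightarrow> b \<in> D \<Longrightarrow> x \<in> C \<Longrightarrow> t a b (t a b x) = x"
  unfolding t_def by (simp flip: rho_comp[OF t_perm t_perm] add: rho_id)

lemma t_sym: "t a b = t b a"
  unfolding t_def by (simp add: transpose_commute)

lemma t_refl [simp]: "x \<in> C \<Longrightarrow> t a a x = x"
  unfolding t_def by (simp add: rho_id)

lemma transpose_in_D: "a \<in> D \<Longrightarrow> b \<in> D \<Longrightarrow> c \<in> D \<Longrightarrow> swap a b c \<in> D"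
  unfolding Transposition.transpose_def by auto

lemma t_conj:
  assumes "a \<in> D" "b \<in> D" "c \<in> D" "d \<in> D" "x \<in> C"
  shows "t a b (t c d x) = t (swap a b c) (swap a b d) (t a b x)"
  unfolding t_def using assms transpose_in_D[of a b]
  by (simp flip: rho_comp[OF t_perm t_perm] add: transpose_conj[of a b c d])

lemma t_commute:
  assumes "a \<in> D" "b \<in> D" "c \<in> D" "d \<in> D" "x \<in> C" "a \<noteq> c" "a \<noteq> d" "b \<noteq> c" "b \<noteq> d"
  shows "t a b (t c d x) = t c d (t a b x)"
  using t_conj[OF assms(1-5)] assms by (simp add: transpose_def)

lemma t_shift:
  assumes "a \<in> D" "b \<in> D" "c \<in> D" "x \<in> C" "a \<noteq> b" "b \<noteq> c" "a \<noteq> c"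
  shows "t a b (t b c x) = t a c (t a b x)" "t a b (t a c x) = t b c (t a b x)"
  using t_conj[of a b b c x] t_conj[of a b a c x] assms by (simp_all add: transpose_def)

text \<open>Transpositions generate the symmetric group, so equivariance has to be checked for them only. The
  action \<open>\<rho>'\<close> is needed on the image of \<open>f\<close> only.\<close>

lemma intertwine_all:
  assumes f: "\<And>a b x. a \<in> D \<Longrightarrow> b \<in> D \<Longrightarrow> x \<in> C \<Longrightarrow> f (t a b x) = \<rho>' (swap a b) (f x)"
    and id: "\<And>x. x \<in> C \<Longrightarrow> \<rho>' id (f x) = f x"
    and comp: "\<And>p q x. p permutes {1..n} \<Longrightarrow> q permutes {1..n} \<Longrightarrow> x \<in> C \<Longrightarrow> \<rho>' (p \<circ> q) (f x) = \<rho>' p (\<rho>' q (f x))"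
    and "p permutes {1..n}" "x \<in> C"
  shows "f (\<rho> p x) = \<rho>' p (f x)"
proof -
  have "\<forall>x\<in>C. f (\<rho> p x) = \<rho>' p (f x)"
    using \<open>p permutes {1..n}\<close> finite_atLeastAtMost
  proof (induction rule: permutes_induct)
    show "\<forall>x\<in>C. f (\<rho> id x) = \<rho>' id (f x)" by (simp add: rho_id id)
  next
    fix a b q assume *: "a \<in> {1..n}" "b \<in> {1..n}" "a \<noteq> b" "\<forall>x\<in>C. f (\<rho> q x) = \<rho>' q (f x)" "q permutes {1..n}"
    note * = *(1,2)[folded D_def] *(3-5)
    show "\<forall>x\<in>C. f (\<rho> (swap a b \<circ> q) x) = \<rho>' (swap a b \<circ> q) (f x)"
    proof
      fix x assume x: "x \<in> C"
      show "f (\<rho> (swap a b \<circ> q) x) = \<rho>' (swap a b \<circ> q) (f x)"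
        using f[OF *(1,2) rho_closed[OF *(5) x]] *(4) x
        by (simp add: rho_comp[OF t_perm[OF *(1,2)] *(5) x] comp[OF t_perm[OF *(1,2)] *(5) x] t_def)
    qed
  qed
  thus ?thesis using \<open>x \<in> C\<close> by blast
qed

lemma rho_invariant:
  assumes W: "W \<subseteq> C" and inv: "\<And>a b x. a \<in> D \<Longrightarrow> b \<in> D \<Longrightarrow> x \<in> W \<Longrightarrow> t a b x \<in> W"
    and p: "p permutes {1..n}" and x: "x \<in> W"
  shows "\<rho> p x \<in> W"
proof -
  have "\<forall>x\<in>W. \<rho> p x \<in> W" using p finite_atLeastAtMost
  proof (induction rule: permutes_induct)
    show "\<forall>x\<in>W. \<rho> id x \<in> W" using W by (auto simp: rho_id)
  next
    fix a b q assume *: "a \<in> {1..n}" "b \<in> {1..n}" "a \<noteq> b" "\<forall>x\<in>W. \<rho> q x \<in> W" "q permutes {1..n}"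
    note * = *(1,2)[folded D_def] *(3-5)
    show "\<forall>x\<in>W. \<rho> (swap a b \<circ> q) x \<in> W"
      using * inv W by (auto simp: rho_comp[OF t_perm[OF *(1,2)] *(5)] subset_iff simp flip: t_def)
  qed
  thus ?thesis using x by blast
qed

text \<open>In the group algebra of the symmetric group of \<open>{a, b, c}\<close>, \<open>z\<close> is the class sum of the
  transpositions. With the sum \<open>e\<close> of the two 3-cycles, \<open>z\<^sup>2 = 1 + e\<close> and \<open>z e = 2 z = 0\<close>,
  hence \<open>z\<^sup>3 = z\<close>.\<close>

definition z :: "nat \<Rightarrow> nat \<Rightarrow> nat \<Rightarrow> 'b \<Rightarrow> 'b" where
  "z a b c x = t a b x + t b c x + t a c x"

lemma z_closed [simp, intro]: "a \<in> D \<Longrightarrow> b \<in> D \<Longrightarrow> c \<in> D \<Longrightarrow> x \<in> C \<Longrightarrow> z a b c x \<in> C"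
  unfolding z_def by auto

lemma z_add: "a \<in> D \<Longrightarrow> b \<in> D \<Longrightarrow> c \<in> D \<Longrightarrow> x \<in> C \<Longrightarrow> y \<in> C \<Longrightarrow> z a b c (x + y) = z a b c x + z a b c y"
  unfolding z_def by (simp add: t_add ac_simps)

lemma z_scale: "a \<in> D \<Longrightarrow> b \<in> D \<Longrightarrow> c \<in> D \<Longrightarrow> x \<in> C \<Longrightarrow> z a b c (d *s x) = d *s z a b c x"
  unfolding z_def by (simp add: t_scale scale_right_distrib)

lemma z_zero [simp]: "a \<in> D \<Longrightarrow> b \<in> D \<Longrightarrow> c \<in> D \<Longrightarrow> z a b c 0 = 0"
  unfolding z_def by simp

lemma z_sym: "z a b c = z b a c" "z a b c = z a c b"
  unfolding z_def using t_sym[of a b] t_sym[of a c] t_sym[of b c] by (auto simp: fun_eq_iff ac_simps)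

lemma z_conj:
  assumes "a \<in> D" "b \<in> D" "c \<in> D" "d \<in> D" "e \<in> D" "x \<in> C"
  shows "t a b (z c d e x) = z (swap a b c) (swap a b d)
    (swap a b e) (t a b x)"
  unfolding z_def using assms by (simp add: t_add t_conj[of a b])

lemma t_rot:
  assumes "a \<in> D" "b \<in> D" "c \<in> D" "x \<in> C" "distinct [a, b, c]"
  shows "t b c (t a c x) = t a b (t b c x)" "t a c (t a b x) = t a b (t b c x)"
    "t a c (t b c x) = t b c (t a b x)" "t a b (t a c x) = t b c (t a b x)"
proof -
  note s = t_sym[of b a] t_sym[of c a] t_sym[of c b]
  show "t b c (t a c x) = t a b (t b c x)"
    using t_shift(1)[of b c a x] assms by (simp add: s)
  show "t a c (t a b x) = t a b (t b c x)"
    using t_shift(1)[of a b c x] assms by (simp add: s)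
  show "t a c (t b c x) = t b c (t a b x)"
    using t_shift(1)[of c b a x] assms by (simp add: s)
  show "t a b (t a c x) = t b c (t a b x)"
    using t_shift(2)[of a b c x] assms by (simp add: s)
qed

lemma z_sq:
  assumes "a \<in> D" "b \<in> D" "c \<in> D" "distinct [a, b, c]" "x \<in> C"
  shows "z a b c (z a b c x) = x + t a b (t b c x) + t b c (t a b x)"
  unfolding z_def using assms
  by (simp add: t_add t_rot[of a b c x] ac_simps)

lemma z_cube:
  assumes "a \<in> D" "b \<in> D" "c \<in> D" "distinct [a, b, c]" "x \<in> C"
  shows "z a b c (z a b c (z a b c x)) = z a b c x"
proof -
  have *: "t a b (t b c (t a b x)) = t a c x" "t b c (t a b (t b c x)) = t a c x"
    "t a c (t a b (t b c x)) = t a b x" "t a c (t b c (t a b x)) = t b c x"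
    using assms t_shift(1)[of a b c "t a b x"] t_rot(3)[of a b c "t b c x"]
      t_rot(2)[of a b c "t b c x"] t_rot(3)[of a b c "t a b x"]
    by simp_all
  show ?thesis using assms
    by (subst z_sq[of a b c x]) (simp_all add: z_def[of a b c "_ + _"] t_add * z_def[of a b c x] ac_simps)
qed

end

section \<open>The sum of the transpositions of a triple is central\<close>

locale simple_char2_rep = char2_rep +
  assumes C_nonzero: "C \<noteq> {0}"
    and simple: "subspace W \<Longrightarrow> W \<subseteq> C \<Longrightarrow> (\<And>p x. p permutes {1..n} \<Longrightarrow> x \<in> W \<Longrightarrow> \<rho> p x \<in> W)
      \<Longrightarrow> W = {0} \<or> W = C"
begin

lemma simple_t:
  assumes "subspace W" "W \<subseteq> C" "\<And>a b x. a \<in> D \<Longrightarrow> b \<in> D \<Longrightarrow> x \<in> W \<Longrightarrow> t a b x \<in> W"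
  shows "W = {0} \<or> W = C"
  by (rule simple[OF assms(1,2) rho_invariant[OF assms(2,3)]])

text \<open>An eigenspace of an operator commuting with all transpositions is everything if it is
  nonzero.\<close>

lemma scalar_if_eigenvector:
  assumes f_add: "\<And>x y. x \<in> C \<Longrightarrow> y \<in> C \<Longrightarrow> f (x + y) = f x + f y"
    and f_scale: "\<And>c x. x \<in> C \<Longrightarrow> f (c *s x) = c *s f x"
    and comm: "\<And>a b x. a \<in> D \<Longrightarrow> b \<in> D \<Longrightarrow> x \<in> C \<Longrightarrow> f (t a b x) = t a b (f x)"
    and u: "u \<in> C" "u \<noteq> 0" "f u = e *s u" and x: "x \<in> C"
  shows "f x = e *s x"
proof -
  let ?W = "{x \<in> C. f x = e *s x}"
  have "f 0 = 0" using f_scale[of 0 0] by simp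
  hence "subspace ?W"
    by (auto simp: subspace_def f_add f_scale scale_right_distrib mult.commute)
  moreover have "t a b x \<in> ?W" if "a \<in> D" "b \<in> D" "x \<in> ?W" for a b x
    using that by (auto simp: comm t_scale)
  ultimately have "?W = {0} \<or> ?W = C" by (intro simple_t) auto
  moreover have "u \<in> ?W" using u by simp
  ultimately show ?thesis using u x by blast
qed

lemma C_obtain_nonzero: obtains u where "u \<in> C" "u \<noteq> 0"
  using C_nonzero C_zero by blast

text \<open>The hypothesis says that \<open>z\<close> agrees for triples with two points in common, hence for all triples, so
  it commutes with the group and is a scalar \<open>e\<close> with \<open>e\<^sup>3 = e\<close>. If \<open>z = 1\<close>, then
  \<open>z\<^sup>2 = 1\<close> makes the two 3-cycles on \<open>{a, b, c}\<close> agree; thus \<open>t\<^sub>a\<^sub>c = t\<^sub>b\<^sub>c\<close>, and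
  \<open>z = 1\<close> becomes \<open>t\<^sub>a\<^sub>b = 1\<close>.\<close>

lemma z_zero_or_trivial:
  assumes n: "n \<ge> 5"
    and rel: "\<And>b c x y v. \<lbrakk>b \<in> D; c \<in> D; x \<in> D; y \<in> D; distinct [b, c, x, y]; v \<in> C\<rbrakk>
      \<Longrightarrow> t b x v + t b y v + t c x v + t c y v = 0"
  shows "(\<forall>a\<in>D. \<forall>b\<in>D. \<forall>c\<in>D. \<forall>x\<in>C. distinct [a, b, c] \<longrightarrow> z a b c x = 0)
    \<or> (\<forall>p x. p permutes {1..n} \<longrightarrow> x \<in> C \<longrightarrow> \<rho> p x = x)"
proof -
  have D123: "1 \<in> D" "2 \<in> D" "3 \<in> D" using n by (auto simp: D_def)
  define Z where "Z = z 1 2 3"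
  have step: "z a b c v = z a b d v"
    if "a \<in> D" "b \<in> D" "c \<in> D" "d \<in> D" "distinct [a, b, c]" "distinct [a, b, d]" "v \<in> C" for a b c d v
  proof (cases "c = d")
    case False
    have "z a b c v + z a b d v = t a c v + t a d v + t b c v + t b d v"
      unfolding z_def by (simp add: ac_simps)
    also have "\<dots> = 0" using rel[of a b c d v] that False by auto
    finally show ?thesis by (rule eq_if_add_zero)
  qed simp
  have Z1: "Z v = z 1 2 d v" if "d \<in> D" "d \<noteq> 1" "d \<noteq> 2" "v \<in> C" for d v
    unfolding Z_def using step[of 1 2 3 d v] that D123 by auto
  have Z2: "Z v = z 1 3 d v" if "d \<in> D" "d \<noteq> 1" "d \<noteq> 3" "v \<in> C" for d v
    unfolding Z_def using step[of 1 3 2 d v] that D123 z_sym(2)[of 1 2 3] by auto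
  have Z3: "Z v = z 2 3 d v" if "d \<in> D" "d \<noteq> 2" "d \<noteq> 3" "v \<in> C" for d v
    unfolding Z_def using step[of 2 3 1 d v] that D123 z_sym(1)[of 1 2 3] z_sym(2)[of 2 1 3] by auto
  have Zconj: "z (swap a b 1) (swap a b 2) (swap a b 3) v = Z v"
    if "a \<in> D" "b \<in> D" "v \<in> C" "a \<noteq> b" "a \<notin> {1,2,3} \<or> b \<in> {1,2,3}" for a b v
  proof -
    note s = z_sym(1)[of 2 1] z_sym(1)[of 3 1] z_sym(1)[of 3 2] z_sym(2)[of _ 3 2] z_sym(2)[of _ 3 1] z_sym(2)[of _ 2 1]
    show ?thesis
    proof (cases "a \<in> {1,2,3}")
      case True
      hence "b \<in> {1,2,3}" using that by blast
      thus ?thesis using True that unfolding Z_def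
        by (auto simp: transpose_def s simp del: One_nat_def)
    next
      case False
      show ?thesis
      proof (cases "b \<in> {1,2,3}")
        case True
        thus ?thesis using that False Z1[of a v] Z2[of a v] Z3[of a v] z_sym(1)[of a 2 3] z_sym(2)[of 1 a 3]
            z_sym(2)[of 2 a 3]
          by (auto simp: transpose_def)
      qed (use False in \<open>simp add: Z_def transpose_def\<close>)
    qed
  qed
  have Z_closed: "Z v \<in> C" if "v \<in> C" for v using that D123 unfolding Z_def by simp
  have Zcomm: "Z (t a b v) = t a b (Z v)" if ab: "a \<in> D" "b \<in> D" and v: "v \<in> C" for a b v
  proof -
    have *: "Z (t a b v) = t a b (Z v)" if "a \<notin> {1,2,3} \<or> b \<in> {1,2,3}" "a \<in> D" "b \<in> D" "a \<noteq> b" for a b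
      using z_conj[of a b 1 2 3 v] Zconj[of a b "t a b v"] that v D123 unfolding Z_def by simp
    show ?thesis
      using *[of a b] *[of b a] ab v t_sym[of a b] by (cases "a = b") (auto simp: Z_closed)
  qed
  have Z_add: "Z (u + v) = Z u + Z v" if "u \<in> C" "v \<in> C" for u v
    using that D123 unfolding Z_def by (simp add: z_add)
  have Z_scale: "Z (c *s v) = c *s Z v" if "v \<in> C" for c v
    using that D123 unfolding Z_def by (simp add: z_scale)
  have Z_cube: "Z (Z (Z v)) = Z v" if "v \<in> C" for v
    using z_cube[of 1 2 3 v] that D123 unfolding Z_def by simp
  have scal: "Z x = e *s x" if "u \<in> C" "u \<noteq> 0" "Z u = e *s u" "x \<in> C" for u e x
    by (rule scalar_if_eigenvector[of Z u]) (use that in \<open>auto simp: Z_add Z_scale Zcomm\<close>)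
  obtain u where u: "u \<in> C" "u \<noteq> 0" by (rule C_obtain_nonzero)
  have "\<exists>e\<in>{0, 1}. \<exists>v\<in>C. v \<noteq> 0 \<and> Z v = e *s v"
  proof -
    \<comment> \<open>\<open>z (z + 1)\<^sup>2 = 0\<close>: one of the three factors kills a nonzero vector on the way from \<open>u\<close>.\<close>
    let ?w = "u + Z (Z u)"
    have "Z ?w = 0" using u by (simp add: Z_add Z_closed Z_cube)
    show ?thesis
    proof (cases "?w = 0")
      case False
      thus ?thesis using \<open>Z ?w = 0\<close> u Z_closed by (intro bexI[of _ 0] bexI[of _ ?w]) auto
    next
      case True
      hence ZZ: "Z (Z u) = u" using eq_if_add_zero by metis
      show ?thesis
      proof (cases "u + Z u = 0")
        case True
        hence "Z u = u" using eq_if_add_zero by metis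
        thus ?thesis using u by (intro bexI[of _ 1] bexI[of _ u]) auto
      next
        case False
        have "Z (u + Z u) = u + Z u" using u ZZ by (simp add: Z_add Z_closed add.commute)
        thus ?thesis using u False Z_closed by (intro bexI[of _ 1] bexI[of _ "u + Z u"]) auto
      qed
    qed
  qed
  then obtain e v where e: "e = 0 \<or> e = 1" and v: "v \<in> C" "v \<noteq> 0" "Z v = e *s v" by blast
  have Zall: "Z x = e *s x" if "x \<in> C" for x using scal[OF v that] .
  \<comment> \<open>By conjugation, all triples behave like \<open>1, 2, 3\<close>.\<close>
  have conj_all: "z (p 1) (p 2) (p 3) x = e *s x" if "p permutes {1..n}" "x \<in> C" for p x
  proof -
    have "\<forall>x\<in>C. z (p 1) (p 2) (p 3) x = e *s x"
      using that(1) finite_atLeastAtMost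
    proof (induction rule: permutes_induct)
      case id
      show ?case using Zall by (simp add: Z_def)
    next
      case (swap a b p)
      have p: "p 1 \<in> D" "p 2 \<in> D" "p 3 \<in> D"
        using D123 by (simp_all only: D_def permutes_in_image[OF swap(4)])
      note ab = swap(1,2)[folded D_def]
      show ?case
      proof
        fix x assume x: "x \<in> C"
        have "z ((swap a b \<circ> p) 1) ((swap a b \<circ> p) 2)
            ((swap a b \<circ> p) 3) (t a b (t a b x)) = t a b (z (p 1) (p 2) (p 3) (t a b x))"
          using z_conj[of a b "p 1" "p 2" "p 3" "t a b x"] ab p x by simp
        also have "\<dots> = e *s x" using swap ab x by (simp add: t_scale)
        finally show "z ((swap a b \<circ> p) 1) ((swap a b \<circ> p) 2)
            ((swap a b \<circ> p) 3) x = e *s x" using x ab by simp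
      qed
    qed
    thus ?thesis using that by blast
  qed
  have all: "z a b c x = e *s x" if "a \<in> D" "b \<in> D" "c \<in> D" "distinct [a, b, c]" "x \<in> C" for a b c x
  proof -
    have "\<exists>p. p permutes {1..n} \<and> p 1 = a \<and> p 2 = b \<and> p 3 = c"
    proof -
      let ?q = "swap 1 a"
      let ?b = "?q b"
      let ?r = "swap 2 ?b"
      let ?c = "?r (?q c)"
      let ?s = "swap 3 ?c"
      have b: "?b \<in> D" "?b \<noteq> 1" using transpose_in_D[of 1 a b] that D123 by (auto simp: transpose_def)
      have qc: "?q c \<in> D" "?q c \<noteq> 1" "?q c \<noteq> ?b" using transpose_in_D[of 1 a c] that D123 by (auto simp: transpose_def)
      have c: "?c \<in> D" "?c \<noteq> 1" "?c \<noteq> 2" using transpose_in_D[of 2 ?b "?q c"] b qc D123 by (auto simp: transpose_def)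
      have "?q \<circ> (?r \<circ> ?s) permutes {1..n}"
        by (intro permutes_compose t_perm) (use b c that D123 in auto)
      moreover have "(?q \<circ> (?r \<circ> ?s)) 1 = a" using b c by (simp add: transpose_def)
      moreover have "(?q \<circ> (?r \<circ> ?s)) 2 = b"
      proof -
        have "?s 2 = 2" using c by (simp add: transpose_apply_other)
        thus ?thesis by simp
      qed
      moreover have "(?q \<circ> (?r \<circ> ?s)) 3 = c" by simp
      ultimately show ?thesis by blast
    qed
    then obtain p where "p permutes {1..n}" "p 1 = a" "p 2 = b" "p 3 = c" by blast
    thus ?thesis using conj_all[of p x] that by simp
  qed
  show ?thesis
  proof (cases "e = 0")
    case True
    thus ?thesis using all by simp
  next
    case False
    hence "e = 1" using e by simp
    hence z1: "z a b c x = x" if "a \<in> D" "b \<in> D" "c \<in> D" "distinct [a, b, c]" "x \<in> C" for a b c x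
      using all that by simp
    have t1: "t a b x = x" if ab: "a \<in> D" "b \<in> D" "a \<noteq> b" and x: "x \<in> C" for a b x
    proof -
      have "\<not> D \<subseteq> {a, b}"
        using card_mono[of "{a, b}" D] n by (auto simp: card_insert_if split: if_splits)
      then obtain c where "c \<in> D" "c \<noteq> a" "c \<noteq> b" by blast
      hence c: "c \<in> D" "distinct [a, b, c]" using ab by auto
      let ?r = "t a b (t b c x)" and ?r' = "t b c (t a b x)"
      have "z a b c (z a b c x) = x" using z1 c ab x by simp
      hence xr: "x + (?r + ?r') = x"
        using z_sq[OF ab(1,2) c x] by (simp only: add.assoc)
      have "?r + ?r' = x + (x + (?r + ?r'))" by (rule dbl_left[symmetric])
      also have "\<dots> = 0" by (simp only: xr dbl)
      finally have "?r = ?r'" by (rule eq_if_add_zero)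
      from arg_cong[OF this, of "t a b"] have "t a c x = t b c x"
        using c ab x t_shift(1)[of a b c "t a b x"] by simp
      thus ?thesis using z1[OF ab(1,2) c x] by (simp add: z_def add.assoc)
    qed
    have "\<rho> p x = x" if "p permutes {1..n}" "x \<in> C" for p x
      using intertwine_all[of id "\<lambda>_ x. x" p x] t1 that by (metis id_apply t_refl)
    thus ?thesis by blast
  qed
qed

end

section \<open>Representations on which the triple sums vanish\<close>

lemma sum_atLeast1_even: "(\<Sum>c\<in>{1..2*j}. g c) = (\<Sum>i\<in>{1..j}. g (2*i-1) + g (2*i))"
  for g :: "nat \<Rightarrow> 'a::comm_monoid_add"
  by (induction j) (simp_all add: add.assoc)

locale spin_rep = simple_char2_rep +
  fixes k :: nat
  assumes n_def: "n = 2*k" and k_ge: "k \<ge> 2"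
    and z0: "\<And>a b c x. \<lbrakk>a \<in> D; b \<in> D; c \<in> D; distinct [a, b, c]; x \<in> C\<rbrakk> \<Longrightarrow> z a b c x = 0"
begin

lemma n_in_D [simp]: "n \<in> D" unfolding D_def using n_def k_ge by simp

lemma sum_const: "(\<Sum>i\<in>I. x) = (if even (card I) then 0 else (x::'b))"
  by (induction I rule: infinite_finite_induct) auto

lemma add_cancel_around: "x + (a + x + s) = a + (s::'b)"
  by (simp only: add.assoc add.left_commute[of x a] dbl_left)

lemma sum_const_scale: "(\<Sum>i\<in>I. x) = of_nat (card I) *s (x::'b)"
  by (induction I rule: infinite_finite_induct) (auto simp: scale_left_distrib)

lemma t_split:
  assumes "a \<in> D" "b \<in> D" "c \<in> D" "distinct [a, b, c]" "x \<in> C"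
  shows "t a c x = t a b x + t b c x"
  by (rule eq_if_add_zero) (use z0[OF assms] in \<open>simp add: z_def ac_simps\<close>)

text \<open>From here on the operators behave like generators of a Clifford algebra: transpositions with one common
  point commute up to the constant 1, because the product \<open>t\<^sub>a\<^sub>b t\<^sub>b\<^sub>c = t\<^sub>a\<^sub>c t\<^sub>a\<^sub>b\<close> is expanded by
  \<open>t\<^sub>a\<^sub>c = t\<^sub>a\<^sub>b + t\<^sub>b\<^sub>c\<close>.\<close>

lemma t_anticommute:
  assumes "a \<in> D" "b \<in> D" "c \<in> D" "distinct [a, b, c]" "x \<in> C"
  shows "t a b (t b c x) = t b c (t a b x) + x"
proof -
  have "x = t a c (t a c x)" using assms by simp
  also have "\<dots> = t a b (t a b x + t b c x) + t b c (t a b x + t b c x)"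
    using assms by (simp add: t_split[of a b c])
  also have "\<dots> = t a b (t b c x) + t b c (t a b x)"
    using assms by (simp add: t_add ac_simps)
  finally show ?thesis by (metis add.commute dbl_left)
qed

definition w :: "nat \<Rightarrow> 'b \<Rightarrow> 'b" where
  "w a x = (\<Sum>c\<in>D-{a}. t a c x)"

text \<open>By \<open>t\<^sub>a\<^sub>c = t\<^sub>a\<^sub>b + t\<^sub>b\<^sub>c\<close> the two sums differ by \<open>n - 2\<close> copies of \<open>t\<^sub>a\<^sub>b\<close>, and \<open>n\<close>
  is even. Independence of \<open>a\<close> makes \<open>w\<close> central.\<close>

lemma w_eq:
  assumes "a \<in> D" "b \<in> D" "x \<in> C"
  shows "w a x = w b x"
proof (cases "a = b")
  case False
  let ?R = "D - {a, b}"
  have card: "even (card ?R)"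
  proof -
    have "card ?R = n - 2" using assms False by (simp add: card_Diff_subset)
    thus ?thesis using n_def by simp
  qed
  have split: "D - {a} = insert b ?R" "D - {b} = insert a ?R" using assms False by auto
  have "w a x = t a b x + (\<Sum>c\<in>?R. t a b x + t b c x)"
    unfolding w_def split(1) using assms False by (simp add: t_split[of a b])
  also have "\<dots> = t b a x + (\<Sum>c\<in>?R. t b c x)"
    using card by (simp only: sum.distrib sum_const t_sym[of a b]) simp
  also have "\<dots> = w b x" unfolding w_def split(2) by simp
  finally show ?thesis .
qed simp

lemma w_add: "a \<in> D \<Longrightarrow> x \<in> C \<Longrightarrow> y \<in> C \<Longrightarrow> w a (x + y) = w a x + w a y"
  and w_scale: "a \<in> D \<Longrightarrow> x \<in> C \<Longrightarrow> w a (c *s x) = c *s w a x"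
  unfolding w_def by (simp_all add: t_add t_scale sum.distrib scale_sum_right)

lemma w_comm:
  assumes "a \<in> D" "b \<in> D" "c \<in> D" "x \<in> C"
  shows "w a (t b c x) = t b c (w a x)"
proof -
  let ?p = "swap b c"
  have p: "?p permutes {1..n}" using assms by (intro t_perm)
  have "t b c (w a x) = (\<Sum>d\<in>D-{a}. t (?p a) (?p d) (t b c x))"
    unfolding w_def using assms by (subst t_sum) (auto intro!: sum.cong t_conj[of b c])
  also have "\<dots> = (\<Sum>d\<in>?p ` (D-{a}). t (?p a) d (t b c x))"
    by (subst sum.reindex) (use permutes_inj_on[OF p] in auto)
  also have "?p ` (D - {a}) = D - {?p a}"
    using permutes_image[OF p] by (simp add: image_set_diff D_def)
  also have "(\<Sum>d\<in>D-{?p a}. t (?p a) d (t b c x)) = w (?p a) (t b c x)"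
    unfolding w_def ..
  also have "\<dots> = w a (t b c x)" using assms by (intro w_eq) (auto intro: transpose_in_D)
  finally show ?thesis ..
qed

lemma pair_distinct:
  fixes i j :: nat
  assumes "1 \<le> i" "1 \<le> j" "i \<noteq> j"
  shows "2*i-1 \<noteq> 2*j-1" "2*i-1 \<noteq> 2*j" "2*i \<noteq> 2*j-1" "2*i \<noteq> 2*j"
  using assms by presburger+

definition \<tau> :: "nat \<Rightarrow> 'b \<Rightarrow> 'b" where "\<tau> i = t (2*i-1) (2*i)"
definition \<sigma> :: "nat \<Rightarrow> 'b \<Rightarrow> 'b" where "\<sigma> i = t (2*i) n"

lemma idx: "i \<in> {1..k} \<Longrightarrow> 2*i-1 \<in> D" "i \<in> {1..k} \<Longrightarrow> 2*i \<in> D"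
  unfolding D_def using n_def by auto

lemma idx2: "i \<in> {1..<k} \<Longrightarrow> 2*i-1 \<in> D" "i \<in> {1..<k} \<Longrightarrow> 2*i \<in> D" "i \<in> {1..<k} \<Longrightarrow> 2*i \<noteq> n" "i \<in> {1..<k} \<Longrightarrow> 2*i-1 \<noteq> n"
  unfolding D_def using n_def by auto

lemma tau_closed [simp]: "i \<in> {1..k} \<Longrightarrow> x \<in> C \<Longrightarrow> \<tau> i x \<in> C"
  and tau_add: "i \<in> {1..k} \<Longrightarrow> x \<in> C \<Longrightarrow> y \<in> C \<Longrightarrow> \<tau> i (x + y) = \<tau> i x + \<tau> i y"
  and tau_scale: "i \<in> {1..k} \<Longrightarrow> x \<in> C \<Longrightarrow> \<tau> i (c *s x) = c *s \<tau> i x"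
  and tau_sq: "i \<in> {1..k} \<Longrightarrow> x \<in> C \<Longrightarrow> \<tau> i (\<tau> i x) = x"
  and tau_sum: "i \<in> {1..k} \<Longrightarrow> (\<And>i. i \<in> I \<Longrightarrow> g i \<in> C) \<Longrightarrow> \<tau> i (sum g I) = (\<Sum>j\<in>I. \<tau> i (g j))"
  unfolding \<tau>_def by (use idx in \<open>simp_all add: t_add t_scale t_sum\<close>)

lemma sigma_closed [simp]: "i \<in> {1..k} \<Longrightarrow> x \<in> C \<Longrightarrow> \<sigma> i x \<in> C"
  and sigma_add: "i \<in> {1..k} \<Longrightarrow> x \<in> C \<Longrightarrow> y \<in> C \<Longrightarrow> \<sigma> i (x + y) = \<sigma> i x + \<sigma> i y"
  and sigma_scale: "i \<in> {1..k} \<Longrightarrow> x \<in> C \<Longrightarrow> \<sigma> i (c *s x) = c *s \<sigma> i x"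
  and sigma_sq: "i \<in> {1..k} \<Longrightarrow> x \<in> C \<Longrightarrow> \<sigma> i (\<sigma> i x) = x"
  and sigma_sum: "i \<in> {1..k} \<Longrightarrow> (\<And>i. i \<in> I \<Longrightarrow> g i \<in> C) \<Longrightarrow> \<sigma> i (sum g I) = (\<Sum>j\<in>I. \<sigma> i (g j))"
  unfolding \<sigma>_def by (use idx in \<open>simp_all add: t_add t_scale t_sum\<close>)

lemma tau_commute: "i \<in> {1..k} \<Longrightarrow> j \<in> {1..k} \<Longrightarrow> x \<in> C \<Longrightarrow> \<tau> i (\<tau> j x) = \<tau> j (\<tau> i x)"
proof (cases "i = j")
  case False
  assume *: "i \<in> {1..k}" "j \<in> {1..k}" "x \<in> C"
  show ?thesis unfolding \<tau>_def
    by (rule t_commute[OF idx(1)[OF *(1)] idx(2)[OF *(1)] idx(1)[OF *(2)] idx(2)[OF *(2)] *(3)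
          pair_distinct[of i j]]) (use * False in auto)
qed simp

lemma tau_sigma_commute:
  assumes "i \<in> {1..<k}" "j \<in> {1..<k}" "i \<noteq> j" "x \<in> C"
  shows "\<tau> i (\<sigma> j x) = \<sigma> j (\<tau> i x)"
  unfolding \<tau>_def \<sigma>_def
  by (rule t_commute[OF idx2(1)[OF assms(1)] idx2(2)[OF assms(1)] idx2(2)[OF assms(2)] n_in_D assms(4)
        pair_distinct(2)[of i j] idx2(4)[OF assms(1)] pair_distinct(4)[of i j] idx2(3)[OF assms(1)]])
    (use assms in auto)

lemma tau_sigma:
  assumes "i \<in> {1..<k}" "x \<in> C"
  shows "\<tau> i (\<sigma> i x) = \<sigma> i (\<tau> i x) + x"
  unfolding \<tau>_def \<sigma>_def
  by (rule t_anticommute[OF idx2(1)[OF assms(1)] idx2(2)[OF assms(1)] n_in_D _ assms(2)])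
    (use idx2(3,4)[OF assms(1)] assms(1) in auto)

lemma sigma_sigma:
  assumes "i \<in> {1..<k}" "j \<in> {1..<k}" "i \<noteq> j" "x \<in> C"
  shows "\<sigma> i (\<sigma> j x) = \<sigma> j (\<sigma> i x) + x"
proof -
  have "distinct [2*i, n, 2*j]" using idx2(3)[OF assms(1)] idx2(3)[OF assms(2)] assms(3) by simp
  from t_anticommute[OF idx2(2)[OF assms(1)] n_in_D idx2(2)[OF assms(2)] this assms(4)]
  show ?thesis unfolding \<sigma>_def by (simp only: t_sym[of n "2*j"])
qed

text \<open>The points \<open>2i - 1\<close> and \<open>2i\<close> contribute \<open>t\<^sub>2\<^sub>i\<^sub>-\<^sub>1\<^sub>,\<^sub>n + t\<^sub>2\<^sub>i\<^sub>,\<^sub>n = \<tau>\<^sub>i\<close> for \<open>i < k\<close>,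
  and the last summand is \<open>\<tau>\<^sub>k\<close>.\<close>

lemma w_tau: "x \<in> C \<Longrightarrow> w n x = (\<Sum>i\<in>{1..k}. \<tau> i x)"
proof -
  assume x: "x \<in> C"
  have "w n x = x + (\<Sum>c\<in>D. t n c x)"
  proof -
    have "(\<Sum>c\<in>D. t n c x) = t n n x + (\<Sum>c\<in>D-{n}. t n c x)"
      by (rule sum.remove) simp_all
    thus ?thesis using x by (simp add: w_def)
  qed
  also have "(\<Sum>c\<in>D. t n c x) = (\<Sum>i\<in>{1..k}. t n (2*i-1) x + t n (2*i) x)"
    unfolding D_def using n_def by (simp only: sum_atLeast1_even)
  also have "\<dots> = (t n (2*k-1) x + t n (2*k) x) + (\<Sum>i\<in>{1..<k}. t n (2*i-1) x + t n (2*i) x)"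
  proof -
    have "{1..k} = insert k {1..<k}" using k_ge by auto
    thus ?thesis by simp
  qed
  also have "(\<Sum>i\<in>{1..<k}. t n (2*i-1) x + t n (2*i) x) = (\<Sum>i\<in>{1..<k}. \<tau> i x)"
  proof (rule sum.cong)
    fix i assume i: "i \<in> {1..<k}"
    have "t (2*i-1) (2*i) x = t (2*i-1) n x + t n (2*i) x"
      by (rule t_split) (use i idx2[OF i] x in auto)
    thus "t n (2*i-1) x + t n (2*i) x = \<tau> i x" by (simp only: \<tau>_def t_sym[of n "2*i-1"] t_sym[of n "2*i"])
  qed simp
  also have "x + (t n (2*k-1) x + t n (2*k) x + (\<Sum>i\<in>{1..<k}. \<tau> i x)) = \<tau> k x + (\<Sum>i\<in>{1..<k}. \<tau> i x)"
  proof -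
    have "t n (2*k) x = x" using t_refl[OF x, of n] n_def by simp
    moreover have "t n (2*k-1) x = \<tau> k x"
      unfolding \<tau>_def by (subst t_sym) (simp flip: n_def)
    ultimately have "t n (2*k) x = x" "t n (2*k-1) x = \<tau> k x" by blast+
    thus ?thesis using add_cancel_around[of x "\<tau> k x"] by simp
  qed
  also have "\<dots> = (\<Sum>i\<in>{1..k}. \<tau> i x)"
  proof -
    have "{1..k} = insert k {1..<k}" using k_ge by auto
    thus ?thesis by simp
  qed
  finally show ?thesis .
qed

text \<open>If \<open>u\<close> is fixed by the earlier \<open>\<tau>\<close> and not by \<open>\<tau>\<^sub>j\<close>, replace it by \<open>u + \<tau>\<^sub>j u \<noteq> 0\<close>.\<close>

lemma ex_tau_fixed: "j \<le> k \<Longrightarrow> \<exists>u\<in>C. u \<noteq> 0 \<and> (\<forall>i\<in>{1..j}. \<tau> i u = u)"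
proof (induction j)
  case 0
  thus ?case using C_nonzero C_zero by auto
next
  case (Suc j)
  then obtain u where u: "u \<in> C" "u \<noteq> 0" "\<And>i. i \<in> {1..j} \<Longrightarrow> \<tau> i u = u" by auto
  let ?i = "Suc j"
  have i: "?i \<in> {1..k}" using Suc by auto
  have D: "{1..Suc j} = insert ?i {1..j}" by auto
  show ?case
  proof (cases "u + \<tau> ?i u = 0")
    case True
    hence "\<tau> ?i u = u" by (metis eq_if_add_zero)
    thus ?thesis using u D by auto
  next
    case False
    have "\<tau> ?i (u + \<tau> ?i u) = u + \<tau> ?i u"
      using i u by (simp add: tau_add tau_sq add.commute)
    moreover have "\<tau> l (u + \<tau> ?i u) = u + \<tau> ?i u" if l: "l \<in> {1..j}" for l
    proof -
      have "l \<in> {1..k}" using l Suc by auto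
      thus ?thesis using i u l tau_commute[of l ?i u] by (simp add: tau_add)
    qed
    ultimately show ?thesis using False u i D by (intro bexI[of _ "u + \<tau> ?i u"]) auto
  qed
qed

text \<open>A common fixed vector of all \<open>\<tau>\<^sub>i\<close> is an eigenvector of the central operator
  \<open>w = \<Sum>\<^sub>i \<tau>\<^sub>i\<close>.\<close>

lemma w_scalar:
  assumes "a \<in> D" "x \<in> C" shows "w a x = of_nat k *s x"
proof -
  obtain u where u: "u \<in> C" "u \<noteq> 0" "\<And>i. i \<in> {1..k} \<Longrightarrow> \<tau> i u = u"
    using ex_tau_fixed[of k] by auto
  have "w n u = (\<Sum>i\<in>{1..k}. u)" using u by (simp add: w_tau)
  also have "\<dots> = of_nat k *s u" by (simp only: sum_const_scale card_atLeastAtMost diff_Suc_1)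
  finally have un: "w n u = of_nat k *s u" .
  have "w n x = of_nat k *s x"
    by (rule scalar_if_eigenvector[of "w n" u])
      (use u un assms in \<open>auto simp: w_comm w_add w_scale\<close>)
  thus ?thesis using w_eq[of a n x] assms by simp
qed

text \<open>Let \<open>a \<notin> A\<close> and \<open>b \<in> A\<close>. In \<open>w a = k\<close> write \<open>t\<^sub>a\<^sub>c = t\<^sub>a\<^sub>b + t\<^sub>b\<^sub>c\<close> for the
  points \<open>c \<in> A - {b}\<close>. As \<open>card A\<close> is odd, \<open>t\<^sub>a\<^sub>b\<close> survives exactly once, and it equals a sum of a
  scalar and transpositions inside \<open>A\<close> or inside its complement. So commuting with the latter is enough.\<close>

lemma commute_of_stabilizer:
  assumes A: "A \<subseteq> D" "odd (card A)"
    and f_closed: "\<And>x. x \<in> C \<Longrightarrow> f x \<in> C"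
    and f_add: "\<And>x y. x \<in> C \<Longrightarrow> y \<in> C \<Longrightarrow> f (x + y) = f x + f y"
    and f_scale: "\<And>c x. x \<in> C \<Longrightarrow> f (c *s x) = c *s f x"
    and comm: "\<And>a b x. a \<in> D \<Longrightarrow> b \<in> D \<Longrightarrow> a \<in> A \<longleftrightarrow> b \<in> A \<Longrightarrow> x \<in> C \<Longrightarrow> f (t a b x) = t a b (f x)"
    and ab: "a \<in> D" "b \<in> D" and x: "x \<in> C"
  shows "f (t a b x) = t a b (f x)"
proof -
  have f_sum: "f (sum g I) = (\<Sum>i\<in>I. f (g i))" if "finite I" "\<And>i. i \<in> I \<Longrightarrow> g i \<in> C" for g and I :: "nat set"
    using that
  proof (induction I rule: finite_induct)
    case empty
    show ?case using f_scale[of 0 0] by simp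
  next
    case (insert i I)
    hence "g i \<in> C" "sum g I \<in> C" by (auto intro: C_sum)
    thus ?case using insert by (simp add: f_add)
  qed
  have formula: "t a b x = of_nat k *s x + (\<Sum>c\<in>D-A-{a}. t a c x) + (\<Sum>c\<in>A-{b}. t b c x)"
    if "a \<in> D - A" "b \<in> A" "x \<in> C" for a b x
  proof -
    have fin: "finite A" using finite_subset[OF A(1)] by simp
    have split: "D - {a} = (D - A - {a}) \<union> A" using that A by auto
    have "of_nat k *s x = w a x" using that by (simp add: w_scalar)
    also have "\<dots> = (\<Sum>c\<in>D-A-{a}. t a c x) + (\<Sum>c\<in>A. t a c x)"
      unfolding w_def split using fin by (intro sum.union_disjoint) auto
    also have "(\<Sum>c\<in>A. t a c x) = t a b x + (\<Sum>c\<in>A-{b}. t a c x)"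
      using that fin by (simp add: sum.remove)
    also have "(\<Sum>c\<in>A-{b}. t a c x) = (\<Sum>c\<in>A-{b}. t a b x + t b c x)"
      using that A by (intro sum.cong refl t_split) auto
    also have "\<dots> = (\<Sum>c\<in>A-{b}. t b c x)"
      using A that fin by (simp add: sum.distrib sum_const card_Diff_singleton_if)
    finally have "of_nat k *s x = (\<Sum>c\<in>D-A-{a}. t a c x) + (t a b x + (\<Sum>c\<in>A-{b}. t b c x))" .
    hence "of_nat k *s x + (\<Sum>c\<in>D-A-{a}. t a c x) = t a b x + (\<Sum>c\<in>A-{b}. t b c x)"
      by (simp add: add.commute)
    thus ?thesis by (simp add: add.assoc)
  qed
  have main: "f (t a b x) = t a b (f x)" if "a \<in> D - A" "b \<in> A" for a b
  proof -
    have "f (t a b x) = of_nat k *s f x + (\<Sum>c\<in>D-A-{a}. f (t a c x)) + (\<Sum>c\<in>A-{b}. f (t b c x))"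
    proof -
      have "f (t a b x) = f (of_nat k *s x + (\<Sum>c\<in>D-A-{a}. t a c x) + (\<Sum>c\<in>A-{b}. t b c x))"
        using formula[OF that x] by simp
      also have "\<dots> = of_nat k *s f x + f (\<Sum>c\<in>D-A-{a}. t a c x) + f (\<Sum>c\<in>A-{b}. t b c x)"
      proof -
        have c1: "(\<Sum>c\<in>D-A-{a}. t a c x) \<in> C" using that x by (intro C_sum) auto
        have c2: "(\<Sum>c\<in>A-{b}. t b c x) \<in> C" using that x A by (intro C_sum t_closed) auto
        show ?thesis using c1 c2 x by (simp add: f_add f_scale)
      qed
      also have "f (\<Sum>c\<in>D-A-{a}. t a c x) = (\<Sum>c\<in>D-A-{a}. f (t a c x))"
        using that x by (intro f_sum) auto
      also have "f (\<Sum>c\<in>A-{b}. t b c x) = (\<Sum>c\<in>A-{b}. f (t b c x))"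
        using that x A finite_subset[OF A(1) finite_D] by (intro f_sum) auto
      finally show ?thesis .
    qed
    also have "(\<Sum>c\<in>D-A-{a}. f (t a c x)) = (\<Sum>c\<in>D-A-{a}. t a c (f x))"
      using that x by (intro sum.cong refl comm) auto
    also have "(\<Sum>c\<in>A-{b}. f (t b c x)) = (\<Sum>c\<in>A-{b}. t b c (f x))"
      using that x A by (intro sum.cong refl comm) auto
    also have "of_nat k *s f x + (\<Sum>c\<in>D-A-{a}. t a c (f x)) + (\<Sum>c\<in>A-{b}. t b c (f x)) = t a b (f x)"
      using formula[OF that f_closed[OF x]] by simp
    finally show ?thesis .
  qed
  consider "a \<in> A \<longleftrightarrow> b \<in> A" | "a \<in> D - A" "b \<in> A" | "b \<in> D - A" "a \<in> A" using ab by blast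
  thus ?thesis
  proof cases
    case 1 show ?thesis by (rule comm[OF ab 1 x])
  next
    case 2 thus ?thesis by (rule main)
  next
    case 3 thus ?thesis unfolding t_sym[of a b] by (rule main)
  qed
qed

end

section \<open>The Fock basis of a spin representation\<close>

context spin_rep
begin

definition K :: "nat set" where "K = {1..<k}"

lemma finite_K [simp]: "finite K" unfolding K_def by simp

lemma K_k: "i \<in> K \<Longrightarrow> i \<in> {1..k}" "i \<in> K \<Longrightarrow> i \<in> {1..<k}" unfolding K_def by auto

text \<open>The \<open>\<sigma>\<^sub>i\<close> commute up to the constant 1 (\<open>sigma_sigma\<close>). Adding the earlier \<open>\<tau>\<^sub>j\<close> cancels these
  constants, and the relations between \<open>\<tau>\<close> and \<open>\<sigma>\<close> are kept.\<close>

definition s :: "nat \<Rightarrow> 'b \<Rightarrow> 'b" where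
  "s i x = \<sigma> i x + (\<Sum>j\<in>{1..<i}. \<tau> j x)"

lemma below_K: "i \<in> K \<Longrightarrow> j \<in> {1..<i} \<Longrightarrow> j \<in> K" unfolding K_def by auto

lemma s_closed [simp]: "i \<in> K \<Longrightarrow> x \<in> C \<Longrightarrow> s i x \<in> C"
proof -
  assume *: "i \<in> K" "x \<in> C"
  have "(\<Sum>j\<in>{1..<i}. \<tau> j x) \<in> C"
    using * K_k(1)[OF below_K[OF *(1)]] by (intro C_sum tau_closed) auto
  thus ?thesis unfolding s_def using * K_k(1)[OF *(1)] by simp
qed

lemma s_add: "i \<in> K \<Longrightarrow> x \<in> C \<Longrightarrow> y \<in> C \<Longrightarrow> s i (x + y) = s i x + s i y"
proof -
  assume *: "i \<in> K" "x \<in> C" "y \<in> C"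
  have "(\<Sum>j\<in>{1..<i}. \<tau> j (x + y)) = (\<Sum>j\<in>{1..<i}. \<tau> j x + \<tau> j y)"
    using * K_k(1)[OF below_K[OF *(1)]] by (intro sum.cong refl tau_add) auto
  thus ?thesis unfolding s_def using * K_k(1)[OF *(1)] by (simp add: sigma_add sum.distrib ac_simps)
qed

lemma s_scale: "i \<in> K \<Longrightarrow> x \<in> C \<Longrightarrow> s i (c *s x) = c *s s i x"
proof -
  assume *: "i \<in> K" "x \<in> C"
  have "(\<Sum>j\<in>{1..<i}. \<tau> j (c *s x)) = (\<Sum>j\<in>{1..<i}. c *s \<tau> j x)"
    using * K_k(1)[OF below_K[OF *(1)]] by (intro sum.cong refl tau_scale) auto
  thus ?thesis unfolding s_def using * K_k(1)[OF *(1)] by (simp add: sigma_scale scale_right_distrib scale_sum_right)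
qed

lemma s_zero [simp]: "i \<in> K \<Longrightarrow> s i 0 = 0"
  using s_scale[of i 0 0] by simp

lemma s_sum: "i \<in> K \<Longrightarrow> (\<And>j. j \<in> I \<Longrightarrow> g j \<in> C) \<Longrightarrow> s i (sum g I) = (\<Sum>j\<in>I. s i (g j))"
  by (induction I rule: infinite_finite_induct) (auto simp: s_add C_sum)

lemma below_closed:
  assumes "j \<in> K" "x \<in> C"
  shows "l \<in> {1..<j} \<Longrightarrow> \<tau> l x \<in> C" "(\<Sum>l\<in>{1..<j}. \<tau> l x) \<in> C"
  using assms K_k(1)[OF below_K[OF assms(1)]] by (auto intro!: C_sum tau_closed)

lemma tau_s:
  assumes "i \<in> K" "j \<in> K" "x \<in> C"
  shows "\<tau> i (s j x) = s j (\<tau> i x) + (if i = j then x else 0)"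
proof -
  note i = K_k[OF assms(1)] and j = K_k[OF assms(2)]
  have "\<tau> i (s j x) = \<tau> i (\<sigma> j x) + (\<Sum>l\<in>{1..<j}. \<tau> i (\<tau> l x))"
    unfolding s_def using tau_add[OF i(1) sigma_closed[OF j(1) assms(3)] below_closed(2)[OF assms(2,3)]]
      tau_sum[OF i(1) below_closed(1)[OF assms(2,3)], of "{1..<j}" "\<lambda>l. l"] by simp
  also have "(\<Sum>l\<in>{1..<j}. \<tau> i (\<tau> l x)) = (\<Sum>l\<in>{1..<j}. \<tau> l (\<tau> i x))"
    using assms i K_k(1)[OF below_K[OF assms(2)]] by (intro sum.cong refl tau_commute) auto
  finally show ?thesis
    unfolding s_def using tau_sigma[OF i(2) assms(3)] tau_sigma_commute[OF i(2) j(2) _ assms(3)]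
    by (auto simp: ac_simps)
qed

lemma sigma_s:
  assumes "i \<in> K" "j \<in> K" "x \<in> C" "i \<noteq> j"
  shows "\<sigma> i (s j x) = s j (\<sigma> i x) + x + (if i < j then x else 0)"
proof -
  note i = K_k[OF assms(1)] and j = K_k[OF assms(2)]
  have "\<sigma> i (s j x) = \<sigma> i (\<sigma> j x) + (\<Sum>l\<in>{1..<j}. \<sigma> i (\<tau> l x))"
    unfolding s_def using sigma_add[OF i(1) sigma_closed[OF j(1) assms(3)] below_closed(2)[OF assms(2,3)]]
      sigma_sum[OF i(1) below_closed(1)[OF assms(2,3)], of "{1..<j}" "\<lambda>l. l"] by simp
  also have "(\<Sum>l\<in>{1..<j}. \<sigma> i (\<tau> l x)) = (\<Sum>l\<in>{1..<j}. \<tau> l (\<sigma> i x) + (if l = i then x else 0))"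
  proof (rule sum.cong)
    fix l assume l: "l \<in> {1..<j}"
    hence lK: "l \<in> {1..<k}" using K_k(2)[OF below_K[OF assms(2)]] by blast
    show "\<sigma> i (\<tau> l x) = \<tau> l (\<sigma> i x) + (if l = i then x else 0)"
      using tau_sigma[OF lK assms(3)] tau_sigma_commute[OF lK i(2) _ assms(3)] by (auto simp: add.assoc)
  qed simp
  also have "\<dots> = (\<Sum>l\<in>{1..<j}. \<tau> l (\<sigma> i x)) + (if i < j then x else 0)"
    using i by (auto simp: sum.distrib)
  finally show ?thesis
    unfolding s_def using sigma_sigma[OF i(2) j(2) assms(4,3)] by (simp add: ac_simps)
qed

lemma s_commute:
  assumes "i \<in> K" "j \<in> K" "x \<in> C"
  shows "s i (s j x) = s j (s i x)"
proof -
  have *: "s i (s j x) = s j (s i x)" if ij: "i < j" "i \<in> K" "j \<in> K" for i j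
  proof -
    have iK: "l \<in> K" if "l \<in> {1..<i}" for l using below_K ij that by blast
    have "s i (s j x) = s j (\<sigma> i x) + (\<Sum>l\<in>{1..<i}. \<tau> l (s j x))"
      unfolding s_def[of i] using sigma_s[OF ij(2,3) assms(3)] ij by (simp add: add.assoc)
    also have "(\<Sum>l\<in>{1..<i}. \<tau> l (s j x)) = (\<Sum>l\<in>{1..<i}. s j (\<tau> l x))"
      using ij assms(3) by (intro sum.cong refl) (auto simp: tau_s[OF iK])
    also have "\<dots> = s j (\<Sum>l\<in>{1..<i}. \<tau> l x)"
      using ij assms(3) K_k(1)[OF iK] by (intro s_sum[symmetric]) auto
    also have "s j (\<sigma> i x) + s j (\<Sum>l\<in>{1..<i}. \<tau> l x) = s j (s i x)"
      unfolding s_def[of i] using ij assms(3) K_k(1)[OF iK] K_k(1)[OF ij(2)]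
      by (intro s_add[symmetric]) (auto intro!: C_sum)
    finally show ?thesis .
  qed
  show ?thesis using *[of i j] *[of j i] assms by (cases i j rule: linorder_cases) auto
qed

lemma sum_tau_sq:
  assumes "\<And>l. l \<in> L \<Longrightarrow> l \<in> {1..k}" "finite L" "x \<in> C"
  shows "(\<Sum>l\<in>L. \<tau> l (\<Sum>m\<in>L. \<tau> m x)) = of_nat (card L) *s x"
  using assms(2,1)
proof (induction L rule: finite_induct)
  case (insert i L)
  have i: "i \<in> {1..k}" and L: "\<And>l. l \<in> L \<Longrightarrow> l \<in> {1..k}" using insert by auto
  have LC: "(\<Sum>m\<in>L. \<tau> m x) \<in> C" using L assms by (intro C_sum) auto
  have "(\<Sum>l\<in>insert i L. \<tau> l (\<Sum>m\<in>insert i L. \<tau> m x))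
    = \<tau> i (\<tau> i x + (\<Sum>m\<in>L. \<tau> m x)) + (\<Sum>l\<in>L. \<tau> l (\<tau> i x + (\<Sum>m\<in>L. \<tau> m x)))"
    using insert by simp
  also have "\<tau> i (\<tau> i x + (\<Sum>m\<in>L. \<tau> m x)) = x + (\<Sum>m\<in>L. \<tau> i (\<tau> m x))"
    using i L LC assms tau_sum[OF i, of L "\<lambda>m. \<tau> m x"] by (simp add: tau_add tau_sq)
  also have "(\<Sum>l\<in>L. \<tau> l (\<tau> i x + (\<Sum>m\<in>L. \<tau> m x))) = (\<Sum>l\<in>L. \<tau> i (\<tau> l x)) + of_nat (card L) *s x"
  proof -
    have "(\<Sum>l\<in>L. \<tau> l (\<tau> i x + (\<Sum>m\<in>L. \<tau> m x))) = (\<Sum>l\<in>L. \<tau> l (\<tau> i x) + \<tau> l (\<Sum>m\<in>L. \<tau> m x))"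
      using i L LC assms by (intro sum.cong refl tau_add) auto
    also have "\<dots> = (\<Sum>l\<in>L. \<tau> l (\<tau> i x)) + of_nat (card L) *s x"
      using insert.IH L by (simp add: sum.distrib)
    also have "(\<Sum>l\<in>L. \<tau> l (\<tau> i x)) = (\<Sum>l\<in>L. \<tau> i (\<tau> l x))"
      using i L assms by (intro sum.cong refl tau_commute) auto
    finally show ?thesis .
  qed
  finally show ?case using insert by (simp add: scale_left_distrib add.assoc)
qed simp

lemma s_sq:
  assumes "i \<in> K" "x \<in> C"
  shows "s i (s i x) = of_nat i *s x"
proof -
  note i = K_k[OF assms(1)]
  let ?L = "{1..<i}"
  have L: "l \<in> {1..k}" "l \<in> {1..<k}" "l \<noteq> i" if "l \<in> ?L" for l
    using that K_k[OF below_K[OF assms(1) that]] by auto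
  let ?T = "\<lambda>x. \<Sum>l\<in>?L. \<tau> l x"
  have TC: "?T x \<in> C" using L(1) assms by (intro C_sum) auto
  have "s i (s i x) = \<sigma> i (\<sigma> i x + ?T x) + ?T (\<sigma> i x + ?T x)" unfolding s_def ..
  also have "\<sigma> i (\<sigma> i x + ?T x) = x + (\<Sum>l\<in>?L. \<sigma> i (\<tau> l x))"
    using i TC assms sigma_sum[OF i(1) below_closed(1)[OF assms], of "{1..<i}" "\<lambda>l. l"]
    by (simp add: sigma_add sigma_sq)
  also have "(\<Sum>l\<in>?L. \<sigma> i (\<tau> l x)) = ?T (\<sigma> i x)"
    using tau_sigma_commute[OF L(2) i(2) L(3) assms(2)] by (intro sum.cong) auto
  also have "?T (\<sigma> i x + ?T x) = (\<Sum>l\<in>?L. \<tau> l (\<sigma> i x) + \<tau> l (?T x))"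
    using L(1) i TC assms by (intro sum.cong refl tau_add) auto
  also have "\<dots> = ?T (\<sigma> i x) + of_nat (card ?L) *s x"
    using sum_tau_sq[of ?L x] L(1) assms by (simp add: sum.distrib)
  finally have "s i (s i x) = x + of_nat (i - 1) *s x" by (simp add: add.assoc)
  also have "\<dots> = of_nat i *s x"
  proof -
    have "i = Suc (i - 1)" using i by auto
    thus ?thesis by (metis of_nat_Suc scale_left_distrib scale_one)
  qed
  finally show ?thesis .
qed

definition vac :: 'b where
  "vac = (SOME u. u \<in> C \<and> u \<noteq> 0 \<and> (\<forall>i\<in>{1..k}. \<tau> i u = u))"

lemma vac: "vac \<in> C" "vac \<noteq> 0" "i \<in> {1..k} \<Longrightarrow> \<tau> i vac = vac"
proof -
  have "\<exists>u. u \<in> C \<and> u \<noteq> 0 \<and> (\<forall>i\<in>{1..k}. \<tau> i u = u)" using ex_tau_fixed[of k] by blast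
  from someI_ex[OF this] show "vac \<in> C" "vac \<noteq> 0" "i \<in> {1..k} \<Longrightarrow> \<tau> i vac = vac"
    unfolding vac_def by auto
qed

text \<open>Extended by the identity to a family of commuting operators on the whole type, as the fold over a set
  requires.\<close>

definition s_total :: "nat \<Rightarrow> 'b \<Rightarrow> 'b" where
  "s_total i x = (if i \<in> K \<and> x \<in> C then s i x else x)"

interpretation s_total: comp_fun_commute s_total
  by unfold_locales (auto simp: fun_eq_iff s_total_def s_commute)

definition fock :: "nat set \<Rightarrow> 'b" where "fock I = Finite_Set.fold s_total vac I"

lemma fock_empty [simp]: "fock {} = vac" unfolding fock_def by simp

lemma fock_insert_total: "finite I \<Longrightarrow> i \<notin> I \<Longrightarrow> fock (insert i I) = s_total i (fock I)"
  unfolding fock_def by (rule s_total.fold_insert)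

lemma fock_closed [simp]: "fock I \<in> C"
proof (cases "finite I")
  case True
  thus ?thesis by induction (auto simp: vac fock_insert_total s_total_def)
qed (simp add: fock_def vac)

lemma fock_insert: "finite I \<Longrightarrow> i \<in> K \<Longrightarrow> i \<notin> I \<Longrightarrow> fock (insert i I) = s i (fock I)"
  by (simp add: fock_insert_total s_total_def)

lemma s_fock:
  assumes "I \<subseteq> K" "i \<in> K"
  shows "s i (fock I) = (if i \<in> I then of_nat i *s fock (I - {i}) else fock (insert i I))"
proof -
  have fin: "finite I" using assms finite_subset[OF _ finite_K] by blast
  show ?thesis
  proof (cases "i \<in> I")
    case True
    have "fock I = s i (fock (I - {i}))"
      using fock_insert[of "I - {i}" i] True assms fin by (simp add: insert_absorb)
    thus ?thesis using True assms by (simp add: s_sq)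
  qed (use assms fin in \<open>simp add: fock_insert\<close>)
qed

lemma tau_fock:
  assumes "I \<subseteq> K" "i \<in> K"
  shows "\<tau> i (fock I) = fock I + (if i \<in> I then fock (I - {i}) else 0)"
proof -
  have "finite I" using assms finite_subset[OF _ finite_K] by blast
  thus ?thesis using assms(1)
  proof (induction I rule: finite_induct)
    case empty
    thus ?case using vac(3)[of i] K_k(1)[OF assms(2)] by simp
  next
    case (insert j I)
    have j: "j \<in> K" "I \<subseteq> K" using insert by auto
    have "\<tau> i (fock (insert j I)) = s j (\<tau> i (fock I)) + (if i = j then fock I else 0)"
      using insert j assms by (simp add: fock_insert tau_s)
    also have "\<tau> i (fock I) = fock I + (if i \<in> I then fock (I - {i}) else 0)"
      using insert by simp
    also have "s j \<dots> = fock (insert j I) + (if i \<in> I then fock (insert j (I - {i})) else 0)"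
      using insert j by (simp add: s_add fock_insert)
    finally show ?case
    proof (cases "i = j")
      case True
      assume "\<tau> i (fock (insert j I)) = fock (insert j I) + (if i \<in> I then fock (insert j (I - {i})) else 0)
        + (if i = j then fock I else 0)"
      thus ?thesis using True insert by simp
    next
      case False
      assume "\<tau> i (fock (insert j I)) = fock (insert j I) + (if i \<in> I then fock (insert j (I - {i})) else 0)
        + (if i = j then fock I else 0)"
      thus ?thesis using False by (simp add: insert_Diff_if)
    qed
  qed
qed

definition comb :: "(nat set \<Rightarrow> 'a) \<Rightarrow> 'b" where
  "comb c = (\<Sum>I\<in>Pow K. c I *s fock I)"

lemma comb_closed [simp]: "comb c \<in> C"
  unfolding comb_def by (intro C_sum) auto

lemma comb_add: "comb c + comb d = comb (\<lambda>I. c I + d I)"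
  unfolding comb_def by (simp add: scale_left_distrib sum.distrib)

lemma comb_scale: "e *s comb c = comb (\<lambda>I. e * c I)"
  unfolding comb_def by (simp add: scale_sum_right)

lemma comb_cong: "(\<And>I. I \<subseteq> K \<Longrightarrow> c I = d I) \<Longrightarrow> comb c = comb d"
  unfolding comb_def by (intro sum.cong) auto

end

context spin_rep
begin

text \<open>The operator \<open>\<tau>\<^sub>i + 1\<close> deletes \<open>i\<close> from the index sets that contain it and kills the other
  basis vectors. This separates the coefficients.\<close>

lemma fock_independent:
  assumes "J \<subseteq> K"
  shows "(\<Sum>I\<in>Pow J. c I *s fock I) = 0 \<Longrightarrow> I \<subseteq> J \<Longrightarrow> c I = 0"
proof -
  have "finite J" using assms finite_subset[OF _ finite_K] by blast
  hence "J \<subseteq> K \<Longrightarrow> \<forall>c. (\<Sum>I\<in>Pow J. c I *s fock I) = 0 \<longrightarrow> (\<forall>I\<subseteq>J. c I = 0)"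
  proof (induction J rule: finite_induct)
    case empty
    show ?case using vac by (auto simp: scale_eq_0_iff)
  next
    case (insert i J)
    have i: "i \<in> K" "J \<subseteq> K" using insert by auto
    show ?case
    proof (intro allI impI)
      fix c I assume sum0: "(\<Sum>I\<in>Pow (insert i J). c I *s fock I) = 0" and I: "I \<subseteq> insert i J"
      let ?A = "\<Sum>I\<in>Pow J. c I *s fock I" and ?B = "\<Sum>I\<in>Pow J. c (insert i I) *s fock (insert i I)"
      let ?C = "\<Sum>I\<in>Pow J. c (insert i I) *s fock I"
      have inj: "inj_on (insert i) (Pow J)" using insert by (auto simp: inj_on_def insert_eq_iff)
      have AB: "?A + ?B = 0"
      proof -
        have "(\<Sum>I\<in>Pow (insert i J). c I *s fock I) = ?A + (\<Sum>I\<in>insert i ` Pow J. c I *s fock I)"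
          unfolding Pow_insert using insert by (intro sum.union_disjoint) auto
        also have "(\<Sum>I\<in>insert i ` Pow J. c I *s fock I) = ?B"
          using inj by (subst sum.reindex) auto
        finally show ?thesis using sum0 by simp
      qed
      have cl: "?A \<in> C" "?B \<in> C" by (auto intro!: C_sum)
      have "\<tau> i ?A = ?A"
      proof -
        have "\<tau> i ?A = (\<Sum>I\<in>Pow J. \<tau> i (c I *s fock I))"
          using K_k(1)[OF i(1)] by (intro tau_sum) auto
        also have "\<dots> = ?A"
        proof (rule sum.cong)
          fix I assume "I \<in> Pow J"
          hence "I \<subseteq> K" "i \<notin> I" using i insert by auto
          thus "\<tau> i (c I *s fock I) = c I *s fock I"
            using K_k(1)[OF i(1)] i by (simp add: tau_scale tau_fock)
        qed simp
        finally show ?thesis .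
      qed
      moreover have "\<tau> i ?B = ?B + ?C"
      proof -
        have "\<tau> i ?B = (\<Sum>I\<in>Pow J. \<tau> i (c (insert i I) *s fock (insert i I)))"
          using K_k(1)[OF i(1)] by (intro tau_sum) auto
        also have "\<dots> = (\<Sum>I\<in>Pow J. c (insert i I) *s fock (insert i I) + c (insert i I) *s fock I)"
        proof (rule sum.cong)
          fix I assume "I \<in> Pow J"
          hence "insert i I \<subseteq> K" "i \<notin> I" using i insert by auto
          thus "\<tau> i (c (insert i I) *s fock (insert i I))
              = c (insert i I) *s fock (insert i I) + c (insert i I) *s fock I"
            using K_k(1)[OF i(1)] i by (simp add: tau_scale tau_fock scale_right_distrib)
        qed simp
        finally show ?thesis by (simp add: sum.distrib)
      qed
      ultimately have "?A + (?B + ?C) = \<tau> i (?A + ?B)" using cl K_k(1)[OF i(1)] by (simp add: tau_add)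
      also have "\<dots> = 0" unfolding AB using tau_scale[OF K_k(1)[OF i(1)] C_zero, of 0] by simp
      finally have C0: "?C = 0" using AB by (simp add: add.assoc[symmetric])
      have c1: "c (insert i I) = 0" if "I \<subseteq> J" for I
        using insert.IH[OF i(2)] C0 that by (auto dest: spec[of _ "\<lambda>I. c (insert i I)"])
      hence "?B = 0" by (intro sum.neutral) auto
      hence "?A = 0" using AB by simp
      hence c0: "c I = 0" if "I \<subseteq> J" for I using insert.IH[OF i(2)] that by auto
      show "c I = 0"
      proof (cases "i \<in> I")
        case True
        have "c (insert i (I - {i})) = 0" using I by (intro c1) auto
        thus ?thesis using True by (simp add: insert_absorb)
      qed (use I c0 in auto)
    qed
  qed
  thus "(\<Sum>I\<in>Pow J. c I *s fock I) = 0 \<Longrightarrow> I \<subseteq> J \<Longrightarrow> c I = 0" using assms by blast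
qed

lemma comb_zeroD: "comb c = 0 \<Longrightarrow> I \<subseteq> K \<Longrightarrow> c I = 0"
  unfolding comb_def by (rule fock_independent[of K]) auto

lemma sum_Pow_split:
  assumes "i \<in> K"
  shows "(\<Sum>I\<in>Pow K. g I) = (\<Sum>I\<in>Pow (K - {i}). g I + (g (insert i I) :: 'b))"
proof -
  have inj: "inj_on (insert i) (Pow (K - {i}))" by (auto simp: inj_on_def insert_eq_iff)
  have "K = insert i (K - {i})" using assms by auto
  hence "Pow K = Pow (K - {i}) \<union> insert i ` Pow (K - {i})" by (metis Pow_insert)
  hence "(\<Sum>I\<in>Pow K. g I) = (\<Sum>I\<in>Pow (K - {i}). g I) + (\<Sum>I\<in>insert i ` Pow (K - {i}). g I)"
    by (simp only:, intro sum.union_disjoint) auto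
  also have "(\<Sum>I\<in>insert i ` Pow (K - {i}). g I) = (\<Sum>I\<in>Pow (K - {i}). g (insert i I))"
    using inj by (subst sum.reindex) auto
  finally show ?thesis by (simp add: sum.distrib)
qed

lemma tau_comb:
  assumes "i \<in> K"
  shows "\<tau> i (comb c) = comb c + comb (\<lambda>I. if i \<in> I then 0 else c (insert i I))"
proof -
  let ?P = "Pow (K - {i})"
  have "\<tau> i (comb c) = (\<Sum>I\<in>Pow K. \<tau> i (c I *s fock I))"
    unfolding comb_def using K_k(1)[OF assms] by (intro tau_sum) auto
  also have "\<dots> = (\<Sum>I\<in>Pow K. c I *s fock I + (if i \<in> I then c I *s fock (I - {i}) else 0))"
    using assms K_k(1)[OF assms]
    by (intro sum.cong) (auto simp: tau_scale tau_fock scale_right_distrib)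
  also have "\<dots> = comb c + (\<Sum>I\<in>Pow K. if i \<in> I then c I *s fock (I - {i}) else 0)"
    unfolding comb_def by (simp add: sum.distrib)
  also have "(\<Sum>I\<in>Pow K. if i \<in> I then c I *s fock (I - {i}) else 0) = (\<Sum>I\<in>?P. c (insert i I) *s fock I)"
    unfolding sum_Pow_split[OF assms] by (intro sum.cong) (auto simp: subset_Diff_insert)
  also have "\<dots> = comb (\<lambda>I. if i \<in> I then 0 else c (insert i I))"
    unfolding comb_def sum_Pow_split[OF assms] by (intro sum.cong) (auto simp: subset_Diff_insert)
  finally show ?thesis .
qed

lemma s_comb:
  assumes "i \<in> K"
  shows "s i (comb c) = comb (\<lambda>I. if i \<in> I then c (I - {i}) else of_nat i * c (insert i I))"
proof -
  let ?P = "Pow (K - {i})"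
  have "s i (comb c) = (\<Sum>I\<in>Pow K. s i (c I *s fock I))"
    unfolding comb_def using assms by (intro s_sum) auto
  also have "\<dots> = (\<Sum>I\<in>Pow K. c I *s (if i \<in> I then of_nat i *s fock (I - {i}) else fock (insert i I)))"
    using assms by (intro sum.cong) (auto simp: s_scale s_fock)
  also have "\<dots> = (\<Sum>I\<in>?P. c I *s fock (insert i I) + c (insert i I) *s (of_nat i *s fock I))"
    unfolding sum_Pow_split[OF assms] by (intro sum.cong) (auto simp: subset_Diff_insert)
  also have "\<dots> = comb (\<lambda>I. if i \<in> I then c (I - {i}) else of_nat i * c (insert i I))"
    unfolding comb_def sum_Pow_split[OF assms]
    by (intro sum.cong) (auto simp: subset_Diff_insert mult.commute add.commute)
  finally show ?thesis .
qed

lemma sigma_s_tau: "x \<in> C \<Longrightarrow> \<sigma> i x = s i x + (\<Sum>j\<in>{1..<i}. \<tau> j x)"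
  unfolding s_def by (simp add: add.assoc)

lemma t_n_even: "i \<in> K \<Longrightarrow> t (2*i) n x = \<sigma> i x"
  unfolding \<sigma>_def ..

lemma t_n_odd: "i \<in> K \<Longrightarrow> x \<in> C \<Longrightarrow> t (2*i-1) n x = \<sigma> i x + \<tau> i x"
proof -
  assume i: "i \<in> K" and x: "x \<in> C"
  have "distinct [2*i-1, 2*i, n]" using idx2(3,4)[OF K_k(2)[OF i]] K_k(2)[OF i] by auto
  from t_split[OF idx2(1,2)[OF K_k(2)[OF i]] n_in_D this x]
  show ?thesis unfolding \<sigma>_def \<tau>_def by (simp add: add.commute)
qed

lemma t_n_last: "x \<in> C \<Longrightarrow> t (2*k-1) n x = of_nat k *s x + (\<Sum>j\<in>K. \<tau> j x)"
proof -
  assume x: "x \<in> C"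
  have "{1..k} = insert k K" using k_ge by (auto simp: K_def)
  moreover have "k \<notin> K" by (simp add: K_def)
  ultimately have "(\<Sum>j\<in>{1..k}. \<tau> j x) = \<tau> k x + (\<Sum>j\<in>K. \<tau> j x)" by simp
  moreover have "(\<Sum>j\<in>{1..k}. \<tau> j x) = of_nat k *s x" using w_scalar[OF n_in_D x] w_tau[OF x] by simp
  ultimately have eq: "of_nat k *s x = \<tau> k x + (\<Sum>j\<in>K. \<tau> j x)" by simp
  have "\<tau> k x = of_nat k *s x + (\<Sum>j\<in>K. \<tau> j x)" unfolding eq by (simp add: add.assoc)
  thus ?thesis unfolding \<tau>_def by (simp flip: n_def)
qed

lemma D_cases:
  assumes "a \<in> D"
  obtains "a = n" | "a = 2*k-1" | i where "i \<in> K" "a = 2*i" | i where "i \<in> K" "a = 2*i-1"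
proof -
  consider "a = n" | "a = 2*k-1" | "a < 2*k-1" using assms n_def unfolding D_def by fastforce
  thus ?thesis
  proof cases
    case 3
    define i where "i = (a + 1) div 2"
    have a1: "1 \<le> a" using assms unfolding D_def by simp
    have "a = 2*i \<or> a = 2*i-1" unfolding i_def using a1 by presburger
    moreover have "1 \<le> i" "i < k" unfolding i_def using a1 3 by presburger+
    ultimately show ?thesis using that unfolding K_def by auto
  qed (use that in blast)+
qed

text \<open>Every transposition is a combination of \<open>t\<^sub>a\<^sub>n\<close>, and these are expressed by \<open>s\<close> and \<open>\<tau>\<close>. So
  the span of the Fock vectors is invariant.\<close>

lemma comb_span: "range comb = C"
proof -
  have sub: "subspace (range comb)"
  proof (rule subspaceI)
    have "comb (\<lambda>_. 0) = 0" unfolding comb_def by simp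
    thus "0 \<in> range comb" by (metis rangeI)
  qed (auto simp: comb_add comb_scale)
  have tau: "\<tau> i x \<in> range comb" if "i \<in> K" "x \<in> range comb" for i x
    using that by (auto simp: tau_comb comb_add)
  have s: "s i x \<in> range comb" if "i \<in> K" "x \<in> range comb" for i x
    using that by (auto simp: s_comb)
  have tn: "t a n x \<in> range comb" if "a \<in> D" and x: "x \<in> range comb" for a x
  proof -
    have xC: "x \<in> C" using x by auto
    have sig: "\<sigma> i x \<in> range comb" if "i \<in> K" for i
      unfolding sigma_s_tau[OF xC] using that x s tau below_K[OF that]
      by (intro subspace_add[OF sub] subspace_sum[OF sub]) auto
    from \<open>a \<in> D\<close> show ?thesis
    proof (cases rule: D_cases)
      case 1 thus ?thesis using x xC by simp
    next
      case 2 thus ?thesis using x xC tau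
        by (simp only: t_n_last) (intro subspace_add[OF sub] subspace_sum[OF sub] subspace_scale[OF sub], auto)
    next
      case (3 i) thus ?thesis using sig by (simp add: t_n_even)
    next
      case (4 i) thus ?thesis using sig tau x xC by (simp only: t_n_odd) (intro subspace_add[OF sub], auto)
    qed
  qed
  have "range comb = {0} \<or> range comb = C"
  proof (rule simple_t[OF sub])
    fix a b x assume ab: "a \<in> D" "b \<in> D" and x: "x \<in> range comb"
    have xC: "x \<in> C" using x by auto
    consider "a = b" | "b = n" | "a = n" | "distinct [a, n, b]" by auto
    thus "t a b x \<in> range comb"
    proof cases
      case 4
      have "t a b x = t a n x + t n b x" by (rule t_split[OF ab(1) n_in_D ab(2) 4 xC])
      thus ?thesis using tn ab x t_sym[of n b] subspace_add[OF sub] by simp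
    next
      case 1 thus ?thesis using x xC by simp
    next
      case 2 thus ?thesis using tn[OF ab(1) x] by simp
    next
      case 3 thus ?thesis using tn[OF ab(2) x] t_sym[of n b] by simp
    qed
  qed auto
  moreover have "comb (\<lambda>I. if I = {} then 1 else 0) = vac"
  proof -
    have "comb (\<lambda>I. if I = {} then 1 else 0) = (\<Sum>I\<in>Pow K. if I = {} then vac else 0)"
      unfolding comb_def by (intro sum.cong) auto
    thus ?thesis by simp
  qed
  hence "vac \<in> range comb" by (metis rangeI)
  ultimately show ?thesis using vac by auto
qed

text \<open>A fixed vector is killed by all \<open>\<tau>\<^sub>i + 1\<close>, which shift the coefficient of every nonempty index set
  to a smaller one. So only the coefficient of the empty set can be nonzero.\<close>

lemma tau_fixed_unique:
  assumes x: "x \<in> C" "\<And>i. i \<in> K \<Longrightarrow> \<tau> i x = x"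
  obtains e where "x = e *s vac"
proof -
  obtain c where c: "x = comb c" using x comb_span by blast
  have "c I = 0" if I: "I \<subseteq> K" "i \<in> I" for I i
  proof -
    have i: "i \<in> K" using I by auto
    let ?d = "\<lambda>I. if i \<in> I then 0 else c (insert i I)"
    have "comb c = comb c + comb ?d" using x(2)[OF i] tau_comb[OF i, of c] c by simp
    hence "comb ?d = 0" by simp
    from comb_zeroD[OF this, of "I - {i}"] show ?thesis using I by (auto simp: insert_absorb)
  qed
  hence "comb c = (\<Sum>I\<in>Pow K. if I = {} then c {} *s vac else 0)"
    unfolding comb_def by (intro sum.cong) auto
  hence "x = c {} *s vac" using c by simp
  thus ?thesis using that by blast
qed

text \<open>The image of the vacuum is again fixed by all \<open>\<tau>\<^sub>i\<close>, hence a multiple of the vacuum.\<close>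

lemma schur:
  assumes f_closed: "\<And>x. x \<in> C \<Longrightarrow> f x \<in> C"
    and f_add: "\<And>x y. x \<in> C \<Longrightarrow> y \<in> C \<Longrightarrow> f (x + y) = f x + f y"
    and f_scale: "\<And>c x. x \<in> C \<Longrightarrow> f (c *s x) = c *s f x"
    and comm: "\<And>a b x. a \<in> D \<Longrightarrow> b \<in> D \<Longrightarrow> x \<in> C \<Longrightarrow> f (t a b x) = t a b (f x)"
  obtains e where "\<And>x. x \<in> C \<Longrightarrow> f x = e *s x"
proof -
  have "\<tau> i (f vac) = f vac" if "i \<in> K" for i
    using comm[OF idx(1,2)[OF K_k(1)[OF that]] vac(1)] vac(3)[OF K_k(1)[OF that]] unfolding \<tau>_def by simp
  then obtain e where "f vac = e *s vac" using tau_fixed_unique[of "f vac"] f_closed vac(1) by blast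
  from scalar_if_eigenvector[OF f_add f_scale comm vac(1,2) this] show ?thesis using that by blast
qed

definition coords :: "'b \<Rightarrow> nat set \<Rightarrow> 'a" where
  "coords x = (SOME c. comb c = x)"

lemma comb_coords:
  assumes "x \<in> C" shows "comb (coords x) = x"
proof -
  obtain c where "comb c = x" using assms comb_span by (metis imageE)
  thus ?thesis unfolding coords_def by (rule someI[of "\<lambda>c. comb c = x"])
qed

lemma comb_eq_iff: "comb c = comb d \<longleftrightarrow> (\<forall>I\<subseteq>K. c I = d I)"
proof
  assume "comb c = comb d"
  hence "comb (\<lambda>I. c I - d I) = 0" unfolding comb_def by (simp add: scale_left_diff_distrib sum_subtractf)
  from comb_zeroD[OF this] show "\<forall>I\<subseteq>K. c I = d I" by auto
qed (auto intro: comb_cong)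

lemma coords_comb: "I \<subseteq> K \<Longrightarrow> coords (comb c) I = c I"
  using comb_coords[of "comb c"] comb_eq_iff by simp

end

text \<open>The matrices of \<open>\<tau>\<^sub>i\<close> and \<open>s\<^sub>i\<close> on the Fock basis, and so those of all transpositions, do not
  depend on the representation. Matching the Fock coordinates is therefore equivariant.\<close>

theorem spin_rep_unique:
  fixes scale1 :: "'f::field \<Rightarrow> 'b::ab_group_add \<Rightarrow> 'b" and scale2 :: "'f \<Rightarrow> 'c::ab_group_add \<Rightarrow> 'c"
  assumes "spin_rep scale1 n C1 \<rho>1 k" and "spin_rep scale2 n C2 \<rho>2 k"
  obtains f where "bij_betw f C1 C2"
    "\<And>x y. x \<in> C1 \<Longrightarrow> y \<in> C1 \<Longrightarrow> f (x + y) = f x + f y"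
    "\<And>e x. x \<in> C1 \<Longrightarrow> f (scale1 e x) = scale2 e (f x)"
    "\<And>p x. p permutes {1..n} \<Longrightarrow> x \<in> C1 \<Longrightarrow> f (\<rho>1 p x) = \<rho>2 p (f x)"
proof -
  interpret V: spin_rep scale1 n C1 \<rho>1 k by fact
  interpret W: spin_rep scale2 n C2 \<rho>2 k by fact
  define f where "f x = W.comb (V.coords x)" for x
  have f_comb: "f (V.comb c) = W.comb c" for c
    unfolding f_def by (rule W.comb_cong) (simp add: V.coords_comb)
  have f_closed: "f x \<in> C2" for x unfolding f_def by simp
  have obt: "\<exists>c. x = V.comb c" if "x \<in> C1" for x using V.comb_coords[OF that] by metis
  have f_add: "f (x + y) = f x + f y" if "x \<in> C1" "y \<in> C1" for x y
    using obt[OF that(1)] obt[OF that(2)] by (auto simp: V.comb_add W.comb_add f_comb)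
  have f_scale: "f (scale1 e x) = scale2 e (f x)" if "x \<in> C1" for e x
    using obt[OF that] by (auto simp: V.comb_scale W.comb_scale f_comb)
  have f_zero: "f 0 = 0" using f_scale[of 0 0] by simp
  have f_sum: "f (sum g I) = (\<Sum>i\<in>I. f (g i))" if "\<And>i. i \<in> I \<Longrightarrow> g i \<in> C1" for g and I :: "nat set"
    using that
  proof (induction I rule: infinite_finite_induct)
    case (insert i I)
    hence "g i \<in> C1" "sum g I \<in> C1" by (auto intro: V.C_sum)
    thus ?case using insert by (simp add: f_add)
  qed (simp_all add: f_zero)
  have f_tau: "f (V.\<tau> i x) = W.\<tau> i (f x)" if "i \<in> V.K" "x \<in> C1" for i x
    using obt[OF that(2)] that(1) by (auto simp: V.tau_comb W.tau_comb f_comb f_add)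
  have f_s: "f (V.s i x) = W.s i (f x)" if "i \<in> V.K" "x \<in> C1" for i x
    using obt[OF that(2)] that(1) by (auto simp: V.s_comb W.s_comb f_comb)
  have f_sigma: "f (V.\<sigma> i x) = W.\<sigma> i (f x)" if i: "i \<in> V.K" and x: "x \<in> C1" for i x
  proof -
    have "f (V.\<sigma> i x) = f (V.s i x) + (\<Sum>j\<in>{1..<i}. f (V.\<tau> j x))"
      unfolding V.sigma_s_tau[OF x]
      using f_add[OF V.s_closed[OF i x] V.below_closed(2)[OF i x]]
        f_sum[OF V.below_closed(1)[OF i x], of "{1..<i}" "\<lambda>j. j"] by simp
    also have "(\<Sum>j\<in>{1..<i}. f (V.\<tau> j x)) = (\<Sum>j\<in>{1..<i}. W.\<tau> j (f x))"
      using f_tau[OF V.below_K[OF i] x] by (intro sum.cong) auto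
    finally show ?thesis using f_s[OF i x] W.sigma_s_tau[OF f_closed] by simp
  qed
  have f_tn: "f (V.t a n x) = W.t a n (f x)" if a: "a \<in> V.D" and x: "x \<in> C1" for a x
    using a
  proof (cases rule: V.D_cases)
    case 1 thus ?thesis using x f_closed by simp
  next
    case 2
    have "f (V.t (2*k-1) n x) = f (scale1 (of_nat k) x) + (\<Sum>j\<in>V.K. f (V.\<tau> j x))"
      unfolding V.t_n_last[OF x] using x V.K_k(1)
      by (subst f_add) (auto intro!: V.C_sum f_sum V.tau_closed)
    also have "(\<Sum>j\<in>V.K. f (V.\<tau> j x)) = (\<Sum>j\<in>W.K. W.\<tau> j (f x))"
      using f_tau x by simp
    finally show ?thesis using 2 W.t_n_last[OF f_closed] f_scale[OF x] by simp
  next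
    case (3 i) thus ?thesis using f_sigma x by (simp add: V.t_n_even W.t_n_even)
  next
    case (4 i)
    have "f (V.t (2*i-1) n x) = f (V.\<sigma> i x) + f (V.\<tau> i x)"
      unfolding V.t_n_odd[OF 4(1) x] using V.K_k(1)[OF 4(1)] x by (intro f_add) auto
    thus ?thesis using 4 f_sigma f_tau x W.t_n_odd[of i "f x"] f_closed by simp
  qed
  have f_t: "f (V.t a b x) = W.t a b (f x)" if ab: "a \<in> V.D" "b \<in> V.D" and x: "x \<in> C1" for a b x
  proof -
    consider "a = b" | "b = n" | "a = n" | "distinct [a, n, b]" by auto
    thus ?thesis
    proof cases
      case 4
      have "f (V.t a b x) = f (V.t a n x) + f (V.t b n x)"
        unfolding V.t_split[OF ab(1) V.n_in_D ab(2) 4 x] V.t_sym[of n b]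
        using ab x by (intro f_add) auto
      thus ?thesis
        using W.t_split[OF _ W.n_in_D _ 4 f_closed] f_tn ab x by (simp add: W.t_sym[of n b])
    next
      case 1 thus ?thesis using x f_closed by simp
    next
      case 2 thus ?thesis using f_tn ab x by simp
    next
      case 3 thus ?thesis using f_tn ab x by (simp add: V.t_sym[of n b] W.t_sym[of n b])
    qed
  qed
  show ?thesis
  proof (rule that)
    show "bij_betw f C1 C2"
    proof (rule bij_betw_imageI)
      show "inj_on f C1"
      proof (rule inj_onI)
        fix x y assume "x \<in> C1" "y \<in> C1" and eq: "f x = f y"
        then obtain c d where cd: "x = V.comb c" "y = V.comb d" using obt by blast
        hence "\<forall>I\<subseteq>V.K. c I = d I" using eq f_comb W.comb_eq_iff by simp
        thus "x = y" using cd V.comb_eq_iff by simp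
      qed
      show "f ` C1 = C2"
      proof
        show "C2 \<subseteq> f ` C1"
        proof
          fix y assume "y \<in> C2"
          then obtain c where "y = W.comb c" using W.comb_span by (metis imageE)
          hence "y = f (V.comb c)" by (simp add: f_comb)
          thus "y \<in> f ` C1" using V.comb_closed by blast
        qed
      qed (use f_closed in blast)
    qed
    show "f (x + y) = f x + f y" if "x \<in> C1" "y \<in> C1" for x y using f_add that .
    show "f (scale1 e x) = scale2 e (f x)" if "x \<in> C1" for e x using f_scale that .
    show "f (\<rho>1 p x) = \<rho>2 p (f x)" if "p permutes {1..n}" "x \<in> C1" for p x
      by (rule V.intertwine_all[OF f_t[unfolded W.t_def] W.rho_id[OF f_closed]
            W.rho_comp[OF _ _ f_closed] that])
  qed
qed

section \<open>Modules in coordinates\<close>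

abbreviation fscale :: "'f::field \<Rightarrow> ('x \<Rightarrow> 'f) \<Rightarrow> 'x \<Rightarrow> 'f" where
  "fscale c f \<equiv> \<lambda>i. c * f i"

lemma vector_space_fscale: "vector_space (fscale :: 'f::field \<Rightarrow> ('x \<Rightarrow> 'f) \<Rightarrow> _)"
  by unfold_locales (auto simp: fun_eq_iff algebra_simps)

text \<open>Coordinate functions with respect to a basis \<open>B\<close> that are extended by zero live in a type of class
  vector space. This is the bridge from carrier-based modules to the results above.\<close>

lemma exists_coordinates:
  fixes V :: "('f::field, 'v, 'm) module_scheme"
  assumes "vectorspace class_ring V" and "vectorspace.fin_dim class_ring V"
  obtains \<kappa> :: "'v \<Rightarrow> 'v \<Rightarrow> 'f" and B where
    "inj_on \<kappa> (carrier V)"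
    "\<And>x y. x \<in> carrier V \<Longrightarrow> y \<in> carrier V \<Longrightarrow> \<kappa> (x \<oplus>\<^bsub>V\<^esub> y) = \<kappa> x + \<kappa> y"
    "\<And>c x. x \<in> carrier V \<Longrightarrow> \<kappa> (c \<odot>\<^bsub>V\<^esub> x) = fscale c (\<kappa> x)"
    "finite B" "B \<subseteq> carrier V" "LinearCombinations.module.span class_ring V B = carrier V"
    "\<And>x b. b \<notin> B \<Longrightarrow> \<kappa> x b = 0"
proof -
  let ?K = "class_ring :: 'f ring"
  interpret vectorspace ?K V by fact
  obtain B where B: "finite B" "basis B" using finite_basis_exists[OF assms(2)] by blast
  hence BV: "B \<subseteq> carrier V" unfolding basis_def by blast
  have ex1: "\<exists>!a. a \<in> B \<rightarrow>\<^sub>E carrier ?K \<and> lincomb a B = x" if "x \<in> carrier V" for x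
    using basis_criterion[OF B(1) BV] B(2) that by blast
  interpret lin: linear_map ?K "class_ring.func_space B" V "\<lambda>a. lincomb a B"
    by (rule lincomb_is_linear[OF B(1) BV])
  define co where "co x = (THE a. a \<in> B \<rightarrow>\<^sub>E carrier ?K \<and> lincomb a B = x)" for x
  have co: "co x \<in> B \<rightarrow>\<^sub>E carrier ?K" "lincomb (co x) B = x" if "x \<in> carrier V" for x
    using theI'[OF ex1[OF that]] unfolding co_def by auto
  have coI: "co x = a" if "a \<in> B \<rightarrow>\<^sub>E carrier ?K" "lincomb a B = x" "x \<in> carrier V" for a x
    using ex1[OF that(3)] co[OF that(3)] that by blast
  have co_fs: "co x \<in> carrier (class_ring.func_space B)" if "x \<in> carrier V" for x
    using co(1)[OF that] by (simp add: class_ring.func_space_def)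
  have K: "carrier ?K = UNIV" "add ?K = (+)" "mult ?K = (*)" by simp_all
  define \<kappa> where "\<kappa> x = (\<lambda>b. if b \<in> B then co x b else 0)" for x
  show ?thesis
  proof (rule that)
    show "inj_on \<kappa> (carrier V)"
    proof (rule inj_onI)
      fix x y assume xy: "x \<in> carrier V" "y \<in> carrier V" and eq: "\<kappa> x = \<kappa> y"
      have "co x = co y"
      proof (rule PiE_ext[OF co(1)[OF xy(1)] co(1)[OF xy(2)]])
        fix b assume "b \<in> B" thus "co x b = co y b" using fun_cong[OF eq, of b] by (simp add: \<kappa>_def)
      qed
      thus "x = y" using co(2) xy by metis
    qed
  next
    fix x y assume xy: "x \<in> carrier V" "y \<in> carrier V"
    have "co (x \<oplus>\<^bsub>V\<^esub> y) = co x \<oplus>\<^bsub>class_ring.func_space B\<^esub> co y"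
    proof (rule coI)
      show "co x \<oplus>\<^bsub>class_ring.func_space B\<^esub> co y \<in> B \<rightarrow>\<^sub>E carrier ?K"
        by (simp add: class_ring.func_space_def K)
      show "lincomb (co x \<oplus>\<^bsub>class_ring.func_space B\<^esub> co y) B = x \<oplus>\<^bsub>V\<^esub> y"
        using lin.T_add[OF co_fs co_fs] xy co(2) by simp
    qed (use xy in simp)
    thus "\<kappa> (x \<oplus>\<^bsub>V\<^esub> y) = \<kappa> x + \<kappa> y"
      by (auto simp: \<kappa>_def fun_eq_iff class_ring.func_space_def K)
  next
    fix c x assume x: "x \<in> carrier V"
    have "co (c \<odot>\<^bsub>V\<^esub> x) = c \<odot>\<^bsub>class_ring.func_space B\<^esub> co x"
    proof (rule coI)
      show "c \<odot>\<^bsub>class_ring.func_space B\<^esub> co x \<in> B \<rightarrow>\<^sub>E carrier ?K"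
        by (simp add: class_ring.func_space_def K)
      show "lincomb (c \<odot>\<^bsub>class_ring.func_space B\<^esub> co x) B = c \<odot>\<^bsub>V\<^esub> x"
        using lin.T_smult[OF _ co_fs[OF x]] x co(2) K by simp
    qed (use x K in simp)
    thus "\<kappa> (c \<odot>\<^bsub>V\<^esub> x) = fscale c (\<kappa> x)"
      by (auto simp: \<kappa>_def fun_eq_iff class_ring.func_space_def K)
  next
    show "finite B" "B \<subseteq> carrier V" by fact+
    show "span B = carrier V" using B(2) unfolding basis_def by blast
    show "\<kappa> x b = 0" if "b \<notin> B" for x b using that by (simp add: \<kappa>_def)
  qed
qed

lemma subspace_iff:
  assumes "vectorspace (class_ring :: 'f::field ring) V"
  shows "VectorSpace.subspace class_ring W V \<longleftrightarrow> W \<subseteq> carrier V \<and> \<zero>\<^bsub>V\<^esub> \<in> W \<and>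
    (\<forall>x\<in>W. \<forall>y\<in>W. x \<oplus>\<^bsub>V\<^esub> y \<in> W) \<and> (\<forall>c. \<forall>x\<in>W. c \<odot>\<^bsub>V\<^esub> x \<in> W)"
  using assms unfolding VectorSpace.subspace_def submodule_def vectorspace_def by auto

context group_module
begin

lemma add_closed [simp, intro]: "x \<in> carrier V \<Longrightarrow> y \<in> carrier V \<Longrightarrow> x \<oplus>\<^bsub>V\<^esub> y \<in> carrier V"
  by simp

lemma sm_closed [simp, intro]: "x \<in> carrier V \<Longrightarrow> c \<odot>\<^bsub>V\<^esub> x \<in> carrier V"
  by (rule smult_closed) simp_all

lemma act_closed [simp, intro]: "g \<in> carrier G \<Longrightarrow> x \<in> carrier V \<Longrightarrow> act V g x \<in> carrier V"
  using LinearCombinations.module_hom_closed[OF act_linear] by blast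

lemma act_add: "g \<in> carrier G \<Longrightarrow> x \<in> carrier V \<Longrightarrow> y \<in> carrier V \<Longrightarrow>
    act V g (x \<oplus>\<^bsub>V\<^esub> y) = act V g x \<oplus>\<^bsub>V\<^esub> act V g y"
  using LinearCombinations.module_hom_add[OF act_linear] by blast

lemma act_smult: "g \<in> carrier G \<Longrightarrow> x \<in> carrier V \<Longrightarrow> act V g (c \<odot>\<^bsub>V\<^esub> x) = c \<odot>\<^bsub>V\<^esub> act V g x"
  using LinearCombinations.module_hom_smult[OF act_linear] by simp

lemma smult_0 [simp]: "x \<in> carrier V \<Longrightarrow> 0 \<odot>\<^bsub>V\<^esub> x = \<zero>\<^bsub>V\<^esub>"
  using smult_l_null[of x] by simp

lemma smult_1 [simp]: "x \<in> carrier V \<Longrightarrow> 1 \<odot>\<^bsub>V\<^esub> x = x"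
  using smult_one[of x] by simp

lemma smult_zero [simp]: "c \<odot>\<^bsub>V\<^esub> \<zero>\<^bsub>V\<^esub> = \<zero>\<^bsub>V\<^esub>"
  using smult_r_null[of c] by simp

lemma smult_mult: "x \<in> carrier V \<Longrightarrow> (c * d) \<odot>\<^bsub>V\<^esub> x = c \<odot>\<^bsub>V\<^esub> (d \<odot>\<^bsub>V\<^esub> x)"
  using smult_assoc1[of c d x] by simp

lemma smult_plus: "x \<in> carrier V \<Longrightarrow> (c + d) \<odot>\<^bsub>V\<^esub> x = c \<odot>\<^bsub>V\<^esub> x \<oplus>\<^bsub>V\<^esub> d \<odot>\<^bsub>V\<^esub> x"
  using smult_l_distr[of c d x] by simp

lemma smult_add: "x \<in> carrier V \<Longrightarrow> y \<in> carrier V \<Longrightarrow> c \<odot>\<^bsub>V\<^esub> (x \<oplus>\<^bsub>V\<^esub> y) = c \<odot>\<^bsub>V\<^esub> x \<oplus>\<^bsub>V\<^esub> c \<odot>\<^bsub>V\<^esub> y"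
  using smult_r_distr[of c x y] by simp

lemma act_zero [simp]: "g \<in> carrier G \<Longrightarrow> act V g \<zero>\<^bsub>V\<^esub> = \<zero>\<^bsub>V\<^esub>"
  using act_smult[of g "\<zero>\<^bsub>V\<^esub>" 0] by simp

lemma grp_submodule_iff:
  "grp_submodule G V W \<longleftrightarrow> W \<subseteq> carrier V \<and> \<zero>\<^bsub>V\<^esub> \<in> W \<and> (\<forall>x\<in>W. \<forall>y\<in>W. x \<oplus>\<^bsub>V\<^esub> y \<in> W) \<and>
    (\<forall>c. \<forall>x\<in>W. c \<odot>\<^bsub>V\<^esub> x \<in> W) \<and> (\<forall>g\<in>carrier G. \<forall>w\<in>W. act V g w \<in> W)"
  unfolding grp_submodule_def subspace_iff[OF vectorspace_axioms] by blast

lemma span_grp_submodule: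
  assumes S: "S \<subseteq> carrier V" and inv: "\<And>g x. g \<in> carrier G \<Longrightarrow> x \<in> S \<Longrightarrow> act V g x \<in> S"
  shows "grp_submodule G V (span S)"
proof -
  interpret sp: submodule class_ring "span S" V by (rule span_is_submodule[OF S])
  have act_span: "act V g x \<in> span S" if g: "g \<in> carrier G" and x: "x \<in> span S" for g x
  proof -
    let ?W = "{x \<in> carrier V. act V g x \<in> span S}"
    have "submodule class_ring ?W V"
    proof
      show "?W \<subseteq> carrier V" by blast
      show "v \<oplus>\<^bsub>V\<^esub> w \<in> ?W" if "v \<in> ?W" "w \<in> ?W" for v w
        using that g by (auto simp: act_add)
      show "\<zero>\<^bsub>V\<^esub> \<in> ?W" using g by simp
      show "c \<odot>\<^bsub>V\<^esub> v \<in> ?W" if "c \<in> carrier class_ring" "v \<in> ?W" for c v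
        using that g sp.smult_closed by (auto simp: act_smult)
    qed
    moreover have "S \<subseteq> ?W" using in_own_span[OF S] inv[OF g] S by blast
    ultimately have "span S \<subseteq> ?W" by (rule span_is_subset[rotated])
    thus ?thesis using x by blast
  qed
  show ?thesis
    unfolding grp_submodule_iff using span_is_subset2[OF S] act_span sp.smult_closed by auto
qed

lemma span_minimal:
  assumes "S \<subseteq> U" "U \<subseteq> carrier V" "\<zero>\<^bsub>V\<^esub> \<in> U" "\<And>x y. x \<in> U \<Longrightarrow> y \<in> U \<Longrightarrow> x \<oplus>\<^bsub>V\<^esub> y \<in> U"
    "\<And>c x. x \<in> U \<Longrightarrow> c \<odot>\<^bsub>V\<^esub> x \<in> U"
  shows "span S \<subseteq> U"
proof (rule span_is_subset[OF assms(1)])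
  have "VectorSpace.subspace class_ring U V"
    unfolding subspace_iff[OF vectorspace_axioms] using assms by simp
  thus "submodule class_ring U V" unfolding VectorSpace.subspace_def by blast
qed

text \<open>The finite orbit of a nonzero vector spans.\<close>

lemma fin_dim_if_simple:
  assumes "simple_module G V" "finite (carrier G)"
  shows fin_dim
proof -
  obtain v where v: "v \<in> carrier V" "v \<noteq> \<zero>\<^bsub>V\<^esub>"
    using assms(1) unfolding simple_module_def by blast
  let ?S = "(\<lambda>g. act V g v) ` carrier G"
  have S: "?S \<subseteq> carrier V" "finite ?S" using v assms by auto
  have "act V g y \<in> ?S" if g: "g \<in> carrier G" and y: "y \<in> ?S" for g y
  proof -
    obtain h where h: "h \<in> carrier G" "y = act V h v" using y by blast
    have "act V g y = act V (g \<otimes>\<^bsub>G\<^esub> h) v" using g h v by (simp add: act_mult)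
    thus ?thesis using g h by blast
  qed
  hence "grp_submodule G V (span ?S)" by (rule span_grp_submodule[OF S(1)])
  hence "span ?S = {\<zero>\<^bsub>V\<^esub>} \<or> span ?S = carrier V" using assms(1) unfolding simple_module_def by blast
  moreover have "v \<in> ?S" using v by (intro image_eqI[of _ _ "\<one>\<^bsub>G\<^esub>"]) (auto simp: act_one)
  hence "v \<in> span ?S" using in_own_span[OF S(1)] by blast
  ultimately have "span ?S = carrier V" using v by blast
  thus ?thesis unfolding fin_dim_def using S by blast
qed

end

lemma finite_sym_group: "finite (carrier (sym_group n))"
  unfolding sym_group_def by (simp add: finite_permutations)

lemma simple_module_coordinates:
  fixes V :: "('f::field, nat \<Rightarrow> nat, 'v) grp_module"
  assumes simple: "simple_module (sym_group n) V" and char: "CHAR('f) = 2"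
  obtains \<kappa> :: "'v \<Rightarrow> 'v \<Rightarrow> 'f" where
    "inj_on \<kappa> (carrier V)"
    "\<And>x y. x \<in> carrier V \<Longrightarrow> y \<in> carrier V \<Longrightarrow> \<kappa> (x \<oplus>\<^bsub>V\<^esub> y) = \<kappa> x + \<kappa> y"
    "\<And>c x. x \<in> carrier V \<Longrightarrow> \<kappa> (c \<odot>\<^bsub>V\<^esub> x) = fscale c (\<kappa> x)"
    "simple_char2_rep fscale n (\<kappa> ` carrier V) (\<lambda>p f. \<kappa> (act V p (inv_into (carrier V) \<kappa> f)))"
proof -
  interpret V: group_module "sym_group n" V using simple unfolding simple_module_def by blast
  obtain \<kappa> :: "'v \<Rightarrow> 'v \<Rightarrow> 'f" where inj: "inj_on \<kappa> (carrier V)"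
    and add: "\<And>x y. x \<in> carrier V \<Longrightarrow> y \<in> carrier V \<Longrightarrow> \<kappa> (x \<oplus>\<^bsub>V\<^esub> y) = \<kappa> x + \<kappa> y"
    and sm: "\<And>c x. x \<in> carrier V \<Longrightarrow> \<kappa> (c \<odot>\<^bsub>V\<^esub> x) = fscale c (\<kappa> x)"
    by (rule exists_coordinates[OF V.vectorspace_axioms V.fin_dim_if_simple[OF simple finite_sym_group]], rule that)
  define \<rho> where "\<rho> = (\<lambda>p f. \<kappa> (act V p (inv_into (carrier V) \<kappa> f)))"
  have rho: "\<rho> p (\<kappa> x) = \<kappa> (act V p x)" if "x \<in> carrier V" for p x
    unfolding \<rho>_def using inj that by simp
  have zero: "\<kappa> \<zero>\<^bsub>V\<^esub> = 0" using sm[of "\<zero>\<^bsub>V\<^esub>" 0] by (auto simp: fun_eq_iff)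
  interpret vs: vector_space "fscale :: 'f \<Rightarrow> ('v \<Rightarrow> 'f) \<Rightarrow> _" by (rule vector_space_fscale)
  have "simple_char2_rep fscale n (\<kappa> ` carrier V) \<rho>"
  proof
    show "CHAR('f) = 2" by fact
    show "vs.subspace (\<kappa> ` carrier V)"
    proof (rule vs.subspaceI)
      show "0 \<in> \<kappa> ` carrier V" using zero V.zero_closed by (metis imageI)
    next
      fix x y assume "x \<in> \<kappa> ` carrier V" "y \<in> \<kappa> ` carrier V"
      thus "x + y \<in> \<kappa> ` carrier V" using add by (auto simp flip: add)
    next
      fix c x assume "x \<in> \<kappa> ` carrier V"
      thus "fscale c x \<in> \<kappa> ` carrier V" by (auto simp flip: sm)
    qed
  next
    fix p x assume p: "p permutes {1..n}" and x: "x \<in> \<kappa> ` carrier V"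
    thus "\<rho> p x \<in> \<kappa> ` carrier V" by (auto simp: rho sym_group_carrier)
    fix c show "\<rho> p (fscale c x) = fscale c (\<rho> p x)"
      using p x by (auto simp: rho sym_group_carrier V.act_smult sm simp flip: sm)
    fix y assume "y \<in> \<kappa> ` carrier V"
    thus "\<rho> p (x + y) = \<rho> p x + \<rho> p y"
      using p x by (auto simp: rho sym_group_carrier V.act_add simp flip: add)
  next
    fix x assume "x \<in> \<kappa> ` carrier V"
    thus "\<rho> id x = x" using V.act_one by (auto simp: rho sym_group_one)
  next
    fix p q x assume "p permutes {1..n}" "q permutes {1..n}" "x \<in> \<kappa> ` carrier V"
    thus "\<rho> (p \<circ> q) x = \<rho> p (\<rho> q x)"
      using V.act_mult[of p q] by (auto simp: rho sym_group_carrier sym_group_mult)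
  next
    show "\<kappa> ` carrier V \<noteq> {0}"
    proof
      assume *: "\<kappa> ` carrier V = {0}"
      have "x = \<zero>\<^bsub>V\<^esub>" if "x \<in> carrier V" for x
        using * that zero inj V.zero_closed by (metis imageI inj_onD singletonD)
      thus False using simple V.zero_closed unfolding simple_module_def by blast
    qed
  next
    fix W assume W: "vs.subspace W" "W \<subseteq> \<kappa> ` carrier V"
      and inv: "\<And>p x. p permutes {1..n} \<Longrightarrow> x \<in> W \<Longrightarrow> \<rho> p x \<in> W"
    let ?U = "{x \<in> carrier V. \<kappa> x \<in> W}"
    have "grp_submodule (sym_group n) V ?U"
      unfolding V.grp_submodule_iff
    proof (intro conjI ballI allI)
      show "\<zero>\<^bsub>V\<^esub> \<in> ?U" using zero vs.subspace_0[OF W(1)] by simp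
    next
      fix x y assume "x \<in> ?U" "y \<in> ?U"
      thus "x \<oplus>\<^bsub>V\<^esub> y \<in> ?U" using vs.subspace_add[OF W(1)] by (simp add: add)
    next
      fix c x assume "x \<in> ?U"
      thus "c \<odot>\<^bsub>V\<^esub> x \<in> ?U" using vs.subspace_scale[OF W(1)] by (simp add: sm)
    next
      fix g x assume "g \<in> carrier (sym_group n)" "x \<in> ?U"
      thus "act V g x \<in> ?U" using inv[of g "\<kappa> x"] rho by (simp add: sym_group_carrier)
    qed auto
    hence "?U = {\<zero>\<^bsub>V\<^esub>} \<or> ?U = carrier V" using simple unfolding simple_module_def by blast
    moreover have "W = \<kappa> ` ?U" using W(2) by blast
    ultimately show "W = {0} \<or> W = \<kappa> ` carrier V" using zero by auto
  qed
  thus ?thesis using that inj add sm unfolding \<rho>_def by blast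
qed

section \<open>Spin modules\<close>

text \<open>The condition on transpositions is invariant under isomorphism and turns out to characterize the
  module for even \<open>n\<close>.\<close>

definition spin_module :: "nat \<Rightarrow> ('f::field, nat \<Rightarrow> nat, 'v) grp_module \<Rightarrow> bool" where
  "spin_module n V \<longleftrightarrow> simple_module (sym_group n) V \<and>
     (\<forall>a\<in>{1..n}. \<forall>b\<in>{1..n}. \<forall>c\<in>{1..n}. distinct [a, b, c] \<longrightarrow> (\<forall>v\<in>carrier V.
        act V (swap a b) v \<oplus>\<^bsub>V\<^esub> act V (swap b c) v
          \<oplus>\<^bsub>V\<^esub> act V (swap a c) v = \<zero>\<^bsub>V\<^esub>))"

lemma transpose_in_sym_group:
  "a \<in> {1..n} \<Longrightarrow> b \<in> {1..n} \<Longrightarrow> swap a b \<in> carrier (sym_group n)"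
  by (simp add: sym_group_carrier permutes_swap_id)

lemma spin_module_coordinates:
  fixes V :: "('f::field, nat \<Rightarrow> nat, 'v) grp_module"
  assumes spin: "spin_module n V" and char: "CHAR('f) = 2" and n: "n = 2*k" "k \<ge> 2"
  obtains \<kappa> :: "'v \<Rightarrow> 'v \<Rightarrow> 'f" where
    "inj_on \<kappa> (carrier V)"
    "\<And>x y. x \<in> carrier V \<Longrightarrow> y \<in> carrier V \<Longrightarrow> \<kappa> (x \<oplus>\<^bsub>V\<^esub> y) = \<kappa> x + \<kappa> y"
    "\<And>c x. x \<in> carrier V \<Longrightarrow> \<kappa> (c \<odot>\<^bsub>V\<^esub> x) = fscale c (\<kappa> x)"
    "spin_rep fscale n (\<kappa> ` carrier V) (\<lambda>p f. \<kappa> (act V p (inv_into (carrier V) \<kappa> f))) k"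
proof -
  have simple: "simple_module (sym_group n) V" using spin unfolding spin_module_def by blast
  interpret V: group_module "sym_group n" V using simple unfolding simple_module_def by blast
  obtain \<kappa> :: "'v \<Rightarrow> 'v \<Rightarrow> 'f" where inj: "inj_on \<kappa> (carrier V)"
    and add: "\<And>x y. x \<in> carrier V \<Longrightarrow> y \<in> carrier V \<Longrightarrow> \<kappa> (x \<oplus>\<^bsub>V\<^esub> y) = \<kappa> x + \<kappa> y"
    and sm: "\<And>c x. x \<in> carrier V \<Longrightarrow> \<kappa> (c \<odot>\<^bsub>V\<^esub> x) = fscale c (\<kappa> x)"
    and rep: "simple_char2_rep fscale n (\<kappa> ` carrier V) (\<lambda>p f. \<kappa> (act V p (inv_into (carrier V) \<kappa> f)))"
    by (rule simple_module_coordinates[OF simple char], rule that)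
  interpret R: simple_char2_rep fscale n "\<kappa> ` carrier V" "\<lambda>p f. \<kappa> (act V p (inv_into (carrier V) \<kappa> f))"
    by (rule rep)
  have zero: "\<kappa> \<zero>\<^bsub>V\<^esub> = 0" using sm[of "\<zero>\<^bsub>V\<^esub>" 0] by (auto simp: fun_eq_iff)
  have "spin_rep fscale n (\<kappa> ` carrier V) (\<lambda>p f. \<kappa> (act V p (inv_into (carrier V) \<kappa> f))) k"
  proof
    fix a b c x assume *: "a \<in> R.D" "b \<in> R.D" "c \<in> R.D" "distinct [a, b, c]" "x \<in> \<kappa> ` carrier V"
    then obtain v where v: "v \<in> carrier V" "x = \<kappa> v" by blast
    note D = *(1-3)[unfolded R.D_def]
    note T = transpose_in_sym_group[OF D(1,2)] transpose_in_sym_group[OF D(2,3)] transpose_in_sym_group[OF D(1,3)]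
    have "R.z a b c x = \<kappa> (act V (swap a b) v \<oplus>\<^bsub>V\<^esub> act V (swap b c) v
          \<oplus>\<^bsub>V\<^esub> act V (swap a c) v)"
      unfolding R.z_def R.t_def v(2) using v(1) T inj by (simp add: add)
    also have "act V (swap a b) v \<oplus>\<^bsub>V\<^esub> act V (swap b c) v
          \<oplus>\<^bsub>V\<^esub> act V (swap a c) v = \<zero>\<^bsub>V\<^esub>"
      using spin D *(4) v(1) unfolding spin_module_def by blast
    finally show "R.z a b c x = 0" by (simp only: zero)
  qed (fact n)+
  thus ?thesis using that inj add sm by blast
qed

lemma spin_or_trivial_action:
  fixes V :: "('f::field, nat \<Rightarrow> nat, 'v) grp_module"
  assumes simple: "simple_module (sym_group n) V" and char: "CHAR('f) = 2" and n: "n \<ge> 5"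
    and rel: "\<And>b c x y v. \<lbrakk>b \<in> {1..n}; c \<in> {1..n}; x \<in> {1..n}; y \<in> {1..n}; distinct [b, c, x, y]; v \<in> carrier V\<rbrakk>
      \<Longrightarrow> act V (swap b x) v \<oplus>\<^bsub>V\<^esub> act V (swap b y) v
         \<oplus>\<^bsub>V\<^esub> act V (swap c x) v \<oplus>\<^bsub>V\<^esub> act V (swap c y) v = \<zero>\<^bsub>V\<^esub>"
  shows "spin_module n V \<or> (\<forall>p\<in>carrier (sym_group n). \<forall>v\<in>carrier V. act V p v = v)"
proof -
  interpret V: group_module "sym_group n" V using simple unfolding simple_module_def by blast
  obtain \<kappa> :: "'v \<Rightarrow> 'v \<Rightarrow> 'f" where inj: "inj_on \<kappa> (carrier V)"
    and add: "\<And>x y. x \<in> carrier V \<Longrightarrow> y \<in> carrier V \<Longrightarrow> \<kappa> (x \<oplus>\<^bsub>V\<^esub> y) = \<kappa> x + \<kappa> y"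
    and sm: "\<And>c x. x \<in> carrier V \<Longrightarrow> \<kappa> (c \<odot>\<^bsub>V\<^esub> x) = fscale c (\<kappa> x)"
    and rep: "simple_char2_rep fscale n (\<kappa> ` carrier V) (\<lambda>p f. \<kappa> (act V p (inv_into (carrier V) \<kappa> f)))"
    by (rule simple_module_coordinates[OF simple char], rule that)
  interpret R: simple_char2_rep fscale n "\<kappa> ` carrier V" "\<lambda>p f. \<kappa> (act V p (inv_into (carrier V) \<kappa> f))"
    by (rule rep)
  have zero: "\<kappa> \<zero>\<^bsub>V\<^esub> = 0" using sm[of "\<zero>\<^bsub>V\<^esub>" 0] by (auto simp: fun_eq_iff)
  have "(\<forall>a\<in>R.D. \<forall>b\<in>R.D. \<forall>c\<in>R.D. \<forall>x\<in>\<kappa> ` carrier V. distinct [a, b, c] \<longrightarrow> R.z a b c x = 0)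
    \<or> (\<forall>p x. p permutes {1..n} \<longrightarrow> x \<in> \<kappa> ` carrier V \<longrightarrow> \<kappa> (act V p (inv_into (carrier V) \<kappa> x)) = x)"
  proof (rule R.z_zero_or_trivial[OF n])
    fix b c x y u assume *: "b \<in> R.D" "c \<in> R.D" "x \<in> R.D" "y \<in> R.D" "distinct [b, c, x, y]" "u \<in> \<kappa> ` carrier V"
    then obtain v where v: "v \<in> carrier V" "u = \<kappa> v" by blast
    note D = *(1-4)[unfolded R.D_def]
    note T = transpose_in_sym_group[OF D(1,3)] transpose_in_sym_group[OF D(1,4)]
       transpose_in_sym_group[OF D(2,3)] transpose_in_sym_group[OF D(2,4)]
    have "R.t b x u + R.t b y u + R.t c x u + R.t c y u =
       \<kappa> (act V (swap b x) v \<oplus>\<^bsub>V\<^esub> act V (swap b y) v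
         \<oplus>\<^bsub>V\<^esub> act V (swap c x) v \<oplus>\<^bsub>V\<^esub> act V (swap c y) v)"
      unfolding R.t_def v(2) using v(1) T inj by (simp add: add)
    thus "R.t b x u + R.t b y u + R.t c x u + R.t c y u = 0" by (simp only: rel[OF D *(5) v(1)] zero)
  qed
  thus ?thesis
  proof
    assume z: "\<forall>a\<in>R.D. \<forall>b\<in>R.D. \<forall>c\<in>R.D. \<forall>x\<in>\<kappa> ` carrier V. distinct [a, b, c] \<longrightarrow> R.z a b c x = 0"
    have "spin_module n V" unfolding spin_module_def
    proof (intro conjI ballI impI simple)
      fix a b c v assume D: "a \<in> {1..n}" "b \<in> {1..n}" "c \<in> {1..n}" and d: "distinct [a, b, c]" and v: "v \<in> carrier V"
      note T = transpose_in_sym_group[OF D(1,2)] transpose_in_sym_group[OF D(2,3)] transpose_in_sym_group[OF D(1,3)]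
      let ?s = "act V (swap a b) v \<oplus>\<^bsub>V\<^esub> act V (swap b c) v
          \<oplus>\<^bsub>V\<^esub> act V (swap a c) v"
      have "R.z a b c (\<kappa> v) = \<kappa> ?s"
        unfolding R.z_def R.t_def using v T inj by (simp add: add)
      moreover have "R.z a b c (\<kappa> v) = 0" using z D d v unfolding R.D_def by blast
      ultimately have "\<kappa> ?s = \<kappa> \<zero>\<^bsub>V\<^esub>" by (simp only: zero)
      moreover have "?s \<in> carrier V" using v T by simp
      ultimately show "?s = \<zero>\<^bsub>V\<^esub>" using inj V.zero_closed by (meson inj_onD)
    qed
    thus ?thesis ..
  next
    assume id: "\<forall>p x. p permutes {1..n} \<longrightarrow> x \<in> \<kappa> ` carrier V \<longrightarrow> \<kappa> (act V p (inv_into (carrier V) \<kappa> x)) = x"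
    have "act V p v = v" if p: "p \<in> carrier (sym_group n)" and v: "v \<in> carrier V" for p v
    proof -
      have "\<kappa> (act V p (inv_into (carrier V) \<kappa> (\<kappa> v))) = \<kappa> v" using id p v by (simp add: sym_group_carrier)
      hence "\<kappa> (act V p v) = \<kappa> v" using inj v by simp
      thus ?thesis using inj v p V.act_closed[OF p v] by (meson inj_onD)
    qed
    thus ?thesis by blast
  qed
qed

lemma spin_module_iso:
  fixes V :: "('f::field, nat \<Rightarrow> nat, 'v) grp_module" and W :: "('f, nat \<Rightarrow> nat, 'w) grp_module"
  assumes V: "spin_module n V" and W: "spin_module n W" and char: "CHAR('f) = 2" and n: "n = 2*k" "k \<ge> 2"
  shows "grp_iso (sym_group n) V W"
proof -
  interpret V: group_module "sym_group n" V using V unfolding spin_module_def simple_module_def by blast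
  interpret W: group_module "sym_group n" W using W unfolding spin_module_def simple_module_def by blast
  obtain \<kappa> :: "'v \<Rightarrow> 'v \<Rightarrow> 'f" where inj: "inj_on \<kappa> (carrier V)"
    and add: "\<And>x y. x \<in> carrier V \<Longrightarrow> y \<in> carrier V \<Longrightarrow> \<kappa> (x \<oplus>\<^bsub>V\<^esub> y) = \<kappa> x + \<kappa> y"
    and sm: "\<And>c x. x \<in> carrier V \<Longrightarrow> \<kappa> (c \<odot>\<^bsub>V\<^esub> x) = fscale c (\<kappa> x)"
    and rep: "spin_rep fscale n (\<kappa> ` carrier V) (\<lambda>p f. \<kappa> (act V p (inv_into (carrier V) \<kappa> f))) k"
    by (rule spin_module_coordinates[OF V char n], rule that)
  obtain \<kappa>' :: "'w \<Rightarrow> 'w \<Rightarrow> 'f" where inj': "inj_on \<kappa>' (carrier W)"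
    and add': "\<And>x y. x \<in> carrier W \<Longrightarrow> y \<in> carrier W \<Longrightarrow> \<kappa>' (x \<oplus>\<^bsub>W\<^esub> y) = \<kappa>' x + \<kappa>' y"
    and sm': "\<And>c x. x \<in> carrier W \<Longrightarrow> \<kappa>' (c \<odot>\<^bsub>W\<^esub> x) = fscale c (\<kappa>' x)"
    and rep': "spin_rep fscale n (\<kappa>' ` carrier W) (\<lambda>p f. \<kappa>' (act W p (inv_into (carrier W) \<kappa>' f))) k"
    by (rule spin_module_coordinates[OF W char n], rule that)
  obtain f where bij: "bij_betw f (\<kappa> ` carrier V) (\<kappa>' ` carrier W)"
    and fadd: "\<And>x y. x \<in> \<kappa> ` carrier V \<Longrightarrow> y \<in> \<kappa> ` carrier V \<Longrightarrow> f (x + y) = f x + f y"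
    and fsm: "\<And>e x. x \<in> \<kappa> ` carrier V \<Longrightarrow> f (fscale e x) = fscale e (f x)"
    and fact: "\<And>p x. p permutes {1..n} \<Longrightarrow> x \<in> \<kappa> ` carrier V \<Longrightarrow>
       f (\<kappa> (act V p (inv_into (carrier V) \<kappa> x))) = \<kappa>' (act W p (inv_into (carrier W) \<kappa>' (f x)))"
    by (rule spin_rep_unique[OF rep rep'], rule that)
  define F where "F = (\<lambda>x\<in>carrier V. inv_into (carrier W) \<kappa>' (f (\<kappa> x)))"
  have fim: "f (\<kappa> x) \<in> \<kappa>' ` carrier W" if "x \<in> carrier V" for x
    using bij that unfolding bij_betw_def by blast
  have F: "F x \<in> carrier W" "\<kappa>' (F x) = f (\<kappa> x)" if "x \<in> carrier V" for x
    using inv_into_into[OF fim[OF that]] f_inv_into_f[OF fim[OF that]] that unfolding F_def by simp_all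
  have FI: "F x = y" if "x \<in> carrier V" "y \<in> carrier W" "\<kappa>' y = f (\<kappa> x)" for x y
    using F[OF that(1)] that inj' by (metis inj_onD)
  have "F \<in> grp_hom (sym_group n) V W"
    unfolding grp_hom_def lin_maps_def LinearCombinations.module_hom_def
  proof (intro CollectI IntI conjI allI impI ballI Pi_I)
    fix x y assume "x \<in> carrier V \<and> y \<in> carrier V"
    thus "F (x \<oplus>\<^bsub>V\<^esub> y) = F x \<oplus>\<^bsub>W\<^esub> F y" by (intro FI) (auto simp: F add add' fadd)
  next
    fix c :: 'f and x assume "c \<in> carrier class_ring \<and> x \<in> carrier V"
    thus "F (c \<odot>\<^bsub>V\<^esub> x) = c \<odot>\<^bsub>W\<^esub> F x" by (intro FI) (auto simp: F sm sm' fsm)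
  next
    fix g v assume g: "g \<in> carrier (sym_group n)" and v: "v \<in> carrier V"
    have p: "g permutes {1..n}" using g by (simp only: sym_group_carrier)
    have "f (\<kappa> (act V g (inv_into (carrier V) \<kappa> (\<kappa> v))))
        = \<kappa>' (act W g (inv_into (carrier W) \<kappa>' (f (\<kappa> v))))"
      using v by (intro fact[OF p]) blast
    moreover have "inv_into (carrier W) \<kappa>' (f (\<kappa> v)) = F v" using v by (simp add: F_def)
    ultimately have "\<kappa>' (act W g (F v)) = f (\<kappa> (act V g v))" using inj v by simp
    thus "F (act V g v) = act W g (F v)" using g v F by (intro FI) auto
  qed (use F(1) in \<open>auto simp: F_def\<close>)
  moreover have "bij_betw F (carrier V) (carrier W)"
  proof (rule bij_betw_imageI)
    show "inj_on F (carrier V)"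
    proof (rule inj_onI)
      fix x y assume "x \<in> carrier V" "y \<in> carrier V" "F x = F y"
      hence "f (\<kappa> x) = f (\<kappa> y)" using F(2) by metis
      thus "x = y" using bij inj \<open>x \<in> carrier V\<close> \<open>y \<in> carrier V\<close> unfolding bij_betw_def
        by (metis imageI inj_onD)
    qed
    show "F ` carrier V = carrier W"
    proof
      show "carrier W \<subseteq> F ` carrier V"
      proof
        fix y assume y: "y \<in> carrier W"
        then obtain x where "x \<in> carrier V" "\<kappa>' y = f (\<kappa> x)"
          using bij unfolding bij_betw_def by (metis (no_types, lifting) imageE imageI)
        thus "y \<in> F ` carrier V" using FI[of x y] y by blast
      qed
    qed (use F(1) in blast)
  qed
  ultimately show ?thesis unfolding grp_iso_def by blast
qed

lemma spin_module_stabilizer_scalar: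
  fixes V :: "('f::field, nat \<Rightarrow> nat, 'v) grp_module"
  assumes V: "spin_module n V" and char: "CHAR('f) = 2" and n: "n = 2*k" "k \<ge> 2"
    and A: "A \<subseteq> {1..n}" "odd (card A)"
    and f_closed: "\<And>x. x \<in> carrier V \<Longrightarrow> f x \<in> carrier V"
    and f_add: "\<And>x y. x \<in> carrier V \<Longrightarrow> y \<in> carrier V \<Longrightarrow> f (x \<oplus>\<^bsub>V\<^esub> y) = f x \<oplus>\<^bsub>V\<^esub> f y"
    and f_smult: "\<And>c x. x \<in> carrier V \<Longrightarrow> f (c \<odot>\<^bsub>V\<^esub> x) = c \<odot>\<^bsub>V\<^esub> f x"
    and comm: "\<And>p x. p \<in> carrier (sym_group n) \<Longrightarrow> p ` A = A \<Longrightarrow> x \<in> carrier V \<Longrightarrow> f (act V p x) = act V p (f x)"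
  obtains e where "\<And>x. x \<in> carrier V \<Longrightarrow> f x = e \<odot>\<^bsub>V\<^esub> x"
proof -
  interpret V: group_module "sym_group n" V using V unfolding spin_module_def simple_module_def by blast
  obtain \<kappa> :: "'v \<Rightarrow> 'v \<Rightarrow> 'f" where inj: "inj_on \<kappa> (carrier V)"
    and add: "\<And>x y. x \<in> carrier V \<Longrightarrow> y \<in> carrier V \<Longrightarrow> \<kappa> (x \<oplus>\<^bsub>V\<^esub> y) = \<kappa> x + \<kappa> y"
    and sm: "\<And>c x. x \<in> carrier V \<Longrightarrow> \<kappa> (c \<odot>\<^bsub>V\<^esub> x) = fscale c (\<kappa> x)"
    and rep: "spin_rep fscale n (\<kappa> ` carrier V) (\<lambda>p f. \<kappa> (act V p (inv_into (carrier V) \<kappa> f))) k"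
    by (rule spin_module_coordinates[OF V char n], rule that)
  interpret R: spin_rep fscale n "\<kappa> ` carrier V" "\<lambda>p f. \<kappa> (act V p (inv_into (carrier V) \<kappa> f))" k
    by (rule rep)
  define g where "g y = \<kappa> (f (inv_into (carrier V) \<kappa> y))" for y
  have g: "g (\<kappa> x) = \<kappa> (f x)" if "x \<in> carrier V" for x unfolding g_def using inj that by simp
  have g_closed: "g y \<in> \<kappa> ` carrier V" if "y \<in> \<kappa> ` carrier V" for y using that g f_closed by auto
  have g_add: "g (x + y) = g x + g y" if xy: "x \<in> \<kappa> ` carrier V" "y \<in> \<kappa> ` carrier V" for x y
  proof -
    obtain u v where uv: "u \<in> carrier V" "x = \<kappa> u" "v \<in> carrier V" "y = \<kappa> v" using xy by blast
    have "g (\<kappa> u + \<kappa> v) = \<kappa> (f (u \<oplus>\<^bsub>V\<^esub> v))"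
      unfolding add[OF uv(1,3), symmetric] using uv by (intro g) blast
    also have "\<dots> = \<kappa> (f u) + \<kappa> (f v)" using uv f_closed by (simp only: f_add add)
    finally show ?thesis using uv g by simp
  qed
  have g_scale: "g (fscale c x) = fscale c (g x)" if x: "x \<in> \<kappa> ` carrier V" for c x
  proof -
    obtain u where u: "u \<in> carrier V" "x = \<kappa> u" using x by blast
    have "g (fscale c (\<kappa> u)) = \<kappa> (f (c \<odot>\<^bsub>V\<^esub> u))"
      unfolding sm[OF u(1), symmetric] using u by (intro g) blast
    also have "\<dots> = fscale c (\<kappa> (f u))" using u f_closed by (simp only: f_smult sm)
    finally show ?thesis using u g by simp
  qed
  have t: "R.t a b (\<kappa> x) = \<kappa> (act V (swap a b) x)" if "x \<in> carrier V" for a b x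
    unfolding R.t_def using that inj by simp
  have g_t: "g (R.t a b x) = R.t a b (g x)"
    if ab: "a \<in> R.D" "b \<in> R.D" "a \<in> A \<longleftrightarrow> b \<in> A" and x: "x \<in> \<kappa> ` carrier V" for a b x
  proof -
    have T: "swap a b \<in> carrier (sym_group n)"
      using ab unfolding R.D_def by (intro transpose_in_sym_group)
    obtain v where v: "v \<in> carrier V" "x = \<kappa> v" using x by blast
    show ?thesis using comm[OF T transpose_image_eq[OF ab(3)] v(1)] v T f_closed by (simp add: t g)
  qed
  have AD: "A \<subseteq> R.D" using A by (simp add: R.D_def)
  obtain e where e: "\<And>x. x \<in> \<kappa> ` carrier V \<Longrightarrow> g x = fscale e x"
  proof (rule R.schur[of g])
    show "g (R.t a b x) = R.t a b (g x)" if "a \<in> R.D" "b \<in> R.D" "x \<in> \<kappa> ` carrier V" for a b x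
      by (rule R.commute_of_stabilizer[OF AD A(2) g_closed g_add g_scale g_t that])
  qed (use g_closed g_add g_scale in auto)
  have "f x = e \<odot>\<^bsub>V\<^esub> x" if x: "x \<in> carrier V" for x
  proof -
    have "\<kappa> (f x) = \<kappa> (e \<odot>\<^bsub>V\<^esub> x)" using e[of "\<kappa> x"] x by (simp add: g sm)
    thus ?thesis using inj f_closed x by (meson V.sm_closed inj_onD)
  qed
  thus ?thesis by (rule that)
qed

text \<open>If the group acts trivially, the line through a nonzero vector is a submodule.\<close>

lemma trivial_iso:
  fixes V :: "('f::field, 'g, 'v) grp_module"
  assumes simple: "simple_module G V"
    and triv: "\<And>p v. p \<in> carrier G \<Longrightarrow> v \<in> carrier V \<Longrightarrow> act V p v = v"
  shows "grp_iso G V trivial_module"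
proof -
  interpret V: group_module G V using simple unfolding simple_module_def by blast
  obtain u where u: "u \<in> carrier V" "u \<noteq> \<zero>\<^bsub>V\<^esub>"
    using simple unfolding simple_module_def by blast
  let ?W = "(\<lambda>c. c \<odot>\<^bsub>V\<^esub> u) ` UNIV"
  have "grp_submodule G V ?W"
    unfolding V.grp_submodule_iff
  proof (intro conjI ballI allI)
    show "\<zero>\<^bsub>V\<^esub> \<in> ?W" using V.smult_0[OF u(1)] by (metis rangeI)
  next
    fix x y assume "x \<in> ?W" "y \<in> ?W"
    thus "x \<oplus>\<^bsub>V\<^esub> y \<in> ?W" using u by (auto simp flip: V.smult_plus)
  next
    fix c x assume "x \<in> ?W"
    thus "c \<odot>\<^bsub>V\<^esub> x \<in> ?W" using u by (auto simp flip: V.smult_mult)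
  qed (use u in \<open>auto simp: triv\<close>)
  moreover have "u \<in> ?W" using V.smult_1[OF u(1)] by (metis rangeI)
  ultimately have W: "?W = carrier V" using simple u unfolding simple_module_def by blast
  have inj: "c = d" if "c \<odot>\<^bsub>V\<^esub> u = d \<odot>\<^bsub>V\<^esub> u" for c d
  proof (rule ccontr)
    assume ne: "c \<noteq> d"
    have "(c - d) \<odot>\<^bsub>V\<^esub> u \<oplus>\<^bsub>V\<^esub> d \<odot>\<^bsub>V\<^esub> u = c \<odot>\<^bsub>V\<^esub> u" using u by (simp flip: V.smult_plus)
    hence "(c - d) \<odot>\<^bsub>V\<^esub> u = \<zero>\<^bsub>V\<^esub>" using that u by simp
    hence "inverse (c - d) \<odot>\<^bsub>V\<^esub> ((c - d) \<odot>\<^bsub>V\<^esub> u) = \<zero>\<^bsub>V\<^esub>" by simp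
    thus False using u ne by (simp flip: V.smult_mult)
  qed
  define f where "f = (\<lambda>v\<in>carrier V. THE c. v = c \<odot>\<^bsub>V\<^esub> u)"
  have f: "f (c \<odot>\<^bsub>V\<^esub> u) = c" for c
    unfolding f_def using u inj by auto
  have "f \<in> grp_hom G V trivial_module"
    unfolding grp_hom_def lin_maps_def LinearCombinations.module_hom_def
  proof (intro CollectI IntI conjI allI impI ballI Pi_I)
    fix x y assume "x \<in> carrier V \<and> y \<in> carrier V"
    then obtain c d where "x = c \<odot>\<^bsub>V\<^esub> u" "y = d \<odot>\<^bsub>V\<^esub> u" unfolding W[symmetric] by blast
    thus "f (x \<oplus>\<^bsub>V\<^esub> y) = f x \<oplus>\<^bsub>trivial_module\<^esub> f y"
      using u by (simp add: f trivial_module_def flip: V.smult_plus)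
  next
    fix e :: 'f and x assume "e \<in> carrier class_ring \<and> x \<in> carrier V"
    then obtain c where "x = c \<odot>\<^bsub>V\<^esub> u" unfolding W[symmetric] by blast
    thus "f (e \<odot>\<^bsub>V\<^esub> x) = e \<odot>\<^bsub>trivial_module\<^esub> f x"
      using u by (simp add: f trivial_module_def flip: V.smult_mult)
  qed (auto simp: triv trivial_module_def f_def)
  moreover have "bij_betw f (carrier V) (carrier (trivial_module :: ('f, 'g, 'f) grp_module))"
    unfolding W[symmetric]
    by (rule bij_betwI[of _ _ _ "\<lambda>c. c \<odot>\<^bsub>V\<^esub> u"]) (auto simp: f trivial_module_def)
  ultimately show ?thesis unfolding grp_iso_def by blast
qed

section \<open>Spaces of homomorphisms\<close>

text \<open>Finitely many linear functionals that separate points bound the dimension. The induction splits off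
  the kernel of one functional.\<close>

lemma fin_dim_if_separated:
  fixes H :: "('f::field, 'h, 'm) module_scheme" and T :: "'h \<Rightarrow> 'x \<Rightarrow> 'f"
  assumes "vectorspace class_ring H" and "finite X"
    and add: "\<And>u v x. u \<in> carrier H \<Longrightarrow> v \<in> carrier H \<Longrightarrow> T (u \<oplus>\<^bsub>H\<^esub> v) x = T u x + T v x"
    and sm: "\<And>c v x. v \<in> carrier H \<Longrightarrow> T (c \<odot>\<^bsub>H\<^esub> v) x = c * T v x"
    and sep: "\<And>v. v \<in> carrier H \<Longrightarrow> (\<And>x. x \<in> X \<Longrightarrow> T v x = 0) \<Longrightarrow> v = \<zero>\<^bsub>H\<^esub>"
  shows "vectorspace.fin_dim class_ring H"
proof -
  interpret H: vectorspace class_ring H by fact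
  have sm_closed: "c \<odot>\<^bsub>H\<^esub> v \<in> carrier H" if "v \<in> carrier H" for c v using that by simp
  have "\<exists>B. finite B \<and> B \<subseteq> W \<and> W \<subseteq> H.span B"
    if "finite X" "VectorSpace.subspace class_ring W H"
      "\<And>v. v \<in> W \<Longrightarrow> (\<And>x. x \<in> X \<Longrightarrow> T v x = 0) \<Longrightarrow> v = \<zero>\<^bsub>H\<^esub>" for W
    using that
  proof (induction X arbitrary: W rule: finite_induct)
    case empty
    hence "W \<subseteq> {\<zero>\<^bsub>H\<^esub>}" by auto
    thus ?case using H.span_zero by (intro exI[of _ "{}"]) auto
  next
    case (insert x X)
    have W: "W \<subseteq> carrier H" "\<zero>\<^bsub>H\<^esub> \<in> W" "\<And>u v. u \<in> W \<Longrightarrow> v \<in> W \<Longrightarrow> u \<oplus>\<^bsub>H\<^esub> v \<in> W"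
      "\<And>c v. v \<in> W \<Longrightarrow> c \<odot>\<^bsub>H\<^esub> v \<in> W"
      using insert.prems(1) unfolding subspace_iff[OF H.vectorspace_axioms] by auto
    show ?case
    proof (cases "\<forall>v\<in>W. T v x = 0")
      case True
      show ?thesis by (rule insert.IH[OF insert.prems(1) insert.prems(2)]) (use True in auto)
    next
      case False
      then obtain u where u: "u \<in> W" "T u x \<noteq> 0" by blast
      define v where "v = inverse (T u x) \<odot>\<^bsub>H\<^esub> u"
      have v: "v \<in> W" "T v x = 1" using u W by (auto simp: v_def sm subset_iff)
      let ?W = "{w \<in> W. T w x = 0}"
      have "T \<zero>\<^bsub>H\<^esub> x = 0" using sm[of "\<zero>\<^bsub>H\<^esub>" 0 x] H.smult_l_null[of "\<zero>\<^bsub>H\<^esub>"] by simp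
      hence sub: "VectorSpace.subspace class_ring ?W H"
        unfolding subspace_iff[OF H.vectorspace_axioms] using W by (auto simp: add sm subset_iff)
      have sepW: "w = \<zero>\<^bsub>H\<^esub>" if "w \<in> ?W" "\<And>y. y \<in> X \<Longrightarrow> T w y = 0" for w
        using insert.prems(2)[of w] that by auto
      obtain B where B: "finite B" "B \<subseteq> ?W" "?W \<subseteq> H.span B" using insert.IH[OF sub sepW] by blast
      have vB: "insert v B \<subseteq> carrier H" using B v W by auto
      have sub: "submodule class_ring (H.span (insert v B)) H" by (rule H.span_is_submodule[OF vB])
      have "W \<subseteq> H.span (insert v B)"
      proof
        fix w assume w: "w \<in> W"
        let ?w = "w \<oplus>\<^bsub>H\<^esub> (- T w x) \<odot>\<^bsub>H\<^esub> v"
        have wH: "w \<in> carrier H" "v \<in> carrier H" using w v W by auto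
        have "?w \<in> ?W" using w v W wH by (auto simp: add sm)
        hence 1: "?w \<in> H.span (insert v B)" using B H.span_is_monotone[of B "insert v B"] by blast
        have 2: "T w x \<odot>\<^bsub>H\<^esub> v \<in> H.span (insert v B)"
          using H.in_own_span[OF vB] submodule.smult_closed[OF sub] by auto
        have "(- T w x) \<odot>\<^bsub>H\<^esub> v \<oplus>\<^bsub>H\<^esub> T w x \<odot>\<^bsub>H\<^esub> v = \<zero>\<^bsub>H\<^esub>"
          using H.smult_l_distr[of "- T w x" "T w x" v] H.smult_l_null[of v] wH by simp
        hence "w = ?w \<oplus>\<^bsub>H\<^esub> T w x \<odot>\<^bsub>H\<^esub> v" using wH sm_closed by (simp add: H.a_assoc)
        thus "w \<in> H.span (insert v B)" using submodule.m_closed[OF sub 1 2] by simp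
      qed
      thus ?thesis using B v by (intro exI[of _ "insert v B"]) auto
    qed
  qed
  from this[of "carrier H"] obtain B where B: "finite B" "B \<subseteq> carrier H" "carrier H \<subseteq> H.span B"
    using \<open>finite X\<close> sep sm_closed unfolding subspace_iff[OF H.vectorspace_axioms] by auto
  thus ?thesis unfolding H.fin_dim_def using H.span_is_subset2[OF B(2)] by blast
qed

lemma dim_injective:
  fixes H :: "('f::field, 'h, 'm) module_scheme" and H' :: "('f, 'k, 'l) module_scheme"
  assumes "vectorspace class_ring H" "vectorspace class_ring H'"
    and fd: "vectorspace.fin_dim class_ring H" "vectorspace.fin_dim class_ring H'"
    and T: "T \<in> LinearCombinations.module_hom class_ring H H'" and inj: "inj_on T (carrier H)"
  shows "vectorspace.dim class_ring H \<le> vectorspace.dim class_ring H'"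
    and "vectorspace.dim class_ring H = vectorspace.dim class_ring H' \<Longrightarrow> T ` carrier H = carrier H'"
proof -
  interpret H: vectorspace class_ring H by fact
  interpret H': vectorspace class_ring H' by fact
  interpret T: linear_map class_ring H H' T
    by unfold_locales (rule T)
  obtain B where B: "finite B" "H.basis B" using H.finite_basis_exists[OF fd(1)] by blast
  have BH: "B \<subseteq> carrier H" "H.lin_indpt B" using B(2) unfolding H.basis_def by auto
  have TB: "T ` B \<subseteq> carrier H'" "finite (T ` B)" using BH B T.T_im by auto
  have card: "card (T ` B) = H.dim" using B H.dim_basis card_image[OF inj_on_subset[OF inj BH(1)]] by simp
  have li: "H'.lin_indpt (T ` B)"
  proof (rule H'.finite_lin_indpt2[OF TB(2,1)])
    fix a :: "'k \<Rightarrow> 'f" assume "a \<in> T ` B \<rightarrow> carrier class_ring" and 0: "H'.lincomb a (T ` B) = \<zero>\<^bsub>H'\<^esub>"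
    have "T (H.lincomb (a \<circ> T) B) = \<zero>\<^bsub>H'\<^esub>"
      using T.lincomb_linear_image[OF inj BH(1) _ B(1), of a] 0 by simp
    also have "\<dots> = T \<zero>\<^bsub>H\<^esub>" by simp
    finally have "H.lincomb (a \<circ> T) B = \<zero>\<^bsub>H\<^esub>"
      by (rule inj_onD[OF inj]) (simp_all add: BH(1))
    hence "(a \<circ> T) \<in> B \<rightarrow> {\<zero>\<^bsub>class_ring\<^esub>}" using H.not_lindepD[OF BH(2) B(1) subset_refl] by simp
    thus "\<forall>v\<in>T ` B. a v = \<zero>\<^bsub>class_ring\<^esub>" by auto
  qed
  show "H.dim \<le> H'.dim" using H'.li_le_dim(2)[OF fd(2) TB(1) li] card by simp
  assume "H.dim = H'.dim"
  hence "H'.basis (T ` B)" using H'.dim_li_is_basis[OF fd(2) TB(2,1) li] card by simp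
  hence gen: "H'.span (T ` B) = carrier H'" unfolding H'.basis_def by blast
  have "submodule class_ring (T ` carrier H) H'"
    using T.imT_is_subspace unfolding T.im_def VectorSpace.subspace_def by blast
  hence "H'.span (T ` B) \<subseteq> T ` carrier H" using BH by (intro H'.span_is_subset) auto
  thus "T ` carrier H = carrier H'" using gen T.T_im by blast
qed

lemma lin_maps_iff:
  fixes V :: "('f::field, 'g, 'v) grp_module" and W :: "('f, 'g, 'w) grp_module"
  shows "f \<in> lin_maps V W \<longleftrightarrow> f \<in> extensional (carrier V) \<and> (\<forall>x\<in>carrier V. f x \<in> carrier W) \<and>
    (\<forall>x\<in>carrier V. \<forall>y\<in>carrier V. f (x \<oplus>\<^bsub>V\<^esub> y) = f x \<oplus>\<^bsub>W\<^esub> f y) \<and>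
    (\<forall>c. \<forall>x\<in>carrier V. f (c \<odot>\<^bsub>V\<^esub> x) = c \<odot>\<^bsub>W\<^esub> f x)"
  unfolding lin_maps_def LinearCombinations.module_hom_def by auto

lemma (in group_module) neg_char_free: "x \<in> carrier V \<Longrightarrow> (- 1) \<odot>\<^bsub>V\<^esub> x \<oplus>\<^bsub>V\<^esub> x = \<zero>\<^bsub>V\<^esub>"
  using smult_plus[of x "- 1" 1] by simp

lemma Hom_module_sel [simp]:
  "carrier (Hom_module G V W) = lin_maps V W"
  "zero (Hom_module G V W) = (\<lambda>v\<in>carrier V. \<zero>\<^bsub>W\<^esub>)"
  "f \<oplus>\<^bsub>Hom_module G V W\<^esub> h = (\<lambda>v\<in>carrier V. f v \<oplus>\<^bsub>W\<^esub> h v)"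
  "c \<odot>\<^bsub>Hom_module G V W\<^esub> f = (\<lambda>v\<in>carrier V. c \<odot>\<^bsub>W\<^esub> f v)"
  "act (Hom_module G V W) g f = (\<lambda>v\<in>carrier V. act W g (f (act V (inv\<^bsub>G\<^esub> g) v)))"
  by (simp_all add: Hom_module_def)

lemma Hom_vectorspace:
  assumes "group_module G V" "group_module G W"
  shows "vectorspace class_ring (Hom_module G V W)"
proof -
  interpret V: group_module G V by fact
  interpret W: group_module G W by fact
  show ?thesis
  proof (rule vs_criteria)
    show "\<forall>v\<in>carrier (Hom_module G V W). \<exists>neg_v\<in>carrier (Hom_module G V W). v \<oplus>\<^bsub>Hom_module G V W\<^esub> neg_v = \<zero>\<^bsub>Hom_module G V W\<^esub>"
    proof
      fix f assume f: "f \<in> carrier (Hom_module G V W)"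
      show "\<exists>h\<in>carrier (Hom_module G V W). f \<oplus>\<^bsub>Hom_module G V W\<^esub> h = \<zero>\<^bsub>Hom_module G V W\<^esub>"
        using f W.neg_char_free
        by (intro bexI[of _ "\<lambda>v\<in>carrier V. (- 1) \<odot>\<^bsub>W\<^esub> f v"])
          (auto simp: lin_maps_iff W.smult_add W.a_comm W.smult_mult[symmetric] intro!: restrict_ext)
    qed
    show "\<forall>v\<in>carrier (Hom_module G V W). v \<oplus>\<^bsub>Hom_module G V W\<^esub> \<zero>\<^bsub>Hom_module G V W\<^esub> = v"
      by (auto simp: lin_maps_iff extensional_def fun_eq_iff)
    show "\<forall>v\<in>carrier (Hom_module G V W). \<one>\<^bsub>class_ring\<^esub> \<odot>\<^bsub>Hom_module G V W\<^esub> v = v"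
      by (auto simp: lin_maps_iff extensional_def fun_eq_iff)
  qed (auto simp: class_field lin_maps_iff W.smult_add W.smult_mult W.smult_plus W.a_ac mult.commute
        intro!: restrict_ext simp flip: W.smult_mult)
qed

section \<open>Permutation modules\<close>

lemma Hom_group_module:
  assumes "group_module G V" "group_module G W"
  shows "group_module G (Hom_module G V W)"
proof -
  interpret V: group_module G V by fact
  interpret W: group_module G W by fact
  have act_closed: "act (Hom_module G V W) g f \<in> lin_maps V W" if "g \<in> carrier G" "f \<in> lin_maps V W" for g f
    using that by (auto simp: lin_maps_iff V.act_add V.act_smult W.act_add W.act_smult)
  show ?thesis
  proof (rule group_module.intro[OF Hom_vectorspace[OF assms] V.G.is_group], rule group_module_axioms.intro)
    show "act (Hom_module G V W) g \<in> LinearCombinations.module_hom class_ring (Hom_module G V W) (Hom_module G V W)"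
      if g: "g \<in> carrier G" for g
      unfolding LinearCombinations.module_hom_def
    proof (intro CollectI conjI Pi_I allI impI)
      show "act (Hom_module G V W) g f \<in> carrier (Hom_module G V W)" if "f \<in> carrier (Hom_module G V W)" for f
        using act_closed[OF g, of f] that by simp
    qed (use g in \<open>auto simp: lin_maps_iff W.act_add W.act_smult intro!: restrict_ext\<close>)
    show "act (Hom_module G V W) \<one>\<^bsub>G\<^esub> f = f" if "f \<in> carrier (Hom_module G V W)" for f
      using that by (auto simp: lin_maps_iff V.act_one W.act_one extensional_def fun_eq_iff)
    show "act (Hom_module G V W) (g \<otimes>\<^bsub>G\<^esub> h) f = act (Hom_module G V W) g (act (Hom_module G V W) h f)"
      if "g \<in> carrier G" "h \<in> carrier G" "f \<in> carrier (Hom_module G V W)" for g h f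
      using that by (auto simp: lin_maps_iff V.G.inv_mult_group V.act_mult W.act_mult intro!: restrict_ext)
  qed
qed

lemma grp_hom_subspace:
  assumes "group_module G V" "group_module G W"
  shows "VectorSpace.subspace class_ring (grp_hom G V W) (Hom_module G V W)"
proof -
  interpret V: group_module G V by fact
  interpret W: group_module G W by fact
  interpret H: vectorspace class_ring "Hom_module G V W" by (rule Hom_vectorspace[OF assms])
  have cl: "(\<lambda>v\<in>carrier V. f v \<oplus>\<^bsub>W\<^esub> h v) \<in> lin_maps V W" if "f \<in> lin_maps V W" "h \<in> lin_maps V W" for f h
    using H.a_closed[of f h] that by simp
  have cs: "(\<lambda>v\<in>carrier V. c \<odot>\<^bsub>W\<^esub> f v) \<in> lin_maps V W" if "f \<in> lin_maps V W" for f c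
    using H.smult_closed[of c f] that by simp
  show ?thesis unfolding subspace_iff[OF H.vectorspace_axioms]
  proof (intro conjI ballI allI)
    show "grp_hom G V W \<subseteq> carrier (Hom_module G V W)" by (auto simp: grp_hom_def)
    show "\<zero>\<^bsub>Hom_module G V W\<^esub> \<in> grp_hom G V W"
      using H.zero_closed by (auto simp: grp_hom_def)
    show "f \<oplus>\<^bsub>Hom_module G V W\<^esub> h \<in> grp_hom G V W" if "f \<in> grp_hom G V W" "h \<in> grp_hom G V W" for f h
      using that cl[of f h] by (auto simp: grp_hom_def W.act_add lin_maps_iff)
    show "c \<odot>\<^bsub>Hom_module G V W\<^esub> f \<in> grp_hom G V W" if "f \<in> grp_hom G V W" for c f
      using that cs[of f c] by (auto simp: grp_hom_def W.act_smult lin_maps_iff)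
  qed
qed

lemma grp_hom_vectorspace:
  assumes "group_module G V" "group_module G W"
  shows "vectorspace class_ring ((Hom_module G V W)\<lparr>carrier := grp_hom G V W\<rparr>)"
  using vectorspace.subspace_is_vs[OF Hom_vectorspace[OF assms] grp_hom_subspace[OF assms]] .

lemma Hom_module_restrict_sel [simp]:
  "zero ((Hom_module G V W)\<lparr>carrier := X\<rparr>) = (\<lambda>v\<in>carrier V. \<zero>\<^bsub>W\<^esub>)"
  "f \<oplus>\<^bsub>(Hom_module G V W)\<lparr>carrier := X\<rparr>\<^esub> h = (\<lambda>v\<in>carrier V. f v \<oplus>\<^bsub>W\<^esub> h v)"
  "c \<odot>\<^bsub>(Hom_module G V W)\<lparr>carrier := X\<rparr>\<^esub> f = (\<lambda>v\<in>carrier V. c \<odot>\<^bsub>W\<^esub> f v)"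
  by (simp_all add: Hom_module_def)

lemma perm_module_sel [simp]:
  "carrier (perm_module G X \<alpha>) = extensional X"
  "zero (perm_module G X \<alpha>) = (\<lambda>x\<in>X. 0)"
  "f \<oplus>\<^bsub>perm_module G X \<alpha>\<^esub> h = (\<lambda>x\<in>X. f x + h x)"
  "c \<odot>\<^bsub>perm_module G X \<alpha>\<^esub> f = (\<lambda>x\<in>X. c * f x)"
  "act (perm_module G X \<alpha>) g f = (\<lambda>x\<in>X. f (\<alpha> (inv\<^bsub>G\<^esub> g) x))"
  by (simp_all add: perm_module_def)

lemma perm_group_module:
  assumes "group G"
    and closed: "\<And>g x. g \<in> carrier G \<Longrightarrow> x \<in> X \<Longrightarrow> \<alpha> g x \<in> X"
    and one: "\<And>x. x \<in> X \<Longrightarrow> \<alpha> \<one>\<^bsub>G\<^esub> x = x"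
    and mult: "\<And>g h x. g \<in> carrier G \<Longrightarrow> h \<in> carrier G \<Longrightarrow> x \<in> X \<Longrightarrow> \<alpha> (g \<otimes>\<^bsub>G\<^esub> h) x = \<alpha> g (\<alpha> h x)"
  shows "group_module G (perm_module G X \<alpha> :: ('f::field, _, _) grp_module)"
proof -
  interpret G: group G by fact
  let ?M = "perm_module G X \<alpha> :: ('f, _, _) grp_module"
  show ?thesis
  proof (intro group_module.intro group_module_axioms.intro assms(1))
    show "vectorspace class_ring ?M"
    proof (rule vs_criteria)
      show "\<forall>v\<in>carrier ?M. \<exists>neg_v\<in>carrier ?M. v \<oplus>\<^bsub>?M\<^esub> neg_v = \<zero>\<^bsub>?M\<^esub>"
      proof
        fix f assume "f \<in> carrier ?M"
        show "\<exists>h\<in>carrier ?M. f \<oplus>\<^bsub>?M\<^esub> h = \<zero>\<^bsub>?M\<^esub>"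
          by (intro bexI[of _ "\<lambda>x\<in>X. - f x"]) (auto intro!: restrict_ext)
      qed
    qed (auto simp: class_field algebra_simps extensional_def fun_eq_iff)
    show "act ?M g \<in> LinearCombinations.module_hom class_ring ?M ?M" if g: "g \<in> carrier G" for g
      unfolding LinearCombinations.module_hom_def using g by (auto simp: closed intro!: restrict_ext)
    show "act ?M \<one>\<^bsub>G\<^esub> f = f" if "f \<in> carrier ?M" for f
      using that by (auto simp: one extensional_def fun_eq_iff)
    show "act ?M (g \<otimes>\<^bsub>G\<^esub> h) f = act ?M g (act ?M h f)"
      if "g \<in> carrier G" "h \<in> carrier G" "f \<in> carrier ?M" for g h f
      using that by (auto simp: G.inv_mult_group mult closed intro!: restrict_ext)
  qed
qed

definition delta :: "'x set \<Rightarrow> 'x \<Rightarrow> 'x \<Rightarrow> 'f::field" where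
  "delta X x = (\<lambda>y\<in>X. if y = x then 1 else 0)"

lemma perm_module_induct [consumes 2, case_names zero add delta]:
  assumes "finite X" and m: "m \<in> extensional X"
    and zero: "P (\<lambda>x\<in>X. 0)"
    and add: "\<And>m x c. m \<in> extensional X \<Longrightarrow> P m \<Longrightarrow> x \<in> X \<Longrightarrow> P (\<lambda>y\<in>X. m y + (\<lambda>y\<in>X. c * delta X x y) y)"
  shows "P (m :: 'x \<Rightarrow> 'f::field)"
proof -
  have "\<forall>m. m \<in> extensional X \<longrightarrow> (\<forall>x\<in>X - Y. m x = 0) \<longrightarrow> P m" if "finite Y" "Y \<subseteq> X" for Y
    using that
  proof (induction Y rule: finite_induct)
    case empty
    show ?case
    proof (intro allI impI)
      fix m :: "'x \<Rightarrow> 'f" assume "m \<in> extensional X" "\<forall>x\<in>X - {}. m x = 0"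
      hence "m = (\<lambda>x\<in>X. 0)" by (auto simp: extensional_def fun_eq_iff)
      thus "P m" using zero by simp
    qed
  next
    case (insert y Y)
    show ?case
    proof (intro allI impI)
      fix m :: "'x \<Rightarrow> 'f" assume m: "m \<in> extensional X" "\<forall>x\<in>X - insert y Y. m x = 0"
      let ?m = "\<lambda>x\<in>X. if x = y then 0 else m x"
      have "P ?m" using insert m by auto
      from add[OF _ this, of y "m y"] have "P (\<lambda>x\<in>X. ?m x + (\<lambda>x\<in>X. m y * delta X y x) x)"
        using insert by auto
      also have "(\<lambda>x\<in>X. ?m x + (\<lambda>x\<in>X. m y * delta X y x) x) = m"
        using m by (auto simp: extensional_def fun_eq_iff delta_def)
      finally show "P m" .
    qed
  qed
  thus ?thesis using assms(1) m by blast
qed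

lemma perm_lin_maps_eqI:
  assumes "finite X" "X \<noteq> {}" and f: "f \<in> lin_maps (perm_module G X \<alpha>) E" "h \<in> lin_maps (perm_module G X \<alpha>) E"
    and eq: "\<And>x. x \<in> X \<Longrightarrow> f (delta X x) = h (delta X x)"
  shows "f = h"
proof
  fix m
  let ?M = "perm_module G X \<alpha>"
  have d: "delta X x \<in> extensional X" for x by (simp add: delta_def)
  have l: "g (\<lambda>x\<in>X. u x + v x) = g u \<oplus>\<^bsub>E\<^esub> g v" "g (\<lambda>x\<in>X. c * u x) = c \<odot>\<^bsub>E\<^esub> g u"
    if "g \<in> lin_maps ?M E" "u \<in> extensional X" "v \<in> extensional X" for g u v c
    using that unfolding lin_maps_iff by auto
  show "f m = h m"
  proof (cases "m \<in> extensional X")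
    case True
    from \<open>finite X\<close> this show ?thesis
    proof (induction m rule: perm_module_induct)
      case zero
      obtain x where x: "x \<in> X" using \<open>X \<noteq> {}\<close> by blast
      have z: "(\<lambda>x\<in>X. 0) = (\<lambda>y\<in>X. 0 * delta X x y)" by (auto simp: fun_eq_iff)
      show ?case unfolding z by (simp only: l(2)[OF f(1) d d] l(2)[OF f(2) d d] eq[OF x])
    next
      case (add m x c)
      have s: "(\<lambda>y\<in>X. c * delta X x y) \<in> extensional X" by simp
      show ?case
        by (simp only: l(1)[OF f(1) add(1) s] l(1)[OF f(2) add(1) s] l(2)[OF f(1) d d] l(2)[OF f(2) d d]
            add(3) eq[OF add(2)])
    qed
  next
    case False
    thus ?thesis using f by (auto simp: lin_maps_iff extensional_def)
  qed
qed

lemma (in group_module) map_finsum: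
  assumes "finite I" "\<And>i. i \<in> I \<Longrightarrow> u i \<in> carrier V"
    and closed: "\<And>x. x \<in> carrier V \<Longrightarrow> h x \<in> carrier V"
    and add: "\<And>x y. x \<in> carrier V \<Longrightarrow> y \<in> carrier V \<Longrightarrow> h (x \<oplus>\<^bsub>V\<^esub> y) = h x \<oplus>\<^bsub>V\<^esub> h y"
    and zero: "h \<zero>\<^bsub>V\<^esub> = \<zero>\<^bsub>V\<^esub>"
  shows "h (finsum V u I) = finsum V (\<lambda>i. h (u i)) I"
  using assms(1,2)
proof (induction I rule: finite_induct)
  case (insert i I)
  hence "u \<in> I \<rightarrow> carrier V" by auto
  thus ?case using insert by (simp add: finsum_insert add finsum_closed closed Pi_def)
qed (simp add: zero)

lemma (in group_module) lin_maps_zero: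
  assumes "f \<in> lin_maps V V" shows "f \<zero>\<^bsub>V\<^esub> = \<zero>\<^bsub>V\<^esub>"
proof -
  have "f (0 \<odot>\<^bsub>V\<^esub> \<zero>\<^bsub>V\<^esub>) = 0 \<odot>\<^bsub>V\<^esub> f \<zero>\<^bsub>V\<^esub>" and "f \<zero>\<^bsub>V\<^esub> \<in> carrier V"
    using assms unfolding lin_maps_iff by blast+
  thus ?thesis by simp
qed

text \<open>A homomorphism from a permutation module to the endomorphisms of \<open>V\<close> is an equivariant family of
  endomorphisms, given by its values at the basis elements; this is the homomorphism of the family \<open>F\<close>.\<close>

definition family_hom :: "('f::field, 'g, 'v) grp_module \<Rightarrow> 'x set \<Rightarrow> ('x \<Rightarrow> 'v \<Rightarrow> 'v) \<Rightarrow> ('x \<Rightarrow> 'f) \<Rightarrow> 'v \<Rightarrow> 'v" where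
  "family_hom V X F = (\<lambda>m\<in>extensional X. \<lambda>v\<in>carrier V. \<Oplus>\<^bsub>V\<^esub>x\<in>X. m x \<odot>\<^bsub>V\<^esub> F x v)"

locale perm_setting = group_module G V
  for G :: "'g monoid" and V :: "('f::field, 'g, 'v) grp_module" +
  fixes X :: "'x set" and \<alpha> :: "'g \<Rightarrow> 'x \<Rightarrow> 'x"
  assumes finite_X: "finite X" and X_nonempty: "X \<noteq> {}"
    and \<alpha>_closed: "\<And>g x. g \<in> carrier G \<Longrightarrow> x \<in> X \<Longrightarrow> \<alpha> g x \<in> X"
    and \<alpha>_one: "\<And>x. x \<in> X \<Longrightarrow> \<alpha> \<one>\<^bsub>G\<^esub> x = x"
    and \<alpha>_mult: "\<And>g h x. g \<in> carrier G \<Longrightarrow> h \<in> carrier G \<Longrightarrow> x \<in> X \<Longrightarrow> \<alpha> (g \<otimes>\<^bsub>G\<^esub> h) x = \<alpha> g (\<alpha> h x)"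
begin

abbreviation M :: "('f, 'g, 'x \<Rightarrow> 'f) grp_module" where "M \<equiv> perm_module G X \<alpha>"
abbreviation E :: "('f, 'g, 'v \<Rightarrow> 'v) grp_module" where "E \<equiv> End_module G V"
abbreviation homs :: "(('x \<Rightarrow> 'f) \<Rightarrow> 'v \<Rightarrow> 'v) set" where "homs \<equiv> grp_hom G M E"
abbreviation homs_space where "homs_space \<equiv> (Hom_module G M E)\<lparr>carrier := homs\<rparr>"

lemma M_module: "group_module G M"
  by (rule perm_group_module[OF G.is_group \<alpha>_closed \<alpha>_one \<alpha>_mult])

lemma E_module: "group_module G E"
  by (rule Hom_group_module[OF group_module_axioms group_module_axioms])

lemma homs_vectorspace: "vectorspace class_ring homs_space"
  by (rule grp_hom_vectorspace[OF M_module E_module])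

lemma delta_in [simp]: "delta X x \<in> extensional X" by (simp add: delta_def)

lemma inv_\<alpha>: "g \<in> carrier G \<Longrightarrow> x \<in> X \<Longrightarrow> \<alpha> (inv\<^bsub>G\<^esub> g) (\<alpha> g x) = x" "g \<in> carrier G \<Longrightarrow> x \<in> X \<Longrightarrow> \<alpha> g (\<alpha> (inv\<^bsub>G\<^esub> g) x) = x"
  using \<alpha>_mult[of "inv\<^bsub>G\<^esub> g" g x] \<alpha>_mult[of g "inv\<^bsub>G\<^esub> g" x] \<alpha>_one[of x] by simp_all

lemma act_delta:
  assumes "g \<in> carrier G" "x \<in> X"
  shows "act M g (delta X x) = delta X (\<alpha> g x)"
proof -
  have "\<alpha> (inv\<^bsub>G\<^esub> g) y = x \<longleftrightarrow> y = \<alpha> g x" if "y \<in> X" for y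
    using inv_\<alpha>[OF assms] inv_\<alpha>(2)[OF assms(1) that] by metis
  thus ?thesis using assms \<alpha>_closed by (auto simp: delta_def intro!: restrict_ext)
qed

lemma inv_act: "g \<in> carrier G \<Longrightarrow> v \<in> carrier V \<Longrightarrow> act V g (act V (inv\<^bsub>G\<^esub> g) v) = v"
   "g \<in> carrier G \<Longrightarrow> v \<in> carrier V \<Longrightarrow> act V (inv\<^bsub>G\<^esub> g) (act V g v) = v"
  using act_mult[of g "inv\<^bsub>G\<^esub> g" v] act_mult[of "inv\<^bsub>G\<^esub> g" g v] by (simp_all add: act_one)

lemma homs_eqI:
  assumes "\<phi> \<in> homs" "\<psi> \<in> homs" "\<And>x v. x \<in> X \<Longrightarrow> v \<in> carrier V \<Longrightarrow> \<phi> (delta X x) v = \<psi> (delta X x) v"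
  shows "\<phi> = \<psi>"
proof (rule perm_lin_maps_eqI[OF finite_X X_nonempty])
  show "\<phi> \<in> lin_maps M E" "\<psi> \<in> lin_maps M E" using assms by (auto simp: grp_hom_def)
  fix x assume x: "x \<in> X"
  have "\<phi> (delta X x) \<in> lin_maps V V" "\<psi> (delta X x) \<in> lin_maps V V"
    using assms(1,2) by (auto simp: grp_hom_def lin_maps_iff)
  thus "\<phi> (delta X x) = \<psi> (delta X x)" using assms(3)[OF x]
    by (intro extensionalityI[of _ "carrier V"]) (auto simp: lin_maps_iff)
qed

lemma family_hom_in_homs:
  assumes F: "\<And>x. x \<in> X \<Longrightarrow> F x \<in> lin_maps V V"
    and equi: "\<And>g x v. g \<in> carrier G \<Longrightarrow> x \<in> X \<Longrightarrow> v \<in> carrier V \<Longrightarrow> F (\<alpha> g x) (act V g v) = act V g (F x v)"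
  shows "family_hom V X F \<in> homs"
    and "x \<in> X \<Longrightarrow> v \<in> carrier V \<Longrightarrow> family_hom V X F (delta X x) v = F x v"
proof -
  have Fc: "F x v \<in> carrier V" if "x \<in> X" "v \<in> carrier V" for x v using F[OF that(1)] that(2) by (auto simp: lin_maps_iff)
  let ?S = "\<lambda>m v. \<Oplus>\<^bsub>V\<^esub>x\<in>X. m x \<odot>\<^bsub>V\<^esub> F x v"
  have S_closed: "?S m v \<in> carrier V" if "v \<in> carrier V" for m v
    using that Fc by (intro finsum_closed) auto
  have S_add: "?S m (u \<oplus>\<^bsub>V\<^esub> v) = ?S m u \<oplus>\<^bsub>V\<^esub> ?S m v" if "u \<in> carrier V" "v \<in> carrier V" for m u v
  proof -
    have "?S m (u \<oplus>\<^bsub>V\<^esub> v) = (\<Oplus>\<^bsub>V\<^esub>x\<in>X. m x \<odot>\<^bsub>V\<^esub> F x u \<oplus>\<^bsub>V\<^esub> m x \<odot>\<^bsub>V\<^esub> F x v)"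
      using F Fc that by (intro finsum_cong') (auto simp: lin_maps_iff smult_add)
    also have "\<dots> = ?S m u \<oplus>\<^bsub>V\<^esub> ?S m v" using Fc that by (intro finsum_addf) auto
    finally show ?thesis .
  qed
  have S_smult: "?S m (c \<odot>\<^bsub>V\<^esub> u) = c \<odot>\<^bsub>V\<^esub> ?S m u" if "u \<in> carrier V" for m c u
  proof -
    have "?S m (c \<odot>\<^bsub>V\<^esub> u) = (\<Oplus>\<^bsub>V\<^esub>x\<in>X. c \<odot>\<^bsub>V\<^esub> (m x \<odot>\<^bsub>V\<^esub> F x u))"
      using F Fc that by (intro finsum_cong') (auto simp: lin_maps_iff smult_mult[symmetric] mult.commute)
    also have "\<dots> = c \<odot>\<^bsub>V\<^esub> ?S m u"
      using Fc that finite_X by (intro map_finsum[symmetric]) (auto simp: smult_add)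
    finally show ?thesis .
  qed
  have lin: "family_hom V X F m \<in> lin_maps V V" if "m \<in> extensional X" for m
    using that S_closed S_add S_smult by (simp add: family_hom_def lin_maps_iff)
  have m_add: "?S (\<lambda>x\<in>X. m x + m' x) v = ?S m v \<oplus>\<^bsub>V\<^esub> ?S m' v" if "v \<in> carrier V" for m m' v
  proof -
    have "?S (\<lambda>x\<in>X. m x + m' x) v = (\<Oplus>\<^bsub>V\<^esub>x\<in>X. m x \<odot>\<^bsub>V\<^esub> F x v \<oplus>\<^bsub>V\<^esub> m' x \<odot>\<^bsub>V\<^esub> F x v)"
      using Fc that by (intro finsum_cong') (auto simp: smult_plus)
    also have "\<dots> = ?S m v \<oplus>\<^bsub>V\<^esub> ?S m' v" using Fc that by (intro finsum_addf) auto
    finally show ?thesis .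
  qed
  have m_smult: "?S (\<lambda>x\<in>X. c * m x) v = c \<odot>\<^bsub>V\<^esub> ?S m v" if "v \<in> carrier V" for m c v
  proof -
    have "?S (\<lambda>x\<in>X. c * m x) v = (\<Oplus>\<^bsub>V\<^esub>x\<in>X. c \<odot>\<^bsub>V\<^esub> (m x \<odot>\<^bsub>V\<^esub> F x v))"
      using Fc that by (intro finsum_cong') (auto simp: smult_mult)
    also have "\<dots> = c \<odot>\<^bsub>V\<^esub> ?S m v"
      using Fc that finite_X by (intro map_finsum[symmetric]) (auto simp: smult_add)
    finally show ?thesis .
  qed
  have act: "?S (\<lambda>x\<in>X. m (\<alpha> (inv\<^bsub>G\<^esub> g) x)) v = act V g (?S m (act V (inv\<^bsub>G\<^esub> g) v))"
    if g: "g \<in> carrier G" and v: "v \<in> carrier V" for g m v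
  proof -
    let ?w = "act V (inv\<^bsub>G\<^esub> g) v"
    have w: "?w \<in> carrier V" using g v by simp
    have inj: "inj_on (\<alpha> g) X" using inv_\<alpha>(1)[OF g] by (metis inj_onI)
    have im: "\<alpha> g ` X = X"
    proof
      show "X \<subseteq> \<alpha> g ` X" using inv_\<alpha>(2)[OF g] \<alpha>_closed g by (metis G.inv_closed image_iff subsetI)
    qed (use \<alpha>_closed g in auto)
    have "?S (\<lambda>x\<in>X. m (\<alpha> (inv\<^bsub>G\<^esub> g) x)) v = (\<Oplus>\<^bsub>V\<^esub>x\<in>\<alpha> g ` X. m (\<alpha> (inv\<^bsub>G\<^esub> g) x) \<odot>\<^bsub>V\<^esub> F x v)"
      unfolding im using Fc v by (intro finsum_cong') auto
    also have "\<dots> = (\<Oplus>\<^bsub>V\<^esub>x\<in>X. m (\<alpha> (inv\<^bsub>G\<^esub> g) (\<alpha> g x)) \<odot>\<^bsub>V\<^esub> F (\<alpha> g x) v)"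
      using inj im Fc v \<alpha>_closed g by (intro finsum_reindex) auto
    also have "\<dots> = (\<Oplus>\<^bsub>V\<^esub>x\<in>X. act V g (m x \<odot>\<^bsub>V\<^esub> F x ?w))"
    proof (rule finsum_cong')
      fix x assume x: "x \<in> X"
      have "F (\<alpha> g x) v = act V g (F x ?w)" using equi[OF g x w] inv_act(1)[OF g v] by simp
      thus "m (\<alpha> (inv\<^bsub>G\<^esub> g) (\<alpha> g x)) \<odot>\<^bsub>V\<^esub> F (\<alpha> g x) v = act V g (m x \<odot>\<^bsub>V\<^esub> F x ?w)"
        using x g w Fc by (simp add: inv_\<alpha> act_smult)
    qed (use Fc w g in auto)
    also have "\<dots> = act V g (?S m ?w)"
      using Fc w finite_X g by (intro map_finsum[symmetric]) (auto simp: act_add)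
    finally show ?thesis .
  qed
  show "family_hom V X F \<in> homs"
    unfolding grp_hom_def mem_Collect_eq
  proof (intro conjI ballI)
    show "family_hom V X F \<in> lin_maps M E"
      unfolding lin_maps_iff[of _ M E]
    proof (intro conjI ballI allI)
      show "family_hom V X F m \<in> carrier E" if "m \<in> carrier M" for m using lin that by simp
    qed (auto simp: family_hom_def m_add[unfolded restrict_apply] m_smult[unfolded restrict_apply] intro!: restrict_ext)
    show "family_hom V X F (act M g m) = act E g (family_hom V X F m)"
      if "g \<in> carrier G" "m \<in> carrier M" for g m
      using that by (auto simp: family_hom_def act[unfolded restrict_apply] intro!: restrict_ext)
  qed
  show "family_hom V X F (delta X x) v = F x v" if "x \<in> X" "v \<in> carrier V"
  proof -
    have "?S (delta X x) v = (\<Oplus>\<^bsub>V\<^esub>y\<in>X. if x = y then F y v else \<zero>\<^bsub>V\<^esub>)"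
      using that Fc by (intro finsum_cong') (auto simp: delta_def)
    also have "\<dots> = F x v" using finsum_singleton[OF that(1) finite_X, of "\<lambda>y. F y v"] Fc that by auto
    finally show ?thesis using that by (simp add: family_hom_def)
  qed
qed

text \<open>A homomorphism is determined by the finitely many coordinates of its values at basis elements of the
  permutation module and of \<open>V\<close>.\<close>

lemma homs_fin_dim:
  assumes "fin_dim"
  shows "vectorspace.fin_dim class_ring homs_space"
proof -
  obtain \<kappa> :: "'v \<Rightarrow> 'v \<Rightarrow> 'f" and B where \<kappa>: "inj_on \<kappa> (carrier V)"
    "\<And>x y. x \<in> carrier V \<Longrightarrow> y \<in> carrier V \<Longrightarrow> \<kappa> (x \<oplus>\<^bsub>V\<^esub> y) = \<kappa> x + \<kappa> y"
    "\<And>c x. x \<in> carrier V \<Longrightarrow> \<kappa> (c \<odot>\<^bsub>V\<^esub> x) = fscale c (\<kappa> x)"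
    "finite B" "B \<subseteq> carrier V" "span B = carrier V"
    "\<And>x b. b \<notin> B \<Longrightarrow> \<kappa> x b = 0"
    by (rule exists_coordinates[OF vectorspace_axioms assms], rule that)
  have zero: "\<kappa> \<zero>\<^bsub>V\<^esub> = 0" using \<kappa>(3)[of "\<zero>\<^bsub>V\<^esub>" 0] by (auto simp: fun_eq_iff)
  interpret E: group_module G E by (rule E_module)
  have lin: "\<phi> (delta X x) \<in> lin_maps V V" if "\<phi> \<in> homs" for \<phi> x
    using that by (auto simp: grp_hom_def lin_maps_iff)
  define T where "T \<phi> = (\<lambda>(x, b, b'). \<kappa> (\<phi> (delta X x) b) b')" for \<phi> :: "('x \<Rightarrow> 'f) \<Rightarrow> 'v \<Rightarrow> 'v"
  define T' where "T' \<phi> i = (if fst (snd i) \<in> carrier V then T \<phi> i else 0)" for \<phi> i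
  show ?thesis
  proof (rule fin_dim_if_separated[OF homs_vectorspace, of "X \<times> B \<times> B" T'])
    show "finite (X \<times> B \<times> B)" using finite_X \<kappa>(4) by simp
  next
    fix \<phi> \<psi> i assume "\<phi> \<in> carrier homs_space" "\<psi> \<in> carrier homs_space"
    hence "\<phi> \<in> homs" "\<psi> \<in> homs" by simp_all
    thus "T' (\<phi> \<oplus>\<^bsub>homs_space\<^esub> \<psi>) i = T' \<phi> i + T' \<psi> i"
      using lin[of \<phi>] lin[of \<psi>] by (auto simp: T'_def T_def split_beta lin_maps_iff \<kappa>(2))
  next
    fix c \<phi> i assume "\<phi> \<in> carrier homs_space"
    hence "\<phi> \<in> homs" by simp
    thus "T' (c \<odot>\<^bsub>homs_space\<^esub> \<phi>) i = c * T' \<phi> i"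
      using lin[of \<phi>] by (auto simp: T'_def T_def split_beta lin_maps_iff \<kappa>(3))
  next
    fix \<phi> assume "\<phi> \<in> carrier homs_space" and 0: "\<And>i. i \<in> X \<times> B \<times> B \<Longrightarrow> T' \<phi> i = 0"
    hence \<phi>: "\<phi> \<in> homs" by simp
    have "\<phi> (delta X x) v = \<zero>\<^bsub>V\<^esub>" if x: "x \<in> X" and v: "v \<in> carrier V" for x v
    proof -
      let ?f = "\<phi> (delta X x)"
      have f: "?f \<in> lin_maps V V" by (rule lin[OF \<phi>])
      have fB: "?f b = \<zero>\<^bsub>V\<^esub>" if b: "b \<in> B" for b
      proof -
        have bV: "b \<in> carrier V" using b \<kappa>(5) by blast
        have "\<kappa> (?f b) b' = 0" for b'
        proof (cases "b' \<in> B")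
          case True
          thus ?thesis using 0[of "(x, b, b')"] x b bV by (simp add: T'_def T_def)
        qed (simp add: \<kappa>(7))
        hence "\<kappa> (?f b) = \<kappa> \<zero>\<^bsub>V\<^esub>" unfolding zero by (simp add: fun_eq_iff)
        thus ?thesis using \<kappa>(1) f bV by (auto simp: lin_maps_iff dest: inj_onD)
      qed
      have "submodule class_ring {v \<in> carrier V. ?f v = \<zero>\<^bsub>V\<^esub>} V"
      proof
        show "\<zero>\<^bsub>V\<^esub> \<in> {v \<in> carrier V. ?f v = \<zero>\<^bsub>V\<^esub>}"
          using lin_maps_zero[OF f] by simp
      qed (use f in \<open>auto simp: lin_maps_iff\<close>)
      hence "span B \<subseteq> {v \<in> carrier V. ?f v = \<zero>\<^bsub>V\<^esub>}"
        using fB \<kappa>(5) by (intro span_is_subset) auto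
      thus ?thesis using v \<kappa>(6) by auto
    qed
    moreover have z: "(\<lambda>m\<in>carrier M. \<zero>\<^bsub>E\<^esub>) \<in> homs"
    proof -
      interpret H: vectorspace class_ring homs_space by (rule homs_vectorspace)
      show ?thesis using H.zero_closed by simp
    qed
    ultimately have "\<phi> = (\<lambda>m\<in>carrier M. \<zero>\<^bsub>E\<^esub>)" by (intro homs_eqI[OF \<phi> z]) simp
    thus "\<phi> = \<zero>\<^bsub>homs_space\<^esub>" by simp
  qed
qed

end

section \<open>Modules whose invariants are 1\<close>

context perm_setting
begin

text \<open>For a transitive action a homomorphism is determined by its value at one point \<open>x0\<close>, an endomorphism that
  commutes with the stabilizer of \<open>x0\<close>. If these are scalars, the space is the line of the constant
  families.\<close>

lemma dim_homs_one:
  assumes x0: "x0 \<in> X" and trans: "\<And>x. x \<in> X \<Longrightarrow> \<exists>g\<in>carrier G. \<alpha> g x0 = x"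
    and nonzero: "carrier V \<noteq> {\<zero>\<^bsub>V\<^esub>}"
    and scalar: "\<And>f. f \<in> lin_maps V V \<Longrightarrow>
      (\<And>g v. g \<in> carrier G \<Longrightarrow> \<alpha> g x0 = x0 \<Longrightarrow> v \<in> carrier V \<Longrightarrow> f (act V g v) = act V g (f v)) \<Longrightarrow>
      \<exists>e. \<forall>v\<in>carrier V. f v = e \<odot>\<^bsub>V\<^esub> v"
  shows "vectorspace.dim class_ring homs_space = 1"
proof -
  interpret H: vectorspace class_ring homs_space by (rule homs_vectorspace)
  let ?\<epsilon> = "family_hom V X (\<lambda>_. \<lambda>v\<in>carrier V. v)"
  have \<epsilon>: "?\<epsilon> \<in> homs" "\<And>x v. x \<in> X \<Longrightarrow> v \<in> carrier V \<Longrightarrow> ?\<epsilon> (delta X x) v = v"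
    using family_hom_in_homs[of "\<lambda>_. \<lambda>v\<in>carrier V. v"] by (auto simp: lin_maps_iff)
  have \<epsilon>H: "?\<epsilon> \<in> carrier homs_space" using \<epsilon>(1) by simp
  have sub: "submodule class_ring (H.span {?\<epsilon>}) homs_space" using \<epsilon>H by (intro H.span_is_submodule) simp
  have "\<phi> \<in> H.span {?\<epsilon>}" if \<phi>: "\<phi> \<in> homs" for \<phi>
  proof -
    let ?f = "\<phi> (delta X x0)"
    have equi: "\<phi> (delta X (\<alpha> g x0)) v = act V g (?f (act V (inv\<^bsub>G\<^esub> g) v))"
      if "g \<in> carrier G" "v \<in> carrier V" for g v
    proof -
      have "\<phi> (act M g (delta X x0)) = act E g (\<phi> (delta X x0))"
        using \<phi> that(1) delta_in[of x0] unfolding grp_hom_def by (simp del: perm_module_sel(5) Hom_module_sel)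
      thus ?thesis unfolding act_delta[OF that(1) x0] using that by simp
    qed
    have f: "?f \<in> lin_maps V V" using \<phi> delta_in[of x0] by (auto simp: grp_hom_def lin_maps_iff)
    hence fc: "?f v \<in> carrier V" if "v \<in> carrier V" for v using that by (auto simp: lin_maps_iff)
    have "?f (act V g v) = act V g (?f v)" if "g \<in> carrier G" "\<alpha> g x0 = x0" "v \<in> carrier V" for g v
      using equi[of g "act V g v"] that by (simp add: inv_act)
    then obtain e where e: "\<And>v. v \<in> carrier V \<Longrightarrow> ?f v = e \<odot>\<^bsub>V\<^esub> v" using scalar[OF f] by blast
    have mem: "e \<odot>\<^bsub>homs_space\<^esub> ?\<epsilon> \<in> homs" using H.smult_closed[of e ?\<epsilon>] \<epsilon>H by simp
    have "\<phi> = e \<odot>\<^bsub>homs_space\<^esub> ?\<epsilon>"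
    proof (rule homs_eqI[OF \<phi> mem])
      fix x v assume x: "x \<in> X" and v: "v \<in> carrier V"
      obtain g where g: "g \<in> carrier G" "\<alpha> g x0 = x" using trans[OF x] by blast
      have "\<phi> (delta X x) v = act V g (e \<odot>\<^bsub>V\<^esub> act V (inv\<^bsub>G\<^esub> g) v)" using equi[OF g(1) v] g e v by simp
      also have "\<dots> = e \<odot>\<^bsub>V\<^esub> v" using g v by (simp add: act_smult inv_act)
      finally show "\<phi> (delta X x) v = (e \<odot>\<^bsub>homs_space\<^esub> ?\<epsilon>) (delta X x) v" using \<epsilon>(2)[OF x v] v by simp
    qed
    thus ?thesis using submodule.smult_closed[OF sub, of e ?\<epsilon>] H.in_own_span[of "{?\<epsilon>}"] \<epsilon>H by simp
  qed
  hence "H.span {?\<epsilon>} = carrier homs_space"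
    using H.span_is_subset2[of "{?\<epsilon>}"] \<epsilon>H by auto
  moreover have "?\<epsilon> \<noteq> \<zero>\<^bsub>homs_space\<^esub>"
  proof
    assume z: "?\<epsilon> = \<zero>\<^bsub>homs_space\<^esub>"
    have "v = \<zero>\<^bsub>V\<^esub>" if "v \<in> carrier V" for v
      using \<epsilon>(2)[OF x0 that] that unfolding z by simp
    thus False using nonzero zero_closed by blast
  qed
  ultimately show ?thesis using \<epsilon>H by (intro H.dim1I)
qed

end

abbreviation subsets :: "nat \<Rightarrow> nat \<Rightarrow> nat set set" where
  "subsets n r \<equiv> {A. A \<subseteq> {1..n} \<and> card A = r}"

lemma finite_subsets: "finite (subsets n r)"
  by (rule finite_subset[of _ "Pow {1..n}"]) auto

lemma subset_setting:
  assumes "group_module (sym_group n) V" "r \<le> n"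
  shows "perm_setting (sym_group n) V (subsets n r) (\<lambda>p A. p ` A)"
proof (rule perm_setting.intro[OF assms(1)], unfold_locales)
  show "finite (subsets n r)" by (rule finite_subsets)
  have "{1..r} \<in> subsets n r" using assms(2) by auto
  thus "subsets n r \<noteq> {}" by blast
  show "p ` A \<in> subsets n r" if "p \<in> carrier (sym_group n)" "A \<in> subsets n r" for p A
    using that permutes_in_image[of p "{1..n}"] permutes_inj_on[of p "{1..n}" A]
    by (auto simp: sym_group_carrier card_image)
qed (auto simp: sym_group_one sym_group_mult)

lemma exists_permutes_image:
  assumes "finite S" "A \<subseteq> S" "B \<subseteq> S" "card A = card B"
  shows "\<exists>p. p permutes S \<and> p ` A = B"
proof -
  have fin: "finite A" "finite B" using assms finite_subset by blast+
  obtain f where f: "bij_betw f A B" using assms(4) fin by (metis finite_same_card_bij)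
  have "card (S - A) = card (S - B)" using assms fin by (simp add: card_Diff_subset)
  then obtain g where g: "bij_betw g (S - A) (S - B)" using assms by (metis finite_Diff finite_same_card_bij)
  define p where "p x = (if x \<in> A then f x else if x \<in> S then g x else x)" for x
  have "bij_betw p A B" using f by (rule bij_betw_cong[THEN iffD1, rotated]) (simp add: p_def)
  moreover have "bij_betw p (S - A) (S - B)" using g by (rule bij_betw_cong[THEN iffD1, rotated]) (simp add: p_def)
  ultimately have "bij_betw p (A \<union> (S - A)) (B \<union> (S - B))" by (rule bij_betw_combine) auto
  hence "bij_betw p S S" using assms by (simp add: Un_absorb1)
  hence "p permutes S" by (rule bij_imp_permutes) (use assms in \<open>auto simp: p_def\<close>)
  moreover have "p ` A = B" using \<open>bij_betw p A B\<close> by (simp add: bij_betw_def)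
  ultimately show ?thesis by blast
qed

lemma d_inv_eq_one:
  fixes V :: "('f::field, nat \<Rightarrow> nat, 'v) grp_module"
  assumes V: "group_module (sym_group n) V" and r: "r \<le> n" and nonzero: "carrier V \<noteq> {\<zero>\<^bsub>V\<^esub>}"
    and scalar: "\<And>f. f \<in> lin_maps V V \<Longrightarrow>
      (\<And>p v. p \<in> carrier (sym_group n) \<Longrightarrow> p ` {1..r} = {1..r} \<Longrightarrow> v \<in> carrier V \<Longrightarrow> f (act V p v) = act V p (f v)) \<Longrightarrow>
      \<exists>e. \<forall>v\<in>carrier V. f v = e \<odot>\<^bsub>V\<^esub> v"
  shows "d_inv n r V = 1"
proof -
  interpret perm_setting "sym_group n" V "subsets n r" "\<lambda>p A. p ` A" by (rule subset_setting[OF V r])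
  have r0: "{1..r} \<in> subsets n r" using r by auto
  have "\<exists>g\<in>carrier (sym_group n). g ` {1..r} = A" if "A \<in> subsets n r" for A
  proof -
    have "{1..r} \<subseteq> {1..n}" "A \<subseteq> {1..n}" "card {1..r} = card A" using that r by auto
    from exists_permutes_image[OF finite_atLeastAtMost this]
    obtain p where "p permutes {1..n}" "p ` {1..r} = A" by blast
    thus ?thesis unfolding sym_group_carrier[symmetric] by blast
  qed
  from dim_homs_one[OF r0 this nonzero scalar] show ?thesis
    unfolding d_inv_def dim_grp_hom_def subset_module_def .
qed

lemma spin_module_d_inv:
  fixes V :: "('f::field, nat \<Rightarrow> nat, 'v) grp_module"
  assumes V: "spin_module n V" and char: "CHAR('f) = 2" and n: "n = 2*k" "k \<ge> 2" and r: "odd r" "r \<le> n"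
  shows "d_inv n r V = 1"
proof -
  have V': "group_module (sym_group n) V" "carrier V \<noteq> {\<zero>\<^bsub>V\<^esub>}"
    using V unfolding spin_module_def simple_module_def by blast+
  have A: "{1..r} \<subseteq> {1..n}" "odd (card {1..r})" using r by auto
  show ?thesis
  proof (rule d_inv_eq_one[OF V'(1) r(2) V'(2)])
    fix f assume f: "f \<in> lin_maps V V" and comm: "\<And>p v. p \<in> carrier (sym_group n) \<Longrightarrow> p ` {1..r} = {1..r} \<Longrightarrow> v \<in> carrier V \<Longrightarrow> f (act V p v) = act V p (f v)"
    have f': "f x \<in> carrier V" "f (x \<oplus>\<^bsub>V\<^esub> y) = f x \<oplus>\<^bsub>V\<^esub> f y" "f (c \<odot>\<^bsub>V\<^esub> x) = c \<odot>\<^bsub>V\<^esub> f x"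
      if "x \<in> carrier V" "y \<in> carrier V" for x y c using f that by (auto simp: lin_maps_iff)
    obtain e where "\<And>x. x \<in> carrier V \<Longrightarrow> f x = e \<odot>\<^bsub>V\<^esub> x"
      by (rule spin_module_stabilizer_scalar[OF V char n A, of f]) (use f' comm in auto)
    thus "\<exists>e. \<forall>v\<in>carrier V. f v = e \<odot>\<^bsub>V\<^esub> v" by blast
  qed
qed

lemma trivial_d_inv:
  fixes V :: "('f::field, nat \<Rightarrow> nat, 'v) grp_module"
  assumes simple: "simple_module (sym_group n) V" and iso: "grp_iso (sym_group n) V trivial_module" and r: "r \<le> n"
  shows "d_inv n r V = 1"
proof -
  interpret V: group_module "sym_group n" V using simple unfolding simple_module_def by blast
  obtain h where h: "h \<in> grp_hom (sym_group n) V trivial_module" "bij_betw h (carrier V) (UNIV :: 'f set)"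
    using iso unfolding grp_iso_def by (auto simp: trivial_module_def)
  have hs: "h (c \<odot>\<^bsub>V\<^esub> x) = c * h x" if "x \<in> carrier V" for c x
    using h(1) that by (auto simp: grp_hom_def lin_maps_iff trivial_module_def)
  obtain u where u: "u \<in> carrier V" "h u = 1" using h(2) unfolding bij_betw_def by (metis UNIV_I imageE)
  have all: "v = h v \<odot>\<^bsub>V\<^esub> u" if "v \<in> carrier V" for v
  proof -
    have "h v = h (h v \<odot>\<^bsub>V\<^esub> u)" using hs u by simp
    thus ?thesis using h(2) that u unfolding bij_betw_def by (meson V.sm_closed inj_onD)
  qed
  show ?thesis
  proof (rule d_inv_eq_one[OF V.group_module_axioms r])
    show "carrier V \<noteq> {\<zero>\<^bsub>V\<^esub>}" using simple unfolding simple_module_def by blast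
    fix f assume f: "f \<in> lin_maps V V"
    have fu: "f u \<in> carrier V" using f u by (auto simp: lin_maps_iff)
    have "f v = h (f u) \<odot>\<^bsub>V\<^esub> v" if v: "v \<in> carrier V" for v
    proof -
      have "f v = f (h v \<odot>\<^bsub>V\<^esub> u)" using all[OF v] by simp
      also have "\<dots> = h v \<odot>\<^bsub>V\<^esub> f u" using f u by (auto simp: lin_maps_iff)
      also have "\<dots> = h v \<odot>\<^bsub>V\<^esub> (h (f u) \<odot>\<^bsub>V\<^esub> u)" using all[OF fu] by simp
      also have "\<dots> = h (f u) \<odot>\<^bsub>V\<^esub> (h v \<odot>\<^bsub>V\<^esub> u)" using u by (simp add: mult.commute flip: V.smult_mult)
      finally show ?thesis using all[OF v] by simp
    qed
    thus "\<exists>e. \<forall>v\<in>carrier V. f v = e \<odot>\<^bsub>V\<^esub> v" by blast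
  qed
qed

section \<open>Comparison of the first and the third invariant\<close>

text \<open>Taking the unordered pair as argument avoids a choice of order in sums over pairs.\<close>

definition swap_on :: "'a set \<Rightarrow> 'a \<Rightarrow> 'a" where
  "swap_on e = (THE p. \<exists>a b. e = {a, b} \<and> p = swap a b)"

lemma swap_on_doubleton [simp]: "swap_on {a, b} = swap a b"
  unfolding swap_on_def by (rule the_equality) (auto simp: doubleton_eq_iff transpose_commute)

lemma subsets_2E:
  assumes "e \<subseteq> A" "card e = 2" obtains a b where "e = {a, b}" "a \<in> A" "b \<in> A" "a \<noteq> b"
  using assms by (auto simp: card_2_iff)

text \<open>In terms of coefficient functions, this is the map from the permutation module on \<open>r\<close>-subsets to the one
  on points that sends a subset to the sum of its points.\<close>

definition push :: "nat \<Rightarrow> nat \<Rightarrow> (nat set \<Rightarrow> 'f::field) \<Rightarrow> nat set \<Rightarrow> 'f" where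
  "push n r m = (\<lambda>S\<in>subsets n 1. \<Sum>A | A \<in> subsets n r \<and> S \<subseteq> A. m A)"

lemma push_delta:
  assumes "A \<in> subsets n r"
  shows "push n r (delta (subsets n r) A) = (\<lambda>S\<in>subsets n 1. if S \<subseteq> A then 1 else 0)"
proof -
  have "(\<Sum>B | B \<in> subsets n r \<and> S \<subseteq> B. delta (subsets n r) A B) = (if S \<subseteq> A then 1 else 0)" for S
  proof -
    have "(\<Sum>B | B \<in> subsets n r \<and> S \<subseteq> B. delta (subsets n r) A B)
        = (\<Sum>B | B \<in> subsets n r \<and> S \<subseteq> B. if B = A then 1 else 0)"
      by (rule sum.cong) (auto simp: delta_def)
    also have "\<dots> = (if S \<subseteq> A then 1 else 0)"
      using assms finite_subset[OF _ finite_subsets[of n r], of "{B. B \<in> subsets n r \<and> S \<subseteq> B}"]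
      by (subst sum.delta) auto
    finally show ?thesis .
  qed
  thus ?thesis unfolding push_def by (intro restrict_ext)
qed

lemma push_add: "push n r (\<lambda>A\<in>subsets n r. u A + v A) = (\<lambda>S\<in>subsets n 1. push n r u S + push n r v S)"
proof -
  have *: "(\<Sum>A | A \<in> subsets n r \<and> S \<subseteq> A. (\<lambda>A\<in>subsets n r. u A + v A) A)
      = (\<Sum>A | A \<in> subsets n r \<and> S \<subseteq> A. u A + v A)" for S
    by (rule sum.cong) auto
  show ?thesis unfolding push_def by (intro restrict_ext) (simp only: restrict_apply' * sum.distrib)
qed

lemma push_smult: "push n r (\<lambda>A\<in>subsets n r. c * u A) = (\<lambda>S\<in>subsets n 1. c * push n r u S)"
proof -
  have *: "(\<Sum>A | A \<in> subsets n r \<and> S \<subseteq> A. (\<lambda>A\<in>subsets n r. c * u A) A)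
      = (\<Sum>A | A \<in> subsets n r \<and> S \<subseteq> A. c * u A)" for S
    by (rule sum.cong) auto
  show ?thesis unfolding push_def by (intro restrict_ext) (simp only: restrict_apply' * sum_distrib_left)
qed

lemma push_act:
  assumes g: "g \<in> carrier (sym_group n)"
  shows "push n r (\<lambda>A\<in>subsets n r. m ((inv\<^bsub>sym_group n\<^esub> g) ` A))
    = (\<lambda>S\<in>subsets n 1. push n r m ((inv\<^bsub>sym_group n\<^esub> g) ` S))"
proof (unfold push_def, intro restrict_ext)
  interpret group "sym_group n" by (rule sym_group_is_group)
  let ?h = "inv\<^bsub>sym_group n\<^esub> g"
  have p: "g permutes {1..n}" "?h permutes {1..n}" using g inv_closed[OF g] by (simp_all only: sym_group_carrier)
  have h: "?h = Hilbert_Choice.inv g" using g by simp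
  have im: "?h ` A \<in> subsets n s" if "A \<in> subsets n s" for A s
    using that permutes_in_image[OF p(2)] permutes_inj_on[OF p(2), of A] by (auto simp: card_image)
  have im': "g ` A \<in> subsets n s" if "A \<in> subsets n s" for A s
    using that permutes_in_image[OF p(1)] permutes_inj_on[OF p(1), of A] by (auto simp: card_image)
  have hg: "?h ` (g ` A) = A" "g ` (?h ` A) = A" for A
    unfolding h image_comp permutes_inv_o[OF p(1)] by simp_all
  fix S assume S: "S \<in> subsets n 1"
  have "(\<Sum>A | A \<in> subsets n r \<and> S \<subseteq> A. (\<lambda>A\<in>subsets n r. m (?h ` A)) A) = (\<Sum>A | A \<in> subsets n r \<and> S \<subseteq> A. m (?h ` A))"
    by (rule sum.cong) auto
  also have "\<dots> = (\<Sum>A | A \<in> subsets n r \<and> ?h ` S \<subseteq> A. m A)"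
  proof (rule sum.reindex_bij_witness[of _ "\<lambda>A. g ` A" "\<lambda>A. ?h ` A"])
    fix A assume A: "A \<in> {A. A \<in> subsets n r \<and> ?h ` S \<subseteq> A}"
    have "g ` (?h ` S) \<subseteq> g ` A" using A by blast
    thus "g ` A \<in> {A. A \<in> subsets n r \<and> S \<subseteq> A}" using A im'[of A r] unfolding hg by blast
  next
    fix A assume A: "A \<in> {A. A \<in> subsets n r \<and> S \<subseteq> A}"
    hence "?h ` S \<subseteq> ?h ` A" by blast
    thus "?h ` A \<in> {A. A \<in> subsets n r \<and> ?h ` S \<subseteq> A}" using A im[of A r] by blast
  qed (simp_all only: hg)
  also have "\<dots> = (\<lambda>S\<in>subsets n 1. \<Sum>A | A \<in> subsets n r \<and> S \<subseteq> A. m A) (?h ` S)"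
    using im[OF S] by (simp only: restrict_apply if_True)
  finally show "(\<Sum>A | A \<in> subsets n r \<and> S \<subseteq> A. (\<lambda>A\<in>subsets n r. m (?h ` A)) A)
     = (\<lambda>S\<in>subsets n 1. \<Sum>A | A \<in> subsets n r \<and> S \<subseteq> A. m A) (?h ` S)" .
qed

lemma char2_add_self: "CHAR('f::field) = 2 \<Longrightarrow> (x::'f) + x = 0"
proof -
  assume "CHAR('f) = 2"
  hence "(1 + 1 :: 'f) = 0" by (metis of_nat_CHAR of_nat_numeral one_add_one)
  thus ?thesis by (metis distrib_left mult.right_neutral mult_zero_right)
qed

text \<open>The map \<open>push n 3\<close> is onto in characteristic 2, so that composition with it embeds \<open>Hom(M\<^sub>1, E)\<close> into
  \<open>Hom(M\<^sub>3, E)\<close>. In the case of equal dimensions the embedding is an isomorphism.\<close>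

lemma d_inv_1_3:
  fixes V :: "('f::field, nat \<Rightarrow> nat, 'v) grp_module"
  assumes simple: "simple_module (sym_group n) V" and char: "CHAR('f) = 2" and n: "n \<ge> 5"
  shows "d_inv n 1 V \<le> d_inv n 3 V"
    and "d_inv n 1 V = d_inv n 3 V \<Longrightarrow>
      \<phi> \<in> grp_hom (sym_group n) (subset_module n 3) (End_module (sym_group n) V) \<Longrightarrow>
      \<exists>\<psi>\<in>grp_hom (sym_group n) (subset_module n 1) (End_module (sym_group n) V).
        \<forall>m\<in>extensional (subsets n 3). \<phi> m = \<psi> (push n 3 m)"
proof -
  let ?G = "sym_group n"
  interpret V: group_module ?G V using simple unfolding simple_module_def by blast
  interpret P1: perm_setting ?G V "subsets n 1" "\<lambda>p A. p ` A"
    by (rule subset_setting[OF V.group_module_axioms]) (use n in simp)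
  interpret P3: perm_setting ?G V "subsets n 3" "\<lambda>p A. p ` A"
    by (rule subset_setting[OF V.group_module_axioms]) (use n in simp)
  have fd: "V.fin_dim" by (rule V.fin_dim_if_simple[OF simple finite_sym_group])
  define T where "T \<psi> = (\<lambda>m\<in>extensional (subsets n 3). \<psi> (push n 3 m))" for \<psi> :: "(nat set \<Rightarrow> 'f) \<Rightarrow> 'v \<Rightarrow> 'v"
  have pe: "push n 3 m \<in> extensional (subsets n 1)" for m :: "nat set \<Rightarrow> 'f" by (simp add: push_def)
  have T_closed: "T \<psi> \<in> P3.homs" if \<psi>: "\<psi> \<in> P1.homs" for \<psi>
  proof -
    have lin: "\<psi> \<in> lin_maps P1.M P1.E" using \<psi> by (simp add: grp_hom_def)
    have equi: "\<psi> (act P1.M g m) = act P1.E g (\<psi> m)" if "g \<in> carrier ?G" "m \<in> extensional (subsets n 1)" for g m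
      using \<psi> that unfolding grp_hom_def by (simp only: mem_Collect_eq perm_module_sel(1))
    have add: "\<psi> (\<lambda>S\<in>subsets n 1. u S + v S) = \<psi> u \<oplus>\<^bsub>P1.E\<^esub> \<psi> v" and sm: "\<psi> (\<lambda>S\<in>subsets n 1. c * u S) = c \<odot>\<^bsub>P1.E\<^esub> \<psi> u"
      and cl: "\<psi> u \<in> lin_maps V V"
      if "u \<in> extensional (subsets n 1)" "v \<in> extensional (subsets n 1)" for u v c
      using lin that unfolding lin_maps_iff[of \<psi>] by (simp_all only: perm_module_sel Hom_module_sel(1))
    show ?thesis unfolding grp_hom_def mem_Collect_eq
    proof (intro conjI ballI)
      show "T \<psi> \<in> lin_maps P3.M P3.E" unfolding lin_maps_iff[of "T \<psi>"]
      proof (intro conjI ballI allI)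
        fix u v c assume "u \<in> carrier P3.M" "v \<in> carrier P3.M"
        show "T \<psi> (u \<oplus>\<^bsub>P3.M\<^esub> v) = T \<psi> u \<oplus>\<^bsub>P3.E\<^esub> T \<psi> v"
          using \<open>u \<in> carrier P3.M\<close> \<open>v \<in> carrier P3.M\<close> add[OF pe pe]
          by (simp only: T_def perm_module_sel restrict_apply push_add restrict_extensional if_True)
      next
        fix u c assume "u \<in> carrier P3.M"
        thus "T \<psi> (c \<odot>\<^bsub>P3.M\<^esub> u) = c \<odot>\<^bsub>P3.E\<^esub> T \<psi> u" using sm[OF pe pe]
          by (simp only: T_def perm_module_sel restrict_apply push_smult restrict_extensional if_True)
      next
        fix u assume "u \<in> carrier P3.M"
        thus "T \<psi> u \<in> carrier P3.E" using cl[OF pe pe] by (simp add: T_def)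
      qed (simp add: T_def)
      fix g m assume g: "g \<in> carrier ?G" and m: "m \<in> carrier P3.M"
      show "T \<psi> (act P3.M g m) = act P3.E g (T \<psi> m)"
        using equi[OF g pe] m
        by (simp only: T_def perm_module_sel restrict_apply push_act[OF g] restrict_extensional if_True)
    qed
  qed
  have T_hom: "T \<in> LinearCombinations.module_hom class_ring P1.homs_space P3.homs_space"
    unfolding LinearCombinations.module_hom_def
  proof (intro CollectI conjI Pi_I allI impI)
    show "T \<psi> \<in> carrier P3.homs_space" if "\<psi> \<in> carrier P1.homs_space" for \<psi> using T_closed that by simp
  qed (use pe in \<open>auto simp: T_def intro!: restrict_ext\<close>)
  \<comment> \<open>A point \<open>a\<close> is the image of \<open>{a,b,c} + {a,b,d} + {a,c,d}\<close>.\<close>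
  have surj: "\<exists>m\<in>extensional (subsets n 3). push n 3 m = (delta (subsets n 1) S :: _ \<Rightarrow> 'f)" if S: "S \<in> subsets n 1" for S
  proof -
    obtain a where a: "S = {a}" "a \<in> {1..n}" using S by (auto simp: card_1_singleton_iff)
    have "3 \<le> card ({1..n} - {a})" using a n by simp
    then obtain U where U: "U \<subseteq> {1..n} - {a}" "card U = 3" "finite U"
      by (rule obtain_subset_with_card_n)
    then obtain b c d where bcd: "U = {b, c, d}" "b \<noteq> c" "c \<noteq> d" "b \<noteq> d" by (auto simp: card_3_iff)
    let ?\<delta> = "delta (subsets n 3) :: nat set \<Rightarrow> nat set \<Rightarrow> 'f"
    have in3: "{a, b, c} \<in> subsets n 3" "{a, b, d} \<in> subsets n 3" "{a, c, d} \<in> subsets n 3"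
      using a U bcd by auto
    let ?m = "\<lambda>A\<in>subsets n 3. ?\<delta> {a, b, c} A + (\<lambda>A\<in>subsets n 3. ?\<delta> {a, b, d} A + ?\<delta> {a, c, d} A) A"
    have "push n 3 ?m = (\<lambda>S\<in>subsets n 1. (if S \<subseteq> {a, b, c} then 1 else 0)
       + ((if S \<subseteq> {a, b, d} then 1 else 0) + (if S \<subseteq> {a, c, d} then 1 else 0)))"
      unfolding push_add push_delta[OF in3(1)] push_delta[OF in3(2)] push_delta[OF in3(3)]
      by (intro restrict_ext) simp
    also have "\<dots> = delta (subsets n 1) S"
      unfolding delta_def
    proof (rule restrict_ext)
      fix S' assume "S' \<in> subsets n 1"
      then obtain x where "S' = {x}" by (auto simp: card_1_singleton_iff)
      thus "(if S' \<subseteq> {a, b, c} then 1 else 0) + ((if S' \<subseteq> {a, b, d} then 1 else 0) + (if S' \<subseteq> {a, c, d} then 1 else 0))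
         = (if S' = S then 1 else (0::'f))"
        using bcd a U char2_add_self[OF char, of 1] by auto
    qed
    finally show ?thesis by (intro bexI[of _ ?m]) auto
  qed
  have inj: "inj_on T (carrier P1.homs_space)"
  proof (rule inj_onI)
    fix \<psi> \<psi>' assume "\<psi> \<in> carrier P1.homs_space" "\<psi>' \<in> carrier P1.homs_space" and eq: "T \<psi> = T \<psi>'"
    hence *: "\<psi> \<in> P1.homs" "\<psi>' \<in> P1.homs" by simp_all
    show "\<psi> = \<psi>'"
    proof (rule P1.homs_eqI[OF *])
      fix S v assume "S \<in> subsets n 1"
      then obtain m where m: "m \<in> extensional (subsets n 3)" "push n 3 m = (delta (subsets n 1) S :: _ \<Rightarrow> 'f)" using surj by blast
      have "T \<psi> m = T \<psi>' m" using eq by simp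
      thus "\<psi> (delta (subsets n 1) S) v = \<psi>' (delta (subsets n 1) S) v" using m by (simp add: T_def)
    qed
  qed
  have d: "d_inv n 1 V = vectorspace.dim class_ring P1.homs_space" "d_inv n 3 V = vectorspace.dim class_ring P3.homs_space"
    unfolding d_inv_def dim_grp_hom_def subset_module_def by (rule refl)+
  note inj' = dim_injective[OF P1.homs_vectorspace P3.homs_vectorspace P1.homs_fin_dim[OF fd] P3.homs_fin_dim[OF fd] T_hom inj]
  show "d_inv n 1 V \<le> d_inv n 3 V" unfolding d by (rule inj'(1))
  assume "d_inv n 1 V = d_inv n 3 V"
  hence "T ` P1.homs = P3.homs" using inj'(2) unfolding d by simp
  moreover assume "\<phi> \<in> grp_hom ?G (subset_module n 3) (End_module ?G V)"
  ultimately obtain \<psi> where "\<psi> \<in> P1.homs" "\<phi> = T \<psi>" unfolding subset_module_def by blast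
  thus "\<exists>\<psi>\<in>grp_hom ?G (subset_module n 1) (End_module ?G V). \<forall>m\<in>extensional (subsets n 3). \<phi> m = \<psi> (push n 3 m)"
    unfolding subset_module_def T_def by (intro bexI[of _ \<psi>]) auto
qed

lemma swap_on_permutes: "e \<subseteq> S \<Longrightarrow> card e = 2 \<Longrightarrow> swap_on e permutes S"
  by (erule subsets_2E) (auto intro: permutes_swap_id)

lemma swap_on_image:
  assumes "p permutes S" "card e = 2"
  shows "swap_on (p ` e) \<circ> p = p \<circ> swap_on e"
proof -
  obtain a b where e: "e = {a, b}" using assms(2) by (auto simp: card_2_iff)
  have "inj p" using assms(1) by (rule permutes_inj)
  thus ?thesis unfolding e by (auto simp: fun_eq_iff transpose_def inj_eq)
qed

lemma pairs_of_triple: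
  assumes "distinct [a, b, c]"
  shows "{e. e \<subseteq> {a, b, c} \<and> card e = 2} = {{a, b}, {b, c}, {a, c}}"
proof
  show "{e. e \<subseteq> {a, b, c} \<and> card e = 2} \<subseteq> {{a, b}, {b, c}, {a, c}}"
  proof
    fix e assume "e \<in> {e. e \<subseteq> {a, b, c} \<and> card e = 2}"
    then obtain x y where "e = {x, y}" "x \<in> {a, b, c}" "y \<in> {a, b, c}" "x \<noteq> y" by (auto simp: card_2_iff)
    thus "e \<in> {{a, b}, {b, c}, {a, c}}" by auto
  qed
qed (use assms in auto)

text \<open>The family \<open>{a, b, c} \<mapsto> t\<^sub>a\<^sub>b + t\<^sub>b\<^sub>c + t\<^sub>a\<^sub>c\<close> defines a homomorphism from \<open>M\<^sub>3\<close>, which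
  factors through the sum of points. With a fifth point \<open>a\<close> it therefore vanishes on
  \<open>{a,b,x} + {a,b,y} + {a,c,x} + {a,c,y}\<close>, where all transpositions that move \<open>a\<close> cancel.\<close>

lemma transposition_relation:
  fixes V :: "('f::field, nat \<Rightarrow> nat, 'v) grp_module"
  assumes simple: "simple_module (sym_group n) V" and char: "CHAR('f) = 2" and n: "n \<ge> 5"
    and eq: "d_inv n 1 V = d_inv n 3 V"
    and D: "b \<in> {1..n}" "c \<in> {1..n}" "x \<in> {1..n}" "y \<in> {1..n}" "distinct [b, c, x, y]" and v: "v \<in> carrier V"
  shows "act V (swap b x) v \<oplus>\<^bsub>V\<^esub> act V (swap b y) v
         \<oplus>\<^bsub>V\<^esub> act V (swap c x) v \<oplus>\<^bsub>V\<^esub> act V (swap c y) v = \<zero>\<^bsub>V\<^esub>"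
proof -
  let ?G = "sym_group n"
  interpret V: group_module ?G V using simple unfolding simple_module_def by blast
  interpret P: perm_setting ?G V "subsets n 3" "\<lambda>p A. p ` A"
    by (rule subset_setting[OF V.group_module_axioms]) (use n in simp)
  define pr where "pr A = {e. e \<subseteq> A \<and> card e = 2}" for A :: "nat set"
  define F where "F A = (\<lambda>v\<in>carrier V. \<Oplus>\<^bsub>V\<^esub>e\<in>pr A. act V (swap_on e) v)" for A
  have fin: "finite (pr A)" if "A \<in> subsets n 3" for A
  proof -
    have "finite A" by (rule finite_subset[of A "{1..n}"]) (use that in auto)
    thus ?thesis unfolding pr_def by (auto intro: finite_subset[of _ "Pow A"])
  qed
  have sw: "swap_on e \<in> carrier ?G" if "A \<in> subsets n 3" "e \<in> pr A" for A e
    unfolding sym_group_carrier using that by (intro swap_on_permutes) (auto simp: pr_def)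
  have F_lin: "F A \<in> lin_maps V V" if A: "A \<in> subsets n 3" for A
    unfolding lin_maps_iff
  proof (intro conjI ballI allI)
    fix u w assume uw: "u \<in> carrier V" "w \<in> carrier V"
    have "(\<Oplus>\<^bsub>V\<^esub>e\<in>pr A. act V (swap_on e) (u \<oplus>\<^bsub>V\<^esub> w)) = (\<Oplus>\<^bsub>V\<^esub>e\<in>pr A. act V (swap_on e) u \<oplus>\<^bsub>V\<^esub> act V (swap_on e) w)"
      using uw sw[OF A] by (intro V.finsum_cong') (auto simp: V.act_add)
    also have "\<dots> = (\<Oplus>\<^bsub>V\<^esub>e\<in>pr A. act V (swap_on e) u) \<oplus>\<^bsub>V\<^esub> (\<Oplus>\<^bsub>V\<^esub>e\<in>pr A. act V (swap_on e) w)"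
      using uw sw[OF A] by (intro V.finsum_addf) auto
    finally show "F A (u \<oplus>\<^bsub>V\<^esub> w) = F A u \<oplus>\<^bsub>V\<^esub> F A w" using uw by (simp add: F_def)
  next
    fix u k assume u: "u \<in> carrier V"
    have "(\<Oplus>\<^bsub>V\<^esub>e\<in>pr A. act V (swap_on e) (k \<odot>\<^bsub>V\<^esub> u)) = (\<Oplus>\<^bsub>V\<^esub>e\<in>pr A. k \<odot>\<^bsub>V\<^esub> act V (swap_on e) u)"
      using u sw[OF A] by (intro V.finsum_cong') (auto simp: V.act_smult)
    also have "\<dots> = k \<odot>\<^bsub>V\<^esub> (\<Oplus>\<^bsub>V\<^esub>e\<in>pr A. act V (swap_on e) u)"
      using u sw[OF A] fin[OF A] by (intro V.map_finsum[symmetric]) (auto simp: V.smult_add)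
    finally show "F A (k \<odot>\<^bsub>V\<^esub> u) = k \<odot>\<^bsub>V\<^esub> F A u" using u by (simp add: F_def)
  next
    fix u assume u: "u \<in> carrier V"
    have "(\<Oplus>\<^bsub>V\<^esub>e\<in>pr A. act V (swap_on e) u) \<in> carrier V" using u sw[OF A] by (intro V.finsum_closed) auto
    thus "F A u \<in> carrier V" using u by (simp add: F_def)
  qed (simp add: F_def)
  have F_equi: "F (g ` A) (act V g u) = act V g (F A u)"
    if g: "g \<in> carrier ?G" and A: "A \<in> subsets n 3" and u: "u \<in> carrier V" for g A u
  proof -
    have p: "g permutes {1..n}" using g by (simp only: sym_group_carrier)
    have inj: "inj g" using p by (rule permutes_inj)
    have pr: "pr (g ` A) = (\<lambda>e. g ` e) ` pr A"
    proof
      show "pr (g ` A) \<subseteq> (\<lambda>e. g ` e) ` pr A"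
      proof
        fix e assume e: "e \<in> pr (g ` A)"
        hence "e \<subseteq> g ` A" by (simp add: pr_def)
        then obtain d where d: "d \<subseteq> A" "e = g ` d" by (rule subset_imageE)
        hence "card d = 2" using e card_image[OF inj_on_subset[OF inj], of d] by (simp add: pr_def)
        thus "e \<in> (\<lambda>e. g ` e) ` pr A" using d by (auto simp: pr_def)
      qed
      show "(\<lambda>e. g ` e) ` pr A \<subseteq> pr (g ` A)"
        using card_image[OF inj_on_subset[OF inj]] by (auto simp: pr_def)
    qed
    have inj': "inj_on (\<lambda>e. g ` e) (pr A)" using inj by (auto simp: inj_on_def inj_image_eq_iff)
    have gA: "g ` A \<in> subsets n 3" using P.\<alpha>_closed[OF g A] .
    have "(\<Oplus>\<^bsub>V\<^esub>e\<in>pr (g ` A). act V (swap_on e) (act V g u)) = (\<Oplus>\<^bsub>V\<^esub>e\<in>pr A. act V (swap_on (g ` e)) (act V g u))"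
      unfolding pr using inj' sw[OF gA] g u unfolding pr by (intro V.finsum_reindex) auto
    also have "\<dots> = (\<Oplus>\<^bsub>V\<^esub>e\<in>pr A. act V g (act V (swap_on e) u))"
    proof (rule V.finsum_cong')
      fix e assume e: "e \<in> pr A"
      have s: "swap_on (g ` e) \<in> carrier ?G" using sw[OF gA] e unfolding pr by blast
      have "act V (swap_on (g ` e)) (act V g u) = act V (swap_on (g ` e) \<circ> g) u"
        using V.act_mult[OF s g u] by (simp add: sym_group_mult)
      also have "\<dots> = act V (g \<circ> swap_on e) u" using swap_on_image[OF p, of e] e by (simp add: pr_def)
      also have "\<dots> = act V g (act V (swap_on e) u)" using V.act_mult[OF g sw[OF A e] u] by (simp add: sym_group_mult)
      finally show "act V (swap_on (g ` e)) (act V g u) = act V g (act V (swap_on e) u)" .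
    qed (use g u sw[OF A] in auto)
    also have "\<dots> = act V g (\<Oplus>\<^bsub>V\<^esub>e\<in>pr A. act V (swap_on e) u)"
      using u sw[OF A] fin[OF A] g by (intro V.map_finsum[symmetric]) (auto simp: V.act_add)
    finally show ?thesis using g u by (simp add: F_def)
  qed
  let ?\<phi> = "family_hom V (subsets n 3) F"
  have \<phi>1: "?\<phi> \<in> P.homs" by (rule P.family_hom_in_homs(1)[OF F_lin F_equi])
  have \<phi>2: "?\<phi> (delta (subsets n 3) A) u = F A u" if "A \<in> subsets n 3" "u \<in> carrier V" for A u
    by (rule P.family_hom_in_homs(2)[OF F_lin F_equi that])
  have "?\<phi> \<in> grp_hom ?G (subset_module n 3) (End_module ?G V)" using \<phi>1 unfolding subset_module_def .
  from d_inv_1_3(2)[OF simple char n eq this] obtain \<psi>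
    where \<psi>: "\<And>m. m \<in> extensional (subsets n 3) \<Longrightarrow> ?\<phi> m = \<psi> (push n 3 m)" by blast
  have "\<not> {1..n} \<subseteq> {b, c, x, y}"
  proof
    assume "{1..n} \<subseteq> {b, c, x, y}"
    from card_mono[OF _ this] have "n \<le> card {b, c, x, y}" by simp
    also have "\<dots> \<le> 4" by (simp add: card_insert_if)
    finally show False using n by simp
  qed
  then obtain a where a: "a \<in> {1..n}" "a \<notin> {b, c, x, y}" by blast
  let ?\<delta> = "delta (subsets n 3) :: nat set \<Rightarrow> nat set \<Rightarrow> 'f"
  have in3: "{a, b, x} \<in> subsets n 3" "{a, b, y} \<in> subsets n 3" "{a, c, x} \<in> subsets n 3" "{a, c, y} \<in> subsets n 3"
    using a D by auto
  let ?m4 = "?\<delta> {a, c, x} \<oplus>\<^bsub>P.M\<^esub> ?\<delta> {a, c, y}"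
  let ?m3 = "?\<delta> {a, b, y} \<oplus>\<^bsub>P.M\<^esub> ?m4"
  let ?m = "?\<delta> {a, b, x} \<oplus>\<^bsub>P.M\<^esub> ?m3"
  let ?z = "0 \<odot>\<^bsub>P.M\<^esub> ?\<delta> {a, b, x}"
  have push: "push n 3 ?m = push n 3 ?z"
  proof -
    have two: "(2::'f) = 0" using char2_add_self[OF char, of 1] by simp
    have "(4::'f) = 2 + 2" by simp
    hence four: "(4::'f) = 0" using two by simp
    have "push n 3 ?m = (\<lambda>S\<in>subsets n 1. (if S \<subseteq> {a, b, x} then 1 else 0) + ((if S \<subseteq> {a, b, y} then 1 else 0)
       + ((if S \<subseteq> {a, c, x} then 1 else 0) + (if S \<subseteq> {a, c, y} then 1 else 0))))"
      unfolding perm_module_sel push_add push_delta[OF in3(1)] push_delta[OF in3(2)] push_delta[OF in3(3)] push_delta[OF in3(4)]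
      by (intro restrict_ext) simp
    also have "\<dots> = (\<lambda>S\<in>subsets n 1. 0)"
    proof (rule restrict_ext)
      fix S assume "S \<in> subsets n 1"
      then obtain s where "S = {s}" by (auto simp: card_1_singleton_iff)
      thus "(if S \<subseteq> {a, b, x} then 1 else 0) + ((if S \<subseteq> {a, b, y} then 1 else 0)
       + ((if S \<subseteq> {a, c, x} then 1 else 0) + (if S \<subseteq> {a, c, y} then 1 else 0))) = (0::'f)"
        using a D by (auto simp: two four)
    qed
    also have "\<dots> = push n 3 ?z" unfolding perm_module_sel push_smult by simp
    finally show ?thesis .
  qed
  have ext: "?m4 \<in> carrier P.M" "?m3 \<in> carrier P.M" "?m \<in> carrier P.M" "?z \<in> carrier P.M" "?\<delta> A \<in> carrier P.M" for A
    by (simp_all add: delta_def)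
  have lin: "?\<phi> (u \<oplus>\<^bsub>P.M\<^esub> w) = ?\<phi> u \<oplus>\<^bsub>P.E\<^esub> ?\<phi> w" "?\<phi> (k \<odot>\<^bsub>P.M\<^esub> u) = k \<odot>\<^bsub>P.E\<^esub> ?\<phi> u"
    if "u \<in> carrier P.M" "w \<in> carrier P.M" for u w k
  proof -
    have "?\<phi> \<in> lin_maps P.M P.E" using \<phi>1 unfolding grp_hom_def by blast
    thus "?\<phi> (u \<oplus>\<^bsub>P.M\<^esub> w) = ?\<phi> u \<oplus>\<^bsub>P.E\<^esub> ?\<phi> w" "?\<phi> (k \<odot>\<^bsub>P.M\<^esub> u) = k \<odot>\<^bsub>P.E\<^esub> ?\<phi> u"
      using that unfolding lin_maps_iff[of _ P.M P.E] by blast+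
  qed
  have "?\<phi> ?m = ?\<phi> ?z"
  proof -
    have e: "?m \<in> extensional (subsets n 3)" "?z \<in> extensional (subsets n 3)" by simp_all
    show ?thesis unfolding \<psi>[OF e(1)] \<psi>[OF e(2)] push ..
  qed
  hence "?\<phi> (?\<delta> {a, b, x}) \<oplus>\<^bsub>P.E\<^esub> (?\<phi> (?\<delta> {a, b, y}) \<oplus>\<^bsub>P.E\<^esub> (?\<phi> (?\<delta> {a, c, x}) \<oplus>\<^bsub>P.E\<^esub> ?\<phi> (?\<delta> {a, c, y})))
     = 0 \<odot>\<^bsub>P.E\<^esub> ?\<phi> (?\<delta> {a, b, x})"
    unfolding lin(1)[OF ext(5) ext(2)] lin(1)[OF ext(5) ext(1)] lin(1)[OF ext(5) ext(5)] lin(2)[OF ext(5) ext(5)] .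
  from fun_cong[OF this, of v]
  have sum0: "F {a, b, x} v \<oplus>\<^bsub>V\<^esub> (F {a, b, y} v \<oplus>\<^bsub>V\<^esub> (F {a, c, x} v \<oplus>\<^bsub>V\<^esub> F {a, c, y} v)) = \<zero>\<^bsub>V\<^esub>"
    using \<phi>2[OF in3(1) v] \<phi>2[OF in3(2) v] \<phi>2[OF in3(3) v] \<phi>2[OF in3(4) v] v F_lin[OF in3(1)]
    by (simp add: lin_maps_iff)
  let ?t = "\<lambda>a b. act V (swap a b) v"
  have t_closed: "?t p q \<in> carrier V" if "p \<in> {1..n}" "q \<in> {1..n}" for p q
    using V.act_closed[OF transpose_in_sym_group[OF that] v] .
  have F3: "F {p, q, r} v = ?t p q \<oplus>\<^bsub>V\<^esub> (?t q r \<oplus>\<^bsub>V\<^esub> ?t p r)"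
    if "distinct [p, q, r]" "p \<in> {1..n}" "q \<in> {1..n}" "r \<in> {1..n}" for p q r
    using that v t_closed[of p q] t_closed[of q r] t_closed[of p r] unfolding F_def pr_def pairs_of_triple[OF that(1)]
    by (simp add: doubleton_eq_iff del: atLeastAtMost_iff)
  have dbl: "u \<oplus>\<^bsub>V\<^esub> u = \<zero>\<^bsub>V\<^esub>" if "u \<in> carrier V" for u
    using V.smult_plus[OF that, of 1 1] that char2_add_self[OF char, of 1] by simp
  have dbl': "u \<oplus>\<^bsub>V\<^esub> (u \<oplus>\<^bsub>V\<^esub> w) = w" if "u \<in> carrier V" "w \<in> carrier V" for u w
    using dbl[OF that(1)] that by (simp add: V.a_assoc[symmetric])
  note cl = t_closed[OF a(1) D(1)] t_closed[OF a(1) D(2)] t_closed[OF a(1) D(3)] t_closed[OF a(1) D(4)]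
    t_closed[OF D(1,3)] t_closed[OF D(1,4)] t_closed[OF D(2,3)] t_closed[OF D(2,4)]
  have F': "F {a, b, x} v = ?t a b \<oplus>\<^bsub>V\<^esub> (?t b x \<oplus>\<^bsub>V\<^esub> ?t a x)" "F {a, b, y} v = ?t a b \<oplus>\<^bsub>V\<^esub> (?t b y \<oplus>\<^bsub>V\<^esub> ?t a y)"
    "F {a, c, x} v = ?t a c \<oplus>\<^bsub>V\<^esub> (?t c x \<oplus>\<^bsub>V\<^esub> ?t a x)" "F {a, c, y} v = ?t a c \<oplus>\<^bsub>V\<^esub> (?t c y \<oplus>\<^bsub>V\<^esub> ?t a y)"
    using F3[of a b x] F3[of a b y] F3[of a c x] F3[of a c y] a D by auto
  show ?thesis
    using sum0 cl unfolding F' by (simp add: V.a_ac dbl dbl')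
qed

section \<open>Orthogonality of triple sums\<close>

text \<open>These are the functions in the common kernel of the maps from \<open>d\<close>-subsets to smaller subsets. The
  two-row Specht module consists of such functions.\<close>

definition annihilated :: "nat \<Rightarrow> nat \<Rightarrow> (nat set \<Rightarrow> 'f::field) \<Rightarrow> bool" where
  "annihilated n d h \<longleftrightarrow> (\<forall>A. A \<subseteq> {1..n} \<longrightarrow> card A < d \<longrightarrow> (\<Sum>B | B \<in> subsets n d \<and> A \<subseteq> B. h B) = 0)"

lemma annihilated_add: "annihilated n d h \<Longrightarrow> annihilated n d g \<Longrightarrow> annihilated n d (\<lambda>B. h B + g B)"
  unfolding annihilated_def by (simp add: sum.distrib)

lemma permutes_subsets:
  assumes "p permutes {1..n}" "B \<in> subsets n r" shows "p ` B \<in> subsets n r"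
  using assms permutes_in_image[OF assms(1)] card_image[OF permutes_inj_on[OF assms(1), of B]] by auto

lemma permutes_image_inv:
  assumes "p permutes S" shows "Hilbert_Choice.inv p ` (p ` B) = B" "p ` (Hilbert_Choice.inv p ` B) = B"
  unfolding image_comp permutes_inv_o[OF assms] by simp_all

lemma annihilated_perm:
  assumes p: "p permutes {1..n}" and h: "annihilated n d h"
  shows "annihilated n d (\<lambda>B. h (p ` B))"
  unfolding annihilated_def
proof (intro allI impI)
  fix A assume A: "A \<subseteq> {1..n}" "card A < d"
  let ?q = "Hilbert_Choice.inv p"
  have q: "?q permutes {1..n}" using p by (rule permutes_inv)
  have "(\<Sum>B | B \<in> subsets n d \<and> A \<subseteq> B. h (p ` B)) = (\<Sum>B | B \<in> subsets n d \<and> p ` A \<subseteq> B. h B)"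
  proof (rule sum.reindex_bij_witness[of _ "\<lambda>B. ?q ` B" "\<lambda>B. p ` B"])
    fix B assume B: "B \<in> {B. B \<in> subsets n d \<and> A \<subseteq> B}"
    thus "p ` B \<in> {B. B \<in> subsets n d \<and> p ` A \<subseteq> B}" using permutes_subsets[OF p, of B d] by blast
  next
    fix B assume B: "B \<in> {B. B \<in> subsets n d \<and> p ` A \<subseteq> B}"
    hence "?q ` (p ` A) \<subseteq> ?q ` B" by blast
    thus "?q ` B \<in> {B. B \<in> subsets n d \<and> A \<subseteq> B}"
      using permutes_subsets[OF q, of B d] B unfolding permutes_image_inv[OF p] by blast
  qed (simp_all only: permutes_image_inv[OF p])
  also have "\<dots> = 0"
  proof -
    have "card (p ` A) = card A" by (rule card_image[OF permutes_inj_on[OF p]])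
    moreover have "p ` A \<subseteq> {1..n}" using A(1) permutes_in_image[OF p] by blast
    ultimately show ?thesis using h A(2) unfolding annihilated_def by simp
  qed
  finally show "(\<Sum>B | B \<in> subsets n d \<and> A \<subseteq> B. h (p ` B)) = 0" .
qed

lemma sum_perm_subsets:
  assumes p: "p permutes {1..n}"
  shows "(\<Sum>B\<in>subsets n d. h (p ` B)) = (\<Sum>B\<in>subsets n d. h B)"
proof (rule sum.reindex_bij_witness[of _ "\<lambda>B. Hilbert_Choice.inv p ` B" "\<lambda>B. p ` B"])
  show "p ` B \<in> subsets n d" if "B \<in> subsets n d" for B by (rule permutes_subsets[OF p that])
  show "Hilbert_Choice.inv p ` B \<in> subsets n d" if "B \<in> subsets n d" for B
    by (rule permutes_subsets[OF permutes_inv[OF p] that])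
qed (simp_all only: permutes_image_inv[OF p])

text \<open>Subsets are split into their parts inside and outside a fixed triple.\<close>

locale triple_setting =
  fixes n d :: nat and a b c :: nat
  assumes n: "n = 2 * d + 2" and D: "a \<in> {1..n}" "b \<in> {1..n}" "c \<in> {1..n}" and dist: "distinct [a, b, c]"
begin

definition N :: "nat set" where "N = {1..n} - {a, b, c}"

lemma N: "finite N" "N \<inter> {a, b, c} = {}" "card N = 2 * d - 1"
proof -
  have "{a, b, c} \<subseteq> {1..n}" using D by auto
  moreover have "card {a, b, c} = 3" using dist by simp
  ultimately show "card N = 2 * d - 1" unfolding N_def using n by (subst card_Diff_subset) auto
qed (auto simp: N_def)

definition part :: "nat set \<Rightarrow> nat \<Rightarrow> nat set set" where
  "part A i = {B. B \<subseteq> N \<and> A \<subseteq> B \<and> card B + i = d}"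

lemma finite_part [simp]: "finite (part A i)"
  by (rule finite_subset[of _ "Pow N"]) (use N(1) in \<open>auto simp: part_def\<close>)

lemma sum_split:
  assumes "A \<subseteq> N" "T \<subseteq> {a, b, c}"
  shows "(\<Sum>B | B \<in> subsets n d \<and> A \<union> T \<subseteq> B. h B)
    = (\<Sum>U | T \<subseteq> U \<and> U \<subseteq> {a, b, c}. \<Sum>B\<in>part A (card U). h (B \<union> U))"
proof -
  have fin: "finite {U. T \<subseteq> U \<and> U \<subseteq> {a, b, c}}"
    by (rule finite_subset[of _ "Pow {a, b, c}"]) auto
  have "(\<Sum>U | T \<subseteq> U \<and> U \<subseteq> {a, b, c}. \<Sum>B\<in>part A (card U). h (B \<union> U))
    = (\<Sum>(U, B)\<in>Sigma {U. T \<subseteq> U \<and> U \<subseteq> {a, b, c}} (\<lambda>U. part A (card U)). h (B \<union> U))"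
    using fin by (subst sum.Sigma) auto
  also have "\<dots> = (\<Sum>B | B \<in> subsets n d \<and> A \<union> T \<subseteq> B. h B)"
  proof (rule sum.reindex_bij_witness[of _ "\<lambda>B. (B \<inter> {a, b, c}, B \<inter> N)" "\<lambda>(U, B). B \<union> U"])
    fix x assume "x \<in> Sigma {U. T \<subseteq> U \<and> U \<subseteq> {a, b, c}} (\<lambda>U. part A (card U))"
    then obtain U B where x: "x = (U, B)" "T \<subseteq> U" "U \<subseteq> {a, b, c}" "B \<subseteq> N" "A \<subseteq> B" "card B + card U = d"
      by (auto simp: part_def)
    have disj: "B \<inter> U = {}" "finite B" "finite U" using x N finite_subset by blast+
    have "card (B \<union> U) = d" using card_Un_disjoint[OF disj(2,3,1)] x by simp
    moreover have "B \<union> U \<subseteq> {1..n}" using x D unfolding N_def by blast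
    ultimately show "(case x of (U, B) \<Rightarrow> B \<union> U) \<in> {B. B \<in> subsets n d \<and> A \<union> T \<subseteq> B}" using x by auto
    show "((case x of (U, B) \<Rightarrow> B \<union> U) \<inter> {a, b, c}, (case x of (U, B) \<Rightarrow> B \<union> U) \<inter> N) = x"
      using x N(2) by auto
  next
    fix B assume B: "B \<in> {B. B \<in> subsets n d \<and> A \<union> T \<subseteq> B}"
    have eq: "B \<inter> N \<union> B \<inter> {a, b, c} = B" using B unfolding N_def by blast
    have "finite B" using B finite_subset[of B "{1..n}"] by auto
    hence "card (B \<inter> N \<union> B \<inter> {a, b, c}) = card (B \<inter> N) + card (B \<inter> {a, b, c})"
      by (intro card_Un_disjoint) (use N(2) in auto)
    hence "card (B \<inter> N) + card (B \<inter> {a, b, c}) = d" unfolding eq using B by simp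
    thus "(B \<inter> {a, b, c}, B \<inter> N) \<in> Sigma {U. T \<subseteq> U \<and> U \<subseteq> {a, b, c}} (\<lambda>U. part A (card U))"
      using B assms by (auto simp: part_def)
    show "(case (B \<inter> {a, b, c}, B \<inter> N) of (U, B) \<Rightarrow> B \<union> U) = B" using eq by simp
  qed (auto)
  finally show ?thesis ..
qed

text \<open>One subset of the triple for each size.\<close>

definition rep :: "nat \<Rightarrow> nat set" where
  "rep i = (if i = 0 then {} else if i = 1 then {a} else if i = 2 then {a, b} else {a, b, c})"

lemma supersets:
  "{U. {} \<subseteq> U \<and> U \<subseteq> {a, b, c}} = {{}, {a}, {b}, {c}, {a, b}, {a, c}, {b, c}, {a, b, c}}"
  "{U. {a} \<subseteq> U \<and> U \<subseteq> {a, b, c}} = {{a}, {a, b}, {a, c}, {a, b, c}}"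
  "{U. {a, b} \<subseteq> U \<and> U \<subseteq> {a, b, c}} = {{a, b}, {a, b, c}}"
  "{U. {a, b, c} \<subseteq> U \<and> U \<subseteq> {a, b, c}} = {{a, b, c}}"
proof -
  have P: "Pow {a, b, c} = {{}, {a}, {b}, {c}, {a, b}, {a, c}, {b, c}, {a, b, c}}"
    by (auto simp: Pow_insert)
  have filter_insert: "{U \<in> insert x S. Q U} = (if Q x then insert x {U \<in> S. Q U} else {U \<in> S. Q U})"
    for x :: "nat set" and S Q by auto
  have *: "{U. X \<subseteq> U \<and> U \<subseteq> {a, b, c}} = {U \<in> Pow {a, b, c}. X \<subseteq> U}" for X by blast
  have ne: "a \<noteq> b" "b \<noteq> c" "a \<noteq> c" "b \<noteq> a" "c \<noteq> b" "c \<noteq> a" using dist by auto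
  show "{U. {} \<subseteq> U \<and> U \<subseteq> {a, b, c}} = {{}, {a}, {b}, {c}, {a, b}, {a, c}, {b, c}, {a, b, c}}"
    "{U. {a} \<subseteq> U \<and> U \<subseteq> {a, b, c}} = {{a}, {a, b}, {a, c}, {a, b, c}}"
    "{U. {a, b} \<subseteq> U \<and> U \<subseteq> {a, b, c}} = {{a, b}, {a, b, c}}"
    "{U. {a, b, c} \<subseteq> U \<and> U \<subseteq> {a, b, c}} = {{a, b, c}}"
    unfolding * P by (simp_all only: filter_insert) (simp_all add: ne)
qed

lemma sum_supersets:
  fixes g :: "nat \<Rightarrow> 'f::comm_monoid_add"
  shows "(\<Sum>U | {} \<subseteq> U \<and> U \<subseteq> {a, b, c}. g (card U)) = g 0 + (g 1 + (g 1 + (g 1 + (g 2 + (g 2 + (g 2 + g 3))))))"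
    "(\<Sum>U | {a} \<subseteq> U \<and> U \<subseteq> {a, b, c}. g (card U)) = g 1 + (g 2 + (g 2 + g 3))"
    "(\<Sum>U | {a, b} \<subseteq> U \<and> U \<subseteq> {a, b, c}. g (card U)) = g 2 + g 3"
    "(\<Sum>U | {a, b, c} \<subseteq> U \<and> U \<subseteq> {a, b, c}. g (card U)) = g 3"
proof -
  have ne: "a \<noteq> b" "b \<noteq> c" "a \<noteq> c" "b \<noteq> a" "c \<noteq> b" "c \<noteq> a" using dist by auto
  have card: "card {a} = 1" "card {b} = 1" "card {c} = 1" "card {a, b} = 2" "card {a, c} = 2" "card {b, c} = 2" "card {a, b, c} = 3"
    using ne by auto
  have 3: "sum f {{a, b}, {a, b, c}} = f {a, b} + f {a, b, c}" for f :: "nat set \<Rightarrow> 'f"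
  proof -
    have "{a, b} \<noteq> {a, b, c}" using ne by auto
    thus ?thesis by simp
  qed
  have 2: "sum f {{a}, {a, b}, {a, c}, {a, b, c}} = f {a} + (f {a, b} + (f {a, c} + f {a, b, c}))" for f :: "nat set \<Rightarrow> 'f"
  proof -
    have "{a} \<notin> {{a, b}, {a, c}, {a, b, c}}" "{a, b} \<notin> {{a, c}, {a, b, c}}" "{a, c} \<notin> {{a, b, c}}" using ne by auto
    thus ?thesis by (simp only: sum.insert finite_insert finite.emptyI sum.empty add_0_right not_False_eq_True empty_iff)
  qed
  have 1: "sum f {{}, {a}, {b}, {c}, {a, b}, {a, c}, {b, c}, {a, b, c}} =
    f {} + (f {a} + (f {b} + (f {c} + (f {a, b} + (f {a, c} + (f {b, c} + f {a, b, c}))))))" for f :: "nat set \<Rightarrow> 'f"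
  proof -
    have "{} \<notin> {{a}, {b}, {c}, {a, b}, {a, c}, {b, c}, {a, b, c}}" by auto
    moreover have "{a} \<notin> {{b}, {c}, {a, b}, {a, c}, {b, c}, {a, b, c}}" using ne by auto
    moreover have "{b} \<notin> {{c}, {a, b}, {a, c}, {b, c}, {a, b, c}}" using ne by auto
    moreover have "{c} \<notin> {{a, b}, {a, c}, {b, c}, {a, b, c}}" using ne by auto
    moreover have "{a, b} \<notin> {{a, c}, {b, c}, {a, b, c}}" using ne by auto
    moreover have "{a, c} \<notin> {{b, c}, {a, b, c}}" "{b, c} \<notin> {{a, b, c}}" using ne by auto
    ultimately show ?thesis by (simp only: sum.insert finite_insert finite.emptyI sum.empty add_0_right not_False_eq_True empty_iff)
  qed
  show "(\<Sum>U | {} \<subseteq> U \<and> U \<subseteq> {a, b, c}. g (card U)) = g 0 + (g 1 + (g 1 + (g 1 + (g 2 + (g 2 + (g 2 + g 3))))))"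
    unfolding supersets 1 card by simp
  show "(\<Sum>U | {a} \<subseteq> U \<and> U \<subseteq> {a, b, c}. g (card U)) = g 1 + (g 2 + (g 2 + g 3))"
    unfolding supersets 2 card ..
  show "(\<Sum>U | {a, b} \<subseteq> U \<and> U \<subseteq> {a, b, c}. g (card U)) = g 2 + g 3"
    unfolding supersets 3 card ..
  show "(\<Sum>U | {a, b, c} \<subseteq> U \<and> U \<subseteq> {a, b, c}. g (card U)) = g 3"
    unfolding supersets by (simp add: card)
qed

text \<open>For functions on \<open>d\<close>-subsets this is invariance under the permutations of the triple.\<close>

definition inv3 :: "(nat set \<Rightarrow> 'f) \<Rightarrow> bool" where
  "inv3 h \<longleftrightarrow> (\<forall>A T. A \<subseteq> N \<longrightarrow> T \<subseteq> {a, b, c} \<longrightarrow> h (A \<union> T) = h (A \<union> rep (card T)))"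

definition G :: "(nat set \<Rightarrow> 'f::field) \<Rightarrow> nat \<Rightarrow> nat set \<Rightarrow> 'f" where
  "G h i A = (\<Sum>B\<in>part A i. h (B \<union> rep i))"

lemma sum_split_inv:
  assumes "A \<subseteq> N" "T \<subseteq> {a, b, c}" "inv3 h"
  shows "(\<Sum>B | B \<in> subsets n d \<and> A \<union> T \<subseteq> B. h B) = (\<Sum>U | T \<subseteq> U \<and> U \<subseteq> {a, b, c}. G h (card U) A)"
  unfolding sum_split[OF assms(1,2)] G_def
proof (intro sum.cong refl)
  fix U B assume "U \<in> {U. T \<subseteq> U \<and> U \<subseteq> {a, b, c}}" "B \<in> part A (card U)"
  thus "h (B \<union> U) = h (B \<union> rep (card U))" using assms(3) unfolding inv3_def part_def by blast
qed

context
  fixes h :: "nat set \<Rightarrow> 'f::field"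
  assumes char: "CHAR('f) = 2" and ann: "annihilated n d h" and inv: "inv3 h"
begin

lemma two_zero: "(x::'f) + x = 0" by (rule char2_add_self[OF char])
lemma two_zero': "(x::'f) + (x + y) = y" by (simp add: two_zero flip: add.assoc)
lemma eq_if_sum_zero: "(x::'f) + y = 0 \<Longrightarrow> x = y" by (metis add.right_neutral two_zero')

text \<open>Summing over the supersets of \<open>A \<union> T\<close> for \<open>T\<close> of size 0, 1, 2, 3 gives a triangular system for the
  sums \<open>G h i A\<close>.\<close>

lemma G_relations:
  assumes A: "A \<subseteq> N"
  shows "card A + 3 < d \<Longrightarrow> G h 3 A = 0"
    "card A + 2 < d \<Longrightarrow> G h 2 A = G h 3 A"
    "card A + 1 < d \<Longrightarrow> G h 1 A = G h 3 A"
    "card A < d \<Longrightarrow> G h 0 A = G h 1 A + G h 2 A + G h 3 A"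
proof -
  have fin: "finite A" using A N(1) finite_subset by blast
  have zero: "(\<Sum>U | T \<subseteq> U \<and> U \<subseteq> {a, b, c}. G h (card U) A) = 0"
    if T: "T \<subseteq> {a, b, c}" "card A + card T < d" for T
  proof -
    have "finite T" using T(1) finite_subset by blast
    moreover have "A \<inter> T = {}" using A T(1) N(2) by blast
    ultimately have "card (A \<union> T) < d" using T(2) fin by (simp add: card_Un_disjoint)
    moreover have "A \<union> T \<subseteq> {1..n}" using A T(1) D unfolding N_def by blast
    ultimately have "(\<Sum>B | B \<in> subsets n d \<and> A \<union> T \<subseteq> B. h B) = 0"
      using ann unfolding annihilated_def by blast
    thus ?thesis by (simp only: sum_split_inv[OF A T(1) inv])
  qed
  have card: "card {a} = 1" "card {a, b} = 2" "card {a, b, c} = 3" using dist by auto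
  note sums = sum_supersets[of "\<lambda>i. G h i A"]
  show "G h 3 A = 0" if "card A + 3 < d"
    using zero[of "{a, b, c}"] that unfolding sums card by simp
  show "G h 2 A = G h 3 A" if "card A + 2 < d"
  proof (rule eq_if_sum_zero)
    show "G h 2 A + G h 3 A = 0" using zero[of "{a, b}"] that unfolding sums card by simp
  qed
  show "G h 1 A = G h 3 A" if "card A + 1 < d"
  proof (rule eq_if_sum_zero)
    have "G h 1 A + (G h 2 A + (G h 2 A + G h 3 A)) = 0"
      using zero[of "{a}"] that unfolding sums card by blast
    thus "G h 1 A + G h 3 A = 0" unfolding two_zero' .
  qed
  show "G h 0 A = G h 1 A + G h 2 A + G h 3 A" if "card A < d"
  proof (rule eq_if_sum_zero)
    have "G h 0 A + (G h 1 A + (G h 1 A + (G h 1 A + (G h 2 A + (G h 2 A + (G h 2 A + G h 3 A)))))) = 0"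
      using zero[of "{}"] that unfolding sums by simp
    thus "G h 0 A + (G h 1 A + G h 2 A + G h 3 A) = 0" unfolding two_zero' by (simp only: add.assoc)
  qed
qed

lemma part_eq: "A \<subseteq> N \<Longrightarrow> card A + i = d \<Longrightarrow> part A i = {A}"
proof -
  assume A: "A \<subseteq> N" "card A + i = d"
  have "B = A" if "B \<in> part A i" for B
  proof -
    have "finite B" "A \<subseteq> B" "card B = card A" using that A N(1) finite_subset by (auto simp: part_def)
    thus ?thesis using card_subset_eq[of B A] by simp
  qed
  moreover have "A \<in> part A i" using A by (simp add: part_def)
  ultimately show ?thesis by blast
qed

lemma part_empty: "A \<subseteq> N \<Longrightarrow> card A + i > d \<Longrightarrow> part A i = {}"
proof -
  assume A: "A \<subseteq> N" "card A + i > d"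
  have False if "B \<in> part A i" for B
  proof -
    have "finite B" "A \<subseteq> B" "card B + i = d" using that A N(1) finite_subset by (auto simp: part_def)
    thus False using card_mono[of B A] A by simp
  qed
  thus ?thesis by blast
qed

lemma G_top:
  assumes A: "A \<subseteq> N" "card A + i = d" "i \<le> 3"
  shows "h (A \<union> rep i) = G h 0 A"
proof -
  have top: "G h i A = h (A \<union> rep i)" unfolding G_def part_eq[OF A(1,2)] by simp
  have above: "G h j A = 0" if "j > i" for j
    using part_empty[OF A(1), of j] that A(2) unfolding G_def by simp
  note rel = G_relations[OF A(1)]
  consider "i = 0" | "i = 1" | "i = 2" | "i = 3" using A(3) by linarith
  hence "G h 0 A = G h i A"
  proof cases
    case 2 thus ?thesis using rel(4) A(2) above[of 2] above[of 3] by simp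
  next
    case 3 thus ?thesis using rel(3,4) A(2) above[of 3] by simp
  next
    case 4
    hence c: "card A + 2 < d" "card A + 1 < d" "card A < d" using A(2) by auto
    have "G h 0 A = G h 3 A + (G h 3 A + G h 3 A)"
      unfolding rel(4)[OF c(3)] rel(2)[OF c(1)] rel(3)[OF c(2)] by (simp only: add.assoc)
    thus ?thesis unfolding 4 two_zero' .
  qed simp
  thus ?thesis using top by simp
qed

lemma G_low: "A \<subseteq> N \<Longrightarrow> card A + 3 < d \<Longrightarrow> G h 0 A = 0"
  using G_relations[of A] by simp

end

text \<open>Write \<open>N\<close> for the complement of the triple. By \<open>G_top\<close> the value of \<open>h\<close> at a set with trace \<open>A\<close>
  on \<open>N\<close> is the sum of \<open>h B\<close> over the \<open>d\<close>-sets \<open>B\<close> with \<open>A \<subseteq> B \<subseteq> N\<close>, and by \<open>G_low\<close> this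
  sum is zero for the sets \<open>A\<close> that are too small to be a trace. The numbers 1, 3, 3, 1 of subsets of the
  triple are odd. Hence the inner product is the sum of \<open>h B * g B' * 2 ^ card (B \<inter> B')\<close> over all pairs of
  \<open>d\<close>-subsets of \<open>N\<close>. As \<open>N\<close> has only \<open>2d - 1\<close> elements, \<open>B\<close> and \<open>B'\<close> meet and all terms are
  zero.\<close>

lemma inv3_orthogonal:
  fixes h g :: "nat set \<Rightarrow> 'f::field"
  assumes char: "CHAR('f) = 2" and d: "d \<ge> 1"
    and h: "annihilated n d h" "inv3 h" and g: "annihilated n d g" "inv3 g"
  shows "(\<Sum>B\<in>subsets n d. h B * g B) = 0"
proof -
  have two: "x + x = 0" "x + (x + y) = y" for x y :: 'f
    using char2_add_self[OF char, of x] by (simp_all flip: add.assoc)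
  let ?P = "\<lambda>A. G h 0 A * G g 0 A"
  define S where "S i = (\<Sum>A | A \<subseteq> N \<and> card A + i = d. ?P A)" for i
  have part0: "part {} i = {A. A \<subseteq> N \<and> card A + i = d}" for i by (auto simp: part_def)
  have inv: "inv3 (\<lambda>B. h B * g B)" using h(2) g(2) unfolding inv3_def by metis
  have GS: "G (\<lambda>B. h B * g B) i {} = S i" if "i \<le> 3" for i
    unfolding G_def[of "\<lambda>B. h B * g B"] S_def part0
  proof (rule sum.cong)
    fix A assume "A \<in> {A. A \<subseteq> N \<and> card A + i = d}"
    hence A: "A \<subseteq> N" "card A + i = d" by auto
    show "h (A \<union> rep i) * g (A \<union> rep i) = ?P A"
      by (simp only: G_top[OF char h A that] G_top[OF char g A that])
  qed simp
  have "(\<Sum>B\<in>subsets n d. h B * g B) = (\<Sum>B | B \<in> subsets n d \<and> {} \<union> {} \<subseteq> B. h B * g B)" by simp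
  also have "\<dots> = (\<Sum>U | {} \<subseteq> U \<and> U \<subseteq> {a, b, c}. G (\<lambda>B. h B * g B) (card U) {})"
    by (rule sum_split_inv[OF _ _ inv]) auto
  also have "\<dots> = S 0 + (S 1 + (S 1 + (S 1 + (S 2 + (S 2 + (S 2 + S 3))))))"
    unfolding sum_supersets[of "\<lambda>i. G (\<lambda>B. h B * g B) i {}"] using GS by simp
  also have "\<dots> = S 0 + S 1 + S 2 + S 3" by (simp only: two(2) add.assoc)
  also have "\<dots> = (\<Sum>A\<in>Pow N. ?P A)"
  proof -
    have fin: "finite {A. A \<subseteq> N \<and> card A + i = d}" for i
      using finite_part[of "{}" i] unfolding part0 .
    have "(\<Sum>A\<in>Pow N. ?P A) = (\<Sum>A\<in>(\<Union>i\<in>{0..3}. {A. A \<subseteq> N \<and> card A + i = d}). ?P A)"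
    proof (rule sum.mono_neutral_right)
      show "\<forall>A\<in>Pow N - (\<Union>i\<in>{0..3}. {A. A \<subseteq> N \<and> card A + i = d}). ?P A = 0"
      proof
        fix A assume A: "A \<in> Pow N - (\<Union>i\<in>{0..3}. {A. A \<subseteq> N \<and> card A + i = d})"
        hence "card A + i \<noteq> d" if "i \<le> 3" for i using that by auto
        from this[of 0] this[of 1] this[of 2] this[of 3] have "card A + 3 < d \<or> card A > d" by linarith
        thus "?P A = 0"
        proof
          assume "card A + 3 < d" thus ?thesis using G_low[OF char h, of A] A by simp
        next
          assume "card A > d"
          hence "part A 0 = {}" using part_empty[OF char h, of A 0] A by auto
          thus ?thesis unfolding G_def by simp
        qed
      qed
    qed (use N(1) in auto)
    also have "\<dots> = (\<Sum>i\<in>{0..3}. S i)"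
      unfolding S_def using fin by (intro sum.UNION_disjoint) auto
    also have "\<dots> = S 0 + S 1 + S 2 + S 3" by (simp add: numeral_3_eq_3 eval_nat_numeral)
    finally show ?thesis ..
  qed
  also have "\<dots> = (\<Sum>A\<in>Pow N. \<Sum>B\<in>part {} 0. \<Sum>B'\<in>part {} 0. if A \<subseteq> B \<inter> B' then h B * g B' else 0)"
  proof (rule sum.cong)
    fix A assume "A \<in> Pow N"
    have *: "G u 0 A = (\<Sum>B\<in>part {} 0. if A \<subseteq> B then u B else 0)" for u :: "nat set \<Rightarrow> 'f"
    proof -
      have "part A 0 = {B \<in> part {} 0. A \<subseteq> B}" by (auto simp: part_def)
      thus ?thesis unfolding G_def rep_def by (simp add: sum.inter_filter)
    qed
    show "?P A = (\<Sum>B\<in>part {} 0. \<Sum>B'\<in>part {} 0. if A \<subseteq> B \<inter> B' then h B * g B' else 0)"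
      unfolding * sum_product by (intro sum.cong) auto
  qed simp
  also have "\<dots> = (\<Sum>B\<in>part {} 0. \<Sum>B'\<in>part {} 0. \<Sum>A\<in>Pow N. if A \<subseteq> B \<inter> B' then h B * g B' else 0)"
    by (rule trans[OF sum.swap], rule sum.cong[OF refl], rule sum.swap)
  also have "\<dots> = 0"
  proof (rule sum.neutral, rule ballI, rule sum.neutral, rule ballI)
    fix B B' assume B: "B \<in> part {} 0" "B' \<in> part {} 0"
    have BN: "B \<subseteq> N" "B' \<subseteq> N" "card B = d" "card B' = d" "finite B" "finite B'"
      using B N(1) finite_subset by (auto simp: part_def)
    have "B \<inter> B' \<noteq> {}"
    proof
      assume "B \<inter> B' = {}"
      hence "card (B \<union> B') = 2 * d" using BN by (simp add: card_Un_disjoint)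
      moreover have "card (B \<union> B') \<le> 2 * d - 1" using card_mono[OF N(1), of "B \<union> B'"] BN N(3) by simp
      ultimately show False using d by simp
    qed
    then obtain m where m: "card (B \<inter> B') = Suc m" using BN by (metis card_eq_0_iff finite_Int not0_implies_Suc)
    have "(\<Sum>A\<in>Pow N. if A \<subseteq> B \<inter> B' then h B * g B' else 0) = (\<Sum>A\<in>Pow (B \<inter> B'). h B * g B')"
      by (rule sum.mono_neutral_cong_right) (use BN N(1) in auto)
    also have "\<dots> = of_nat (2 ^ Suc m) * (h B * g B')"
      by (simp only: sum_constant card_Pow[OF finite_Int[OF disjI1[OF BN(5)]]] m)
    also have "\<dots> = 0" using two(1)[of 1] by simp
    finally show "(\<Sum>A\<in>Pow N. if A \<subseteq> B \<inter> B' then h B * g B' else 0) = 0" .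
  qed
  finally show ?thesis .
qed

end

definition triple_sum :: "nat \<Rightarrow> nat \<Rightarrow> nat \<Rightarrow> (nat set \<Rightarrow> 'f::field) \<Rightarrow> nat set \<Rightarrow> 'f" where
  "triple_sum a b c h B = h (swap a b ` B) + h (swap b c ` B) + h (swap a c ` B)"

text \<open>The triple sum of \<open>h\<close> is invariant under the rotation of the triple. So the form does not change if \<open>g\<close>
  is replaced by its sum over the three rotations, which reduces the claim to invariant functions.\<close>

lemma triple_sum_orthogonal:
  fixes h g :: "nat set \<Rightarrow> 'f::field"
  assumes char: "CHAR('f) = 2" and n: "n = 2 * d + 2" "d \<ge> 1"
    and abc: "a \<in> {1..n}" "b \<in> {1..n}" "c \<in> {1..n}" "distinct [a, b, c]"
    and h: "annihilated n d h" and g: "annihilated n d g"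
  shows "(\<Sum>B\<in>subsets n d. triple_sum a b c h B * g B) = 0"
proof -
  interpret triple_setting n d a b c by unfold_locales (use n abc in auto)
  have ne: "a \<noteq> b" "b \<noteq> c" "a \<noteq> c" "b \<noteq> a" "c \<noteq> b" "c \<noteq> a" using abc(4) by auto
  note P = permutes_swap_id[OF abc(1,2)] permutes_swap_id[OF abc(2,3)] permutes_swap_id[OF abc(1,3)]
  define \<sigma> where "\<sigma> = swap a b \<circ> swap b c"
  have \<sigma>P: "\<sigma> permutes {1..n}" unfolding \<sigma>_def by (rule permutes_compose[OF P(2,1)])
  have \<sigma>abc: "\<sigma> a = b" "\<sigma> b = c" "\<sigma> c = a" unfolding \<sigma>_def using ne by (simp_all add: transpose_def)
  have \<sigma>N: "\<sigma> ` A = A" if "A \<subseteq> N" for A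
  proof -
    have "\<sigma> x = x" if "x \<in> A" for x using that \<open>A \<subseteq> N\<close> unfolding \<sigma>_def N_def by (auto simp: transpose_def)
    thus ?thesis by (simp add: image_def)
  qed
  have inv3I: "inv3 u" if u: "\<And>B. u (\<sigma> ` B) = u B" for u :: "nat set \<Rightarrow> 'f"
    unfolding inv3_def
  proof (intro allI impI)
    fix A T assume A: "A \<subseteq> N" and T: "T \<subseteq> {a, b, c}"
    have sh: "u (A \<union> \<sigma> ` T) = u (A \<union> T)" for T
      using u[of "A \<union> T"] \<sigma>N[OF A] by (simp add: image_Un)
    have one: "u (A \<union> {b}) = u (A \<union> {a})" "u (A \<union> {c}) = u (A \<union> {b})"
      using sh[of "{a}"] sh[of "{b}"] \<sigma>abc by simp_all
    have two: "u (A \<union> {b, c}) = u (A \<union> {a, b})" "u (A \<union> {c, a}) = u (A \<union> {b, c})"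
      using sh[of "{a, b}"] sh[of "{b, c}"] \<sigma>abc by simp_all
    have "T \<in> {U. {} \<subseteq> U \<and> U \<subseteq> {a, b, c}}" using T by simp
    hence "T \<in> {{}, {a}, {b}, {c}, {a, b}, {a, c}, {b, c}, {a, b, c}}" unfolding supersets .
    moreover have "card {a, b} = 2" "card {a, c} = 2" "card {b, c} = 2" "card {a, b, c} = 3" using ne by auto
    ultimately show "u (A \<union> T) = u (A \<union> rep (card T))"
      using one two by (auto simp: rep_def insert_commute)
  qed
  have \<sigma>im: "\<sigma> ` B = swap a b ` (swap b c ` B)" for B unfolding \<sigma>_def by (simp add: image_comp)
  have rot: "swap a b \<circ> \<sigma> = swap b c" "swap b c \<circ> \<sigma> = swap a c" "swap a c \<circ> \<sigma> = swap a b"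
    unfolding \<sigma>_def using ne by (auto simp: fun_eq_iff transpose_def)
  have zinv: "triple_sum a b c h (\<sigma> ` B) = triple_sum a b c h B" for B
    unfolding triple_sum_def image_comp rot by (simp only: ac_simps)
  have zann: "annihilated n d (triple_sum a b c h)"
    unfolding triple_sum_def by (intro annihilated_add annihilated_perm P h)
  define g' where "g' B = g B + g (\<sigma> ` B) + g (\<sigma> ` (\<sigma> ` B))" for B
  have \<sigma>3: "\<sigma> ` (\<sigma> ` (\<sigma> ` B)) = B" for B
  proof -
    have "\<sigma> (\<sigma> (\<sigma> x)) = x" for x unfolding \<sigma>_def using ne by (auto simp: transpose_def)
    thus ?thesis by (simp add: image_image)
  qed
  have g'inv: "g' (\<sigma> ` B) = g' B" for B unfolding g'_def \<sigma>3 by (simp only: ac_simps)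
  have g'ann: "annihilated n d g'"
  proof -
    have "annihilated n d (\<lambda>B. g (\<sigma> ` B))" by (rule annihilated_perm[OF \<sigma>P g])
    from this annihilated_perm[OF \<sigma>P this] show ?thesis
      unfolding g'_def by (intro annihilated_add g)
  qed
  let ?z = "triple_sum a b c h"
  have zg: "(\<Sum>B\<in>subsets n d. ?z B * u (\<sigma> ` B)) = (\<Sum>B\<in>subsets n d. ?z B * u B)" for u
    using sum_perm_subsets[OF \<sigma>P, of "\<lambda>B. ?z B * u B" d] by (simp only: zinv)
  have "0 = (\<Sum>B\<in>subsets n d. ?z B * g' B)"
    using inv3_orthogonal[OF char assms(3) zann inv3I g'ann inv3I] zinv g'inv by simp
  also have "\<dots> = (\<Sum>B\<in>subsets n d. ?z B * g B) + (\<Sum>B\<in>subsets n d. ?z B * g (\<sigma> ` B))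
      + (\<Sum>B\<in>subsets n d. ?z B * g (\<sigma> ` (\<sigma> ` B)))"
    unfolding g'_def by (simp only: distrib_left sum.distrib)
  also have "\<dots> = (\<Sum>B\<in>subsets n d. ?z B * g B)"
    unfolding zg[of "\<lambda>B. g (\<sigma> ` B)"] zg[of g] char2_add_self[OF char] by simp
  finally show ?thesis ..
qed

section \<open>Transversals of pairs\<close>

locale columns =
  fixes n d :: nat and a b :: "nat \<Rightarrow> nat"
  assumes inj_a: "inj_on a {..<d}" and inj_b: "inj_on b {..<d}"
    and ab: "i < d \<Longrightarrow> j < d \<Longrightarrow> a i \<noteq> b j"
    and a_range: "j < d \<Longrightarrow> a j \<in> {1..n}" and b_range: "j < d \<Longrightarrow> b j \<in> {1..n}"
begin

text \<open>The product of the transpositions of \<open>a j\<close> and \<open>b j\<close> for \<open>j \<in> J\<close>.\<close>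

definition psw :: "nat set \<Rightarrow> nat \<Rightarrow> nat" where
  "psw J x = (if \<exists>j\<in>J. j < d \<and> x = a j then b (THE j. j < d \<and> x = a j)
    else if \<exists>j\<in>J. j < d \<and> x = b j then a (THE j. j < d \<and> x = b j) else x)"

lemma a_eq: "i < d \<Longrightarrow> j < d \<Longrightarrow> a i = a j \<longleftrightarrow> i = j"
  and b_eq: "i < d \<Longrightarrow> j < d \<Longrightarrow> b i = b j \<longleftrightarrow> i = j"
  using inj_a inj_b by (auto simp: inj_on_def)

lemma psw_a: "j < d \<Longrightarrow> psw J (a j) = (if j \<in> J then b j else a j)"
proof -
  assume j: "j < d"
  have "(THE i. i < d \<and> a j = a i) = j" by (rule the_equality) (use j a_eq in auto)
  moreover have "(\<exists>i\<in>J. i < d \<and> a j = a i) \<longleftrightarrow> j \<in> J" using j a_eq by auto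
  moreover have "\<not> (\<exists>i\<in>J. i < d \<and> a j = b i)" using j ab by auto
  ultimately show ?thesis unfolding psw_def by auto
qed

lemma psw_b: "j < d \<Longrightarrow> psw J (b j) = (if j \<in> J then a j else b j)"
proof -
  assume j: "j < d"
  have "(THE i. i < d \<and> b j = b i) = j" by (rule the_equality) (use j b_eq in auto)
  moreover have "(\<exists>i\<in>J. i < d \<and> b j = b i) \<longleftrightarrow> j \<in> J" using j b_eq by auto
  moreover have "\<not> (\<exists>i\<in>J. i < d \<and> b j = a i)" using j ab by metis
  ultimately show ?thesis unfolding psw_def by auto
qed

lemma psw_other: "x \<notin> a ` {..<d} \<Longrightarrow> x \<notin> b ` {..<d} \<Longrightarrow> psw J x = x"
  unfolding psw_def by auto

lemma point_cases:
  obtains j where "j < d" "x = a j" | j where "j < d" "x = b j" | "x \<notin> a ` {..<d}" "x \<notin> b ` {..<d}"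
  by blast

lemma psw_psw [simp]: "psw J (psw J x) = x"
  by (cases x rule: point_cases) (auto simp: psw_a psw_b psw_other)

lemma psw_permutes: "psw J permutes {1..n}"
proof (rule bij_imp_permutes)
  have closed: "psw J x \<in> {1..n}" if "x \<in> {1..n}" for x
    using that a_range b_range by (cases x rule: point_cases) (auto simp: psw_a psw_b psw_other)
  show "bij_betw (psw J) {1..n} {1..n}"
    by (rule bij_betwI[of _ _ _ "psw J"]) (use closed in auto)
  show "psw J x = x" if "x \<notin> {1..n}" for x
    using that a_range b_range by (cases x rule: point_cases) (auto simp: psw_other)
qed

lemma mem_psw_image: "x \<in> psw J ` B \<longleftrightarrow> psw J x \<in> B"
proof
  assume "psw J x \<in> B"
  hence "psw J (psw J x) \<in> psw J ` B" by (rule imageI)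
  thus "x \<in> psw J ` B" by simp
qed auto

definition transversal :: "nat set \<Rightarrow> bool" where
  "transversal B \<longleftrightarrow> (\<forall>j<d. (a j \<in> B) \<noteq> (b j \<in> B))"

definition transv :: "nat set \<Rightarrow> nat set" where
  "transv J = (\<lambda>j. if j \<in> J then b j else a j) ` {..<d}"

definition col_fun :: "nat set \<Rightarrow> 'f::field" where
  "col_fun B = (if transversal B then 1 else 0)"

lemma a_in_transv: "j < d \<Longrightarrow> a j \<in> transv J \<longleftrightarrow> j \<notin> J"
  and b_in_transv: "j < d \<Longrightarrow> b j \<in> transv J \<longleftrightarrow> j \<in> J"
proof -
  assume j: "j < d"
  show "a j \<in> transv J \<longleftrightarrow> j \<notin> J"
  proof
    assume "a j \<in> transv J"
    then obtain i where i: "i < d" "a j = (if i \<in> J then b i else a i)" unfolding transv_def by auto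
    thus "j \<notin> J" using j ab[of j i] a_eq[of j i] by (cases "i \<in> J") auto
  qed (use j in \<open>auto simp: transv_def image_iff intro!: bexI[of _ j]\<close>)
  show "b j \<in> transv J \<longleftrightarrow> j \<in> J"
  proof
    assume "b j \<in> transv J"
    then obtain i where i: "i < d" "b j = (if i \<in> J then b i else a i)" unfolding transv_def by auto
    thus "j \<in> J" using j ab[of i j] b_eq[of j i] by (cases "i \<in> J") auto
  qed (use j in \<open>auto simp: transv_def image_iff intro!: bexI[of _ j]\<close>)
qed

lemma transversal_transv: "transversal (transv J)"
  unfolding transversal_def by (simp add: a_in_transv b_in_transv)

lemma transv_subsets: "transv J \<in> subsets n d"
proof -
  have "inj_on (\<lambda>j. if j \<in> J then b j else a j) {..<d}"
    by (rule inj_onI) (use a_eq b_eq ab in \<open>auto split: if_splits, metis+\<close>)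
  hence "card (transv J) = d" unfolding transv_def by (simp only: card_image card_lessThan)
  moreover have "transv J \<subseteq> {1..n}" unfolding transv_def using a_range b_range by auto
  ultimately show ?thesis by simp
qed

lemma transv_inject: "I \<subseteq> {..<d} \<Longrightarrow> J \<subseteq> {..<d} \<Longrightarrow> transv I = transv J \<Longrightarrow> I = J"
  using b_in_transv by blast

lemma transversal_eq_transv:
  assumes "B \<in> subsets n d" "transversal B"
  shows "B = transv {j. j < d \<and> b j \<in> B}"
proof (rule sym, rule card_subset_eq)
  show "finite B" using assms(1) finite_subset[of B "{1..n}"] by auto
  show "transv {j. j < d \<and> b j \<in> B} \<subseteq> B"
    unfolding transv_def using assms(2) by (auto simp: transversal_def)
  show "card (transv {j. j < d \<and> b j \<in> B}) = card B" using transv_subsets assms(1) by simp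
qed

lemma transversals: "{B. B \<in> subsets n d \<and> transversal B} = transv ` Pow {..<d}"
  using transversal_eq_transv transversal_transv transv_subsets by blast

lemma psw_transv: "psw J ` transv I = transv (sym_diff J I)"
proof (rule Set.set_eqI)
  fix x
  show "x \<in> psw J ` transv I \<longleftrightarrow> x \<in> transv (sym_diff J I)"
    unfolding mem_psw_image
  proof (cases x rule: point_cases)
    case 3
    have "x \<notin> transv I" for I using 3 by (auto simp: transv_def)
    thus "psw J x \<in> transv I \<longleftrightarrow> x \<in> transv (sym_diff J I)" using 3 by (simp add: psw_other)
  qed (auto simp: psw_a psw_b a_in_transv b_in_transv)
qed

text \<open>If \<open>B\<close> meets some pair in zero or two points, exchanging this pair does not change \<open>B\<close> and the terms
  cancel. Otherwise the images of \<open>B\<close> run through all transversals.\<close>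

lemma sum_psw:
  fixes h :: "nat set \<Rightarrow> 'f::field"
  assumes char: "CHAR('f) = 2" and B: "B \<in> subsets n d"
  shows "(\<Sum>J\<in>Pow {..<d}. h (psw J ` B)) = (if transversal B then \<Sum>B' | B' \<in> subsets n d \<and> transversal B'. h B' else 0)"
proof (cases "transversal B")
  case True
  define I where "I = {j. j < d \<and> b j \<in> B}"
  have BI: "B = transv I" unfolding I_def by (rule transversal_eq_transv[OF B True])
  have I: "I \<subseteq> {..<d}" unfolding I_def by auto
  have "(\<Sum>J\<in>Pow {..<d}. h (psw J ` B)) = (\<Sum>J\<in>Pow {..<d}. h (transv (sym_diff J I)))"
    unfolding BI psw_transv ..
  also have "\<dots> = (\<Sum>J\<in>Pow {..<d}. h (transv J))"
    by (rule sum.reindex_bij_witness[of _ "\<lambda>J. sym_diff J I" "\<lambda>J. sym_diff J I"]) (use I in auto)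
  also have "\<dots> = (\<Sum>B'\<in>transv ` Pow {..<d}. h B')"
  proof -
    have "inj_on transv (Pow {..<d})" by (rule inj_onI) (rule transv_inject; blast)
    from sum.reindex[OF this, of h] show ?thesis by simp
  qed
  finally show ?thesis using True unfolding transversals by simp
next
  case False
  then obtain i where i: "i < d" "(a i \<in> B) = (b i \<in> B)" unfolding transversal_def by blast
  let ?S = "{..<d} - {i}"
  have eq: "psw (insert i J) ` B = psw J ` B" if "i \<notin> J" for J
  proof (rule Set.set_eqI)
    fix x show "x \<in> psw (insert i J) ` B \<longleftrightarrow> x \<in> psw J ` B"
      unfolding mem_psw_image using i that
      by (cases x rule: point_cases) (auto simp: psw_a psw_b psw_other)
  qed
  have "{..<d} = insert i ?S" using i by auto
  hence "Pow {..<d} = Pow ?S \<union> insert i ` Pow ?S" by (metis Pow_insert)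
  hence "(\<Sum>J\<in>Pow {..<d}. h (psw J ` B)) = (\<Sum>J\<in>Pow ?S. h (psw J ` B)) + (\<Sum>J\<in>insert i ` Pow ?S. h (psw J ` B))"
    by (simp only:) (rule sum.union_disjoint, auto)
  also have "(\<Sum>J\<in>insert i ` Pow ?S. h (psw J ` B)) = (\<Sum>J\<in>Pow ?S. h (psw (insert i J) ` B))"
    by (subst sum.reindex) (auto simp: inj_on_def insert_eq_iff)
  also have "\<dots> = (\<Sum>J\<in>Pow ?S. h (psw J ` B))"
  proof (rule sum.cong)
    fix J assume "J \<in> Pow ?S"
    hence "i \<notin> J" by blast
    from eq[OF this] show "h (psw (insert i J) ` B) = h (psw J ` B)" by (rule arg_cong)
  qed simp
  finally show ?thesis using False char2_add_self[OF char] by simp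
qed

text \<open>The signed column sum maps every vector \<open>h\<close> to a multiple of the polytabloid; the factor is the inner
  product of the two.\<close>

lemma sum_psw_bilinear:
  fixes h :: "nat set \<Rightarrow> 'f::field"
  assumes char: "CHAR('f) = 2" and B: "B \<in> subsets n d"
  shows "(\<Sum>J\<in>Pow {..<d}. h (psw J ` B)) = (\<Sum>B'\<in>subsets n d. h B' * col_fun B') * col_fun B"
proof -
  have "(\<Sum>B' | B' \<in> subsets n d \<and> transversal B'. h B') = (\<Sum>B'\<in>subsets n d. h B' * col_fun B')"
    using finite_subsets[of n d] by (intro sum.mono_neutral_cong_left) (auto simp: col_fun_def)
  thus ?thesis unfolding sum_psw[OF assms] by (simp add: col_fun_def)
qed

text \<open>A set of fewer than \<open>d\<close> points misses one of the pairs. Exchanging this pair is an involution without fixed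
  points on the transversals that contain the set.\<close>

lemma annihilated_col_fun:
  assumes char: "CHAR('f::field) = 2"
  shows "annihilated n d (col_fun :: nat set \<Rightarrow> 'f)"
  unfolding annihilated_def
proof (intro allI impI)
  fix A assume A: "A \<subseteq> {1..n}" "card A < d"
  have "\<exists>i<d. a i \<notin> A \<and> b i \<notin> A"
  proof (rule ccontr)
    assume *: "\<not> (\<exists>i<d. a i \<notin> A \<and> b i \<notin> A)"
    hence "transv {j. a j \<notin> A} \<subseteq> A" unfolding transv_def by auto
    hence "card (transv {j. a j \<notin> A}) \<le> card A" using A finite_subset by (intro card_mono) auto
    thus False using transv_subsets[of "{j. a j \<notin> A}"] A by simp
  qed
  then obtain i where i: "i < d" "a i \<notin> A" "b i \<notin> A" by blast
  let ?S = "\<lambda>Q. {B. B \<in> subsets n d \<and> A \<subseteq> B \<and> Q B}"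
  have psw_A: "A \<subseteq> psw {i} ` B \<longleftrightarrow> A \<subseteq> B" for B
  proof -
    have "psw {i} x = x" if "x \<in> A" for x
      using i that by (cases x rule: point_cases) (auto simp: psw_a psw_b psw_other)
    thus ?thesis by (auto simp: mem_psw_image subset_iff)
  qed
  have inv: "psw {i} ` (psw {i} ` B) = B" for B by (simp add: image_image)
  have tr: "transversal (psw {i} ` B) \<longleftrightarrow> transversal B" for B
    unfolding transversal_def mem_psw_image by (auto simp: psw_a psw_b)
  have fin: "finite (?S Q)" for Q by (rule finite_subset[OF _ finite_subsets[of n d]]) auto
  have "(\<Sum>B | B \<in> subsets n d \<and> A \<subseteq> B. col_fun B) = (\<Sum>B\<in>?S transversal. (1::'f))"
    using finite_subset[OF _ finite_subsets[of n d], of "{B. B \<in> subsets n d \<and> A \<subseteq> B}"]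
    by (intro sum.mono_neutral_cong_right) (auto simp: col_fun_def)
  also have "?S transversal = ?S (\<lambda>B. transversal B \<and> a i \<in> B) \<union> ?S (\<lambda>B. transversal B \<and> a i \<notin> B)" by blast
  also have "(\<Sum>B\<in>\<dots>. (1::'f)) = (\<Sum>B\<in>?S (\<lambda>B. transversal B \<and> a i \<in> B). 1) + (\<Sum>B\<in>?S (\<lambda>B. transversal B \<and> a i \<notin> B). 1)"
    by (rule sum.union_disjoint[OF fin fin]) blast
  also have "(\<Sum>B\<in>?S (\<lambda>B. transversal B \<and> a i \<in> B). (1::'f)) = (\<Sum>B\<in>?S (\<lambda>B. transversal B \<and> a i \<notin> B). 1)"
  proof (rule sum.reindex_bij_witness[of _ "\<lambda>B. psw {i} ` B" "\<lambda>B. psw {i} ` B"])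
    fix B assume B: "B \<in> ?S (\<lambda>B. transversal B \<and> a i \<in> B)"
    hence "b i \<notin> B" using i unfolding transversal_def by blast
    hence "a i \<notin> psw {i} ` B" using i by (simp add: mem_psw_image psw_a)
    thus "psw {i} ` B \<in> ?S (\<lambda>B. transversal B \<and> a i \<notin> B)"
      using B permutes_subsets[OF psw_permutes, of B d "{i}"] psw_A[of B] tr[of B] by blast
  next
    fix B assume B: "B \<in> ?S (\<lambda>B. transversal B \<and> a i \<notin> B)"
    hence "b i \<in> B" using i unfolding transversal_def by blast
    hence "a i \<in> psw {i} ` B" using i by (simp add: mem_psw_image psw_a)
    thus "psw {i} ` B \<in> ?S (\<lambda>B. transversal B \<and> a i \<in> B)"
      using B permutes_subsets[OF psw_permutes, of B d "{i}"] psw_A[of B] tr[of B] by blast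
  qed (simp_all only: inv)
  finally show "(\<Sum>B | B \<in> subsets n d \<and> A \<subseteq> B. col_fun B) = (0::'f)"
    unfolding char2_add_self[OF char] .
qed

end

text \<open>Two matchings whose union consists of a path on \<open>2d+1\<close> vertices and an isolated vertex
  have exactly one common transversal.\<close>

lemma shifted_columns:
  assumes "n = 2 * d + 2"
  shows "columns n d (\<lambda>j. 2*j+1) (\<lambda>j. 2*j+2)" "columns n d (\<lambda>j. 2*j+2) (\<lambda>j. 2*j+3)"
proof -
  have "2 * i + 1 \<noteq> 2 * j + 2" "2 * i + 2 \<noteq> 2 * j + 3" for i j :: nat by presburger+
  thus "columns n d (\<lambda>j. 2*j+1) (\<lambda>j. 2*j+2)" "columns n d (\<lambda>j. 2*j+2) (\<lambda>j. 2*j+3)"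
    by (unfold_locales, use assms in \<open>auto simp: inj_on_def\<close>)
qed

lemma sum_shifted_columns:
  assumes n: "n = 2 * d + 2"
  shows "(\<Sum>B\<in>subsets n d. columns.col_fun d (\<lambda>j. 2*j+1) (\<lambda>j. 2*j+2) B
      * columns.col_fun d (\<lambda>j. 2*j+2) (\<lambda>j. 2*j+3) B) = (1::'f::field)"
proof -
  interpret P: columns n d "\<lambda>j. 2*j+1" "\<lambda>j. 2*j+2" by (rule shifted_columns[OF n])
  interpret Q: columns n d "\<lambda>j. 2*j+2" "\<lambda>j. 2*j+3" by (rule shifted_columns[OF n])
  let ?B = "P.transv {..<d}"
  have odd: "2 * j + 1 \<notin> B" if B: "B \<in> subsets n d" "P.transversal B" "Q.transversal B" and "j < d" for B j
    using \<open>j < d\<close>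
  proof (induction j)
    case 0
    have "1 \<notin> Q.transv J" for J unfolding Q.transv_def by auto
    thus ?case using Q.transversal_eq_transv[OF B(1,3)] by auto
  next
    case (Suc j)
    hence "2 * j + 1 \<notin> B" by simp
    hence "2 * j + 2 \<in> B" using B(2) Suc unfolding P.transversal_def by auto
    hence "2 * j + 3 \<notin> B" using B(3) Suc unfolding Q.transversal_def by auto
    thus ?case by (simp add: eval_nat_numeral)
  qed
  have uniq: "B = ?B" if "B \<in> subsets n d" "P.transversal B" "Q.transversal B" for B
  proof -
    have "{j. j < d \<and> 2 * j + 2 \<in> B} = {..<d}"
      using odd[OF that] that(2) unfolding P.transversal_def by auto
    thus ?thesis using P.transversal_eq_transv[OF that(1,2)] by simp
  qed
  have B: "?B \<in> subsets n d" "P.transversal ?B" by (rule P.transv_subsets P.transversal_transv)+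
  have "Q.transversal ?B"
    unfolding Q.transversal_def
  proof (intro allI impI)
    fix j assume j: "j < d"
    have "2 * j + 2 \<in> ?B" using j unfolding P.transv_def by auto
    moreover have "2 * j + 3 \<notin> ?B" unfolding P.transv_def by (auto, presburger)
    ultimately show "(2 * j + 2 \<in> ?B) \<noteq> (2 * j + 3 \<in> ?B)" by blast
  qed
  hence iff: "P.transversal B \<and> Q.transversal B \<longleftrightarrow> B = ?B" if "B \<in> subsets n d" for B
    using uniq[OF that] B(2) by blast
  have "(\<Sum>B\<in>subsets n d. P.col_fun B * Q.col_fun B) = (\<Sum>B\<in>subsets n d. if B = ?B then 1 else (0::'f))"
  proof (rule sum.cong)
    fix B assume "B \<in> subsets n d"
    have "P.col_fun B * Q.col_fun B = (if P.transversal B \<and> Q.transversal B then 1 else (0::'f))"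
      unfolding P.col_fun_def Q.col_fun_def
      by (cases "P.transversal B"; cases "Q.transversal B")
        (simp_all only: if_True if_False simp_thms mult_1_left mult_zero_left mult_zero_right)
    thus "P.col_fun B * Q.col_fun B = (if B = ?B then 1 else (0::'f))"
      unfolding iff[OF \<open>B \<in> subsets n d\<close>] .
  qed simp
  also have "\<dots> = 1" using B(1) finite_subsets[of n d] by simp
  finally show ?thesis .
qed

section \<open>Two-row tableaux and their polytabloids\<close>

locale two_row =
  fixes n d :: nat
  assumes n: "n = 2 * d + 2"
begin

definition la :: "nat list" where "la = [d + 2, d]"

lemma sum_la [simp]: "sum_list la = n" using n by (simp add: la_def)

lemma diagram_iff: "x \<in> diagram la \<longleftrightarrow> (fst x = 0 \<and> snd x < d + 2) \<or> (fst x = 1 \<and> snd x < d)"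
  by (cases x) (auto simp: diagram_def la_def less_Suc_eq nth_Cons split: nat.splits)

lemma diagram_eq: "diagram la = {0} \<times> {..<d+2} \<union> {1} \<times> {..<d}"
  using diagram_iff by auto

definition row1 :: "(nat \<times> nat \<Rightarrow> nat) \<Rightarrow> nat set" where "row1 t = row_entries la t 1"

text \<open>A tabloid of a two-row tableau is determined by the entries of its second row.\<close>

definition tab :: "nat set \<Rightarrow> (nat \<times> nat \<Rightarrow> nat) set" where
  "tab B = {s \<in> tableaux la. row1 s = B}"

lemma tableauxD:
  assumes "t \<in> tableaux la"
  shows "inj_on t (diagram la)" "t ` diagram la = {1..n}" "t \<in> extensional (diagram la)"
  using assms unfolding tableaux_def bij_betw_def by auto

lemma row1_eq: "row1 t = (\<lambda>j. t (1, j)) ` {..<d}"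
proof -
  have "{b \<in> diagram la. fst b = 1} = (\<lambda>j. (1, j)) ` {..<d}" by (auto simp: diagram_iff image_iff)
  thus ?thesis unfolding row1_def row_entries_def by (simp only: image_image)
qed

lemma row1_subsets: "t \<in> tableaux la \<Longrightarrow> row1 t \<in> subsets n d"
proof -
  assume t: "t \<in> tableaux la"
  let ?R = "{b \<in> diagram la. fst b = 1}"
  have "?R = (\<lambda>j. (1, j)) ` {..<d}" by (auto simp: diagram_iff image_iff)
  hence "card ?R = d" by (simp add: card_image inj_on_def)
  moreover have "inj_on t ?R" by (rule inj_on_subset[OF tableauxD(1)[OF t]]) auto
  ultimately have "card (row1 t) = d" unfolding row1_def row_entries_def by (simp add: card_image)
  moreover have "row1 t \<subseteq> {1..n}" using tableauxD(2)[OF t] unfolding row1_def row_entries_def by blast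
  ultimately show ?thesis by simp
qed

lemma row_entries_by_row1:
  assumes t: "t \<in> tableaux la"
  shows "row_entries la t i = (if i = 0 then {1..n} - row1 t else if i = 1 then row1 t else {})"
proof -
  consider "i = 0" | "i = 1" | "i \<ge> 2" by linarith
  thus ?thesis
  proof cases
    case 1
    have "diagram la = {b \<in> diagram la. fst b = 0} \<union> {b \<in> diagram la. fst b = 1}"
      by (auto simp: diagram_iff)
    hence "{1..n} = row_entries la t 0 \<union> row1 t"
      unfolding row1_def row_entries_def image_Un[symmetric] using tableauxD(2)[OF t] by simp
    moreover have "row_entries la t 0 \<inter> row1 t = {}"
    proof (rule equals0I)
      fix y assume "y \<in> row_entries la t 0 \<inter> row1 t"
      then obtain u v where uv: "u \<in> diagram la" "fst u = 0" "y = t u" "v \<in> diagram la" "fst v = 1" "y = t v"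
        unfolding row1_def row_entries_def by blast
      have "u = v" by (rule inj_onD[OF tableauxD(1)[OF t] _ uv(1,4)]) (use uv in simp)
      thus False using uv(2,5) by simp
    qed
    ultimately show ?thesis using 1 by auto
  next
    case 3
    hence "{b \<in> diagram la. fst b = i} = {}" by (auto simp: diagram_iff)
    thus ?thesis using 3 by (simp add: row_entries_def)
  qed (simp add: row1_def)
qed

lemma tabloid_eq: "t \<in> tableaux la \<Longrightarrow> tabloid la t = tab (row1 t)"
  unfolding tabloid_def tab_def
proof (intro Collect_cong conj_cong refl iffI)
  fix s assume "t \<in> tableaux la" "s \<in> tableaux la" "\<forall>i. row_entries la s i = row_entries la t i"
  thus "row1 s = row1 t" by (simp add: row1_def)
next
  fix s assume "t \<in> tableaux la" "s \<in> tableaux la" "row1 s = row1 t"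
  thus "\<forall>i. row_entries la s i = row_entries la t i" by (simp add: row_entries_by_row1)
qed

lemma tableau_of_row1:
  assumes B: "B \<in> subsets n d"
  obtains t where "t \<in> tableaux la" "row1 t = B"
proof -
  have BD: "B \<subseteq> {1..n}" "card B = d" "finite B" using B finite_subset[of B "{1..n}"] by auto
  have "card ({1..n} - B) = d + 2" using BD n by (simp add: card_Diff_subset)
  then obtain f where f: "bij_betw f ({0::nat} \<times> {..<d+2}) ({1..n} - B)"
    using finite_same_card_bij[of "{0::nat} \<times> {..<d+2}" "{1..n} - B"] by (auto simp: card_cartesian_product)
  obtain g where g: "bij_betw g ({1::nat} \<times> {..<d}) B"
    using finite_same_card_bij[of "{1::nat} \<times> {..<d}" B] BD by (auto simp: card_cartesian_product)
  define t where "t = (\<lambda>x\<in>diagram la. if fst x = 1 then g x else f x)"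
  have f': "bij_betw t ({0} \<times> {..<d+2}) ({1..n} - B)"
    using f by (rule bij_betw_cong[THEN iffD1, rotated]) (auto simp: t_def diagram_iff)
  have g': "bij_betw t ({1} \<times> {..<d}) B"
    using g by (rule bij_betw_cong[THEN iffD1, rotated]) (auto simp: t_def diagram_iff)
  have "bij_betw t (diagram la) (({1..n} - B) \<union> B)"
    unfolding diagram_eq by (rule bij_betw_combine[OF f' g']) auto
  moreover have "({1..n} - B) \<union> B = {1..n}" using BD by auto
  ultimately have "t \<in> tableaux la" unfolding tableaux_def sum_la by (simp add: t_def)
  moreover have "row1 t = B"
  proof -
    have "(\<lambda>j. t (1, j)) ` {..<d} = t ` ({1} \<times> {..<d})" by (auto simp: image_iff)
    thus ?thesis unfolding row1_eq using g' by (simp add: bij_betw_def)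
  qed
  ultimately show ?thesis by (rule that)
qed

lemma tabloids: "tabloid la ` tableaux la = tab ` subsets n d"
proof
  show "tabloid la ` tableaux la \<subseteq> tab ` subsets n d" using tabloid_eq row1_subsets by auto
  show "tab ` subsets n d \<subseteq> tabloid la ` tableaux la"
  proof
    fix T assume "T \<in> tab ` subsets n d"
    then obtain B where B: "B \<in> subsets n d" "T = tab B" by blast
    obtain t where "t \<in> tableaux la" "row1 t = B" using tableau_of_row1[OF B(1)] by blast
    thus "T \<in> tabloid la ` tableaux la" using B(2) tabloid_eq by blast
  qed
qed

lemma tab_eq_iff: "A \<in> subsets n d \<Longrightarrow> tab A = tab B \<longleftrightarrow> A = B"
proof
  assume A: "A \<in> subsets n d" and eq: "tab A = tab B"
  obtain t where "t \<in> tableaux la" "row1 t = A" using tableau_of_row1[OF A] by blast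
  hence "t \<in> tab A" by (simp add: tab_def)
  hence "t \<in> tab B" by (simp only: eq)
  hence "row1 t = B" unfolding tab_def by blast
  with \<open>row1 t = A\<close> show "A = B" by blast
qed simp

lemma tableau_act:
  assumes p: "p permutes {1..n}" and t: "t \<in> tableaux la"
  shows "tableau_act la p t \<in> tableaux la" "row1 (tableau_act la p t) = p ` row1 t"
    "x \<in> diagram la \<Longrightarrow> tableau_act la p t x = p (t x)"
proof -
  show app: "tableau_act la p t x = p (t x)" if "x \<in> diagram la" for x
    using that by (simp add: tableau_act_def compose_def)
  have "bij_betw t (diagram la) {1..n}" using tableauxD[OF t] by (simp add: bij_betw_def)
  from bij_betw_trans[OF this permutes_imp_bij[OF p]]
  have "bij_betw (tableau_act la p t) (diagram la) {1..n}"
    by (rule bij_betw_cong[THEN iffD1, rotated]) (simp add: app)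
  thus "tableau_act la p t \<in> tableaux la"
    unfolding tableaux_def sum_la by (simp add: tableau_act_def compose_def)
  have "(1, j) \<in> diagram la" if "j < d" for j using that by (simp add: diagram_iff)
  thus "row1 (tableau_act la p t) = p ` row1 t"
    unfolding row1_eq by (auto simp: app image_image intro!: image_cong)
qed

lemma tableau_act_compose:
  assumes "t \<in> tableaux la"
  shows "tableau_act la p (tableau_act la q t) = tableau_act la (p \<circ> q) t" "tableau_act la id t = t"
  using tableauxD(3)[OF assms] by (auto simp: tableau_act_def compose_def fun_eq_iff extensional_def)

lemma tab_act:
  assumes p: "p permutes {1..n}"
  shows "tableau_act la p ` tab B = tab (p ` B)"
proof
  show "tableau_act la p ` tab B \<subseteq> tab (p ` B)" using tableau_act[OF p] by (auto simp: tab_def)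
  show "tab (p ` B) \<subseteq> tableau_act la p ` tab B"
  proof
    fix s assume s: "s \<in> tab (p ` B)"
    let ?q = "Hilbert_Choice.inv p"
    have q: "?q permutes {1..n}" using p by (rule permutes_inv)
    have st: "s \<in> tableaux la" "row1 s = p ` B" using s by (auto simp: tab_def)
    have "tableau_act la ?q s \<in> tab B"
      using tableau_act[OF q st(1)] st(2) by (simp add: tab_def permutes_image_inv[OF p])
    moreover have "tableau_act la p (tableau_act la ?q s) = s"
      using tableau_act_compose[OF st(1)] permutes_inv_o[OF p] by simp
    ultimately show "s \<in> tableau_act la p ` tab B" by (metis imageI)
  qed
qed

lemma tableaux_transitive:
  assumes t: "t \<in> tableaux la" and s: "s \<in> tableaux la"
  obtains p where "p permutes {1..n}" "tableau_act la p t = s"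
proof -
  have bt: "bij_betw t (diagram la) {1..n}" and bs: "bij_betw s (diagram la) {1..n}"
    using tableauxD[OF t] tableauxD[OF s] by (simp_all add: bij_betw_def)
  define p where "p x = (if x \<in> {1..n} then s (inv_into (diagram la) t x) else x)" for x
  have "bij_betw (s \<circ> inv_into (diagram la) t) {1..n} {1..n}"
    using bij_betw_trans[OF bij_betw_inv_into[OF bt] bs] .
  hence "bij_betw p {1..n} {1..n}"
    by (rule bij_betw_cong[THEN iffD1, rotated]) (simp add: p_def)
  hence p: "p permutes {1..n}" by (rule bij_imp_permutes) (unfold p_def, rule if_not_P)
  have "tableau_act la p t = s"
  proof (rule extensionalityI[of _ "diagram la"])
    show "tableau_act la p t \<in> extensional (diagram la)" by (simp add: tableau_act_def)
    show "s \<in> extensional (diagram la)" by (rule tableauxD(3)[OF s])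
    fix x assume x: "x \<in> diagram la"
    have "t x \<in> {1..n}" using bt x by (auto simp: bij_betw_def)
    thus "tableau_act la p t x = s x"
      using tableau_act(3)[OF p t x] x tableauxD(1)[OF t] by (simp add: p_def)
  qed
  thus ?thesis using that p by blast
qed

\<comment> \<open>Rewriting \<open>1\<close> to \<open>Suc 0\<close> would hide the second row \<open>t (1, j)\<close>.\<close>
declare One_nat_def [simp del]

abbreviation col_a where "col_a t \<equiv> \<lambda>j. t (0::nat, j::nat) :: nat"
abbreviation col_b where "col_b t \<equiv> \<lambda>j. t (1::nat, j::nat) :: nat"

lemma columns_tableau:
  assumes t: "t \<in> tableaux la" shows "columns n d (col_a t) (col_b t)"
proof
  have dg: "(0, j) \<in> diagram la" "(1, j) \<in> diagram la" if "j < d" for j using that by (auto simp: diagram_iff)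
  show "inj_on (col_a t) {..<d}" "inj_on (col_b t) {..<d}"
    using inj_onD[OF tableauxD(1)[OF t] _ dg(1) dg(1)] inj_onD[OF tableauxD(1)[OF t] _ dg(2) dg(2)]
    by (auto intro!: inj_onI)
  show "col_a t i \<noteq> col_b t j" if "i < d" "j < d" for i j
    using inj_onD[OF tableauxD(1)[OF t] _ dg(1) dg(2)] that by fastforce
  show "col_a t j \<in> {1..n}" "col_b t j \<in> {1..n}" if "j < d" for j
    using imageI[OF dg(1)[OF that], of t] imageI[OF dg(2)[OF that], of t] unfolding tableauxD(2)[OF t] by blast+
qed

lemma column_entries_eq:
  "column_entries la t j = (if j < d then {col_a t j, col_b t j} else if j < d + 2 then {col_a t j} else {})"
proof -
  have "{b \<in> diagram la. snd b = j} = (if j < d then {(0, j), (1, j)} else if j < d + 2 then {(0, j)} else {})"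
    by (auto simp: diagram_iff)
  thus ?thesis unfolding column_entries_def by simp
qed

text \<open>The columns have length at most two, so an element of the column stabilizer is given by the set of columns
  that it exchanges.\<close>

lemma column_stabilizer_eq:
  assumes t: "t \<in> tableaux la"
  shows "column_stabilizer la t = columns.psw d (col_a t) (col_b t) ` Pow {..<d}"
proof -
  interpret columns n d "col_a t" "col_b t" by (rule columns_tableau[OF t])
  show ?thesis
  proof
    show "psw ` Pow {..<d} \<subseteq> column_stabilizer la t"
    proof
      fix p assume "p \<in> psw ` Pow {..<d}"
      then obtain J where p: "p = psw J" by blast
      have "p ` column_entries la t j = column_entries la t j" for j
      proof (cases "j < d \<or> j \<ge> d + 2")
        case True
        show ?thesis
        proof (cases "j < d")
          case j: True
          show ?thesis unfolding p column_entries_eq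
            using j psw_a[OF j, of J] psw_b[OF j, of J] by (cases "j \<in> J") (simp_all add: insert_commute)
        qed (use True in \<open>simp add: column_entries_eq\<close>)
      next
        case False
        hence dj: "(0, j) \<in> diagram la" by (auto simp: diagram_iff)
        have di: "(0, i) \<in> diagram la" "(1, i) \<in> diagram la" if "i < d" for i using that by (auto simp: diagram_iff)
        have "col_a t j \<notin> col_a t ` {..<d}" "col_a t j \<notin> col_b t ` {..<d}"
          using inj_onD[OF tableauxD(1)[OF t] _ dj di(1)] inj_onD[OF tableauxD(1)[OF t] _ dj di(2)] False by auto
        thus ?thesis unfolding p column_entries_eq using False by (simp add: psw_other)
      qed
      thus "p \<in> column_stabilizer la t"
        unfolding column_stabilizer_def p sum_la using psw_permutes by (simp add: sym_group_carrier)
    qed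
    show "column_stabilizer la t \<subseteq> psw ` Pow {..<d}"
    proof
      fix p assume "p \<in> column_stabilizer la t"
      hence p: "p permutes {1..n}" and col: "\<And>j. p ` column_entries la t j = column_entries la t j"
        unfolding column_stabilizer_def sum_la by (auto simp: sym_group_carrier)
      define J where "J = {j. j < d \<and> p (col_a t j) = col_b t j}"
      have pair: "p ` {col_a t j, col_b t j} = {col_a t j, col_b t j}" if "j < d" for j
        using col[of j] that unfolding column_entries_eq by simp
      have inj: "p x = p y \<longleftrightarrow> x = y" for x y using permutes_inj[OF p] by (simp add: inj_eq)
      have "p x = psw J x" for x
      proof (cases x rule: point_cases)
        case (1 j)
        have "p (col_a t j) \<in> {col_a t j, col_b t j}" using pair[OF 1(1)] by blast
        thus ?thesis using 1 by (auto simp: psw_a J_def)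
      next
        case (2 j)
        have "p (col_a t j) \<in> {col_a t j, col_b t j}" "p (col_b t j) \<in> {col_a t j, col_b t j}"
          using pair[OF 2(1)] by blast+
        thus ?thesis using 2 ab[OF 2(1) 2(1)] inj[of "col_a t j" "col_b t j"] by (auto simp: psw_b J_def)
      next
        case 3
        have "p x = x"
        proof (cases "x \<in> {1..n}")
          case True
          then obtain y where y: "y \<in> diagram la" "x = t y" using tableauxD(2)[OF t] by (metis imageE)
          obtain i j where ij: "y = (i, j)" by (cases y)
          have "i = 0" "\<not> j < d" "j < d + 2" using y ij 3 by (auto simp: diagram_iff)
          thus ?thesis using col[of j] y ij unfolding column_entries_eq by simp
        qed (use p in \<open>simp add: permutes_not_in\<close>)
        thus ?thesis using 3 by (simp add: psw_other)
      qed
      moreover have "J \<in> Pow {..<d}" unfolding J_def by auto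
      ultimately show "p \<in> psw ` Pow {..<d}" by (metis ext imageI)
    qed
  qed
qed

lemma psw_inj_on:
  assumes t: "t \<in> tableaux la"
  shows "inj_on (columns.psw d (col_a t) (col_b t)) (Pow {..<d})"
proof -
  interpret columns n d "col_a t" "col_b t" by (rule columns_tableau[OF t])
  show ?thesis
  proof (rule inj_onI)
    fix I J assume IJ: "I \<in> Pow {..<d}" "J \<in> Pow {..<d}" and eq: "psw I = psw J"
    have "j \<in> I \<longleftrightarrow> j \<in> J" if "j < d" for j
      using fun_cong[OF eq, of "col_a t j"] ab[OF that that] that by (auto simp: psw_a split: if_splits)
    thus "I = J" using IJ by blast
  qed
qed

text \<open>Signs are 1 in characteristic 2, and the images of the second row under the column stabilizer are the
  transversals of the columns of length two.\<close>

lemma polytabloid_tab: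
  assumes char: "CHAR('f::field) = 2" and t: "t \<in> tableaux la" and B: "B \<in> subsets n d"
  shows "polytabloid la t (tab B) = (columns.col_fun d (col_a t) (col_b t) B :: 'f)"
proof -
  interpret columns n d "col_a t" "col_b t" by (rule columns_tableau[OF t])
  have "(1 + 1 :: 'f) = 0" by (rule char2_add_self[OF char])
  hence "(- 1 :: 'f) = 1" by (simp add: minus_equation_iff eq_neg_iff_add_eq_0)
  hence sign: "of_int (sign p) = (1 :: 'f)" for p :: "nat \<Rightarrow> nat" by (simp add: sign_def)
  have B0: "row1 t \<in> subsets n d" by (rule row1_subsets[OF t])
  have "polytabloid la t (tab B) = (\<Sum>p\<in>column_stabilizer la t. if tabloid la (tableau_act la p t) = tab B then of_int (sign p) else (0::'f))"
    using B unfolding polytabloid_def tabloids by simp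
  also have "\<dots> = (\<Sum>J\<in>Pow {..<d}. if tabloid la (tableau_act la (psw J) t) = tab B then 1 else 0)"
    unfolding column_stabilizer_eq[OF t] sum.reindex[OF psw_inj_on[OF t]] sign by simp
  also have "\<dots> = (\<Sum>J\<in>Pow {..<d}. if psw J ` row1 t = B then 1 else 0)"
  proof (rule sum.cong)
    fix J assume "J \<in> Pow {..<d}"
    have "tabloid la (tableau_act la (psw J) t) = tab (psw J ` row1 t)"
      using tabloid_eq tableau_act[OF psw_permutes t] by simp
    thus "(if tabloid la (tableau_act la (psw J) t) = tab B then 1 else (0::'f)) = (if psw J ` row1 t = B then 1 else 0)"
      using tab_eq_iff[OF permutes_subsets[OF psw_permutes B0]] by simp
  qed simp
  also have "\<dots> = (\<Sum>B'\<in>subsets n d. (if B' = B then 1 else 0) * col_fun B') * col_fun (row1 t)"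
    by (rule sum_psw_bilinear[OF char B0])
  also have "(\<Sum>B'\<in>subsets n d. (if B' = B then 1 else 0) * col_fun B') = (\<Sum>B'\<in>subsets n d. if B' = B then col_fun B' else (0::'f))"
    by (rule sum.cong) auto
  also have "\<dots> = col_fun B" using B finite_subsets[of n d] by simp
  also have "col_fun (row1 t) = (1::'f)"
  proof -
    have "col_a t j \<notin> row1 t" if "j < d" for j using ab[OF that] unfolding row1_eq by auto
    thus ?thesis unfolding col_fun_def transversal_def row1_eq by auto
  qed
  finally show ?thesis by simp
qed

end

section \<open>Submodules and heads\<close>

lemma sub_group_module:
  assumes "group_module G V" "grp_submodule G V W"
  shows "group_module G (V\<lparr>carrier := W\<rparr>)"
proof -
  interpret V: group_module G V by fact
  have sub: "VectorSpace.subspace class_ring W V" and act: "\<And>g w. g \<in> carrier G \<Longrightarrow> w \<in> W \<Longrightarrow> act V g w \<in> W"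
    using assms(2) unfolding grp_submodule_def by simp_all
  have WV: "\<And>w. w \<in> W \<Longrightarrow> w \<in> carrier V" using assms(2) unfolding V.grp_submodule_iff by (simp add: subset_iff)
  show ?thesis
  proof (rule group_module.intro[OF V.subspace_is_vs[OF sub] V.G.is_group], rule group_module_axioms.intro)
    show "act (V\<lparr>carrier := W\<rparr>) g \<in> LinearCombinations.module_hom class_ring (V\<lparr>carrier := W\<rparr>) (V\<lparr>carrier := W\<rparr>)"
      if "g \<in> carrier G" for g
      using that act WV by (simp add: LinearCombinations.module_hom_def V.act_add V.act_smult)
  qed (simp_all add: WV V.act_one V.act_mult)
qed

lemma sub_grp_submodule_iff:
  assumes "group_module G V" "grp_submodule G V W"
  shows "grp_submodule G (V\<lparr>carrier := W\<rparr>) U \<longleftrightarrow> U \<subseteq> W \<and> grp_submodule G V U"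
proof -
  interpret V: group_module G V by fact
  interpret W: group_module G "V\<lparr>carrier := W\<rparr>" by (rule sub_group_module[OF assms])
  have "W \<subseteq> carrier V" using assms(2) unfolding V.grp_submodule_iff by (elim conjE)
  hence sub: "U \<subseteq> W \<and> U \<subseteq> carrier V \<longleftrightarrow> U \<subseteq> W" by (meson subset_trans)
  have sel: "carrier (V\<lparr>carrier := W\<rparr>) = W" "zero (V\<lparr>carrier := W\<rparr>) = zero V" "add (V\<lparr>carrier := W\<rparr>) = add V"
    "smult (V\<lparr>carrier := W\<rparr>) = smult V" "act (V\<lparr>carrier := W\<rparr>) = act V" by simp_all
  show ?thesis unfolding V.grp_submodule_iff W.grp_submodule_iff sel conj_assoc[symmetric] sub by (rule refl)
qed

locale quotient_setting = group_module +
  fixes W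
  assumes W: "grp_submodule G V W"
begin

lemma W_sub: "W \<subseteq> carrier V" "\<zero>\<^bsub>V\<^esub> \<in> W" "x \<in> W \<Longrightarrow> y \<in> W \<Longrightarrow> x \<oplus>\<^bsub>V\<^esub> y \<in> W"
  "x \<in> W \<Longrightarrow> c \<odot>\<^bsub>V\<^esub> x \<in> W" "g \<in> carrier G \<Longrightarrow> x \<in> W \<Longrightarrow> act V g x \<in> W"
  using W unfolding grp_submodule_iff by simp_all

text \<open>All operations of the quotient are evaluated on these cosets of representatives.\<close>

definition cs where "cs x = W +>\<^bsub>V\<^esub> x"

abbreviation Q where "Q \<equiv> quot_module V W"

lemma cs_eq: "cs x = {h \<oplus>\<^bsub>V\<^esub> x | h. h \<in> W}"
  unfolding cs_def a_r_coset_def' by blast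

lemma cs_absorb: "h \<in> W \<Longrightarrow> x \<in> carrier V \<Longrightarrow> cs (h \<oplus>\<^bsub>V\<^esub> x) = cs x"
proof
  assume h: "h \<in> W" and x: "x \<in> carrier V"
  have hV: "h \<in> carrier V" using h W_sub(1) by blast
  show "cs (h \<oplus>\<^bsub>V\<^esub> x) \<subseteq> cs x"
  proof
    fix y assume "y \<in> cs (h \<oplus>\<^bsub>V\<^esub> x)"
    then obtain k where k: "k \<in> W" "y = k \<oplus>\<^bsub>V\<^esub> (h \<oplus>\<^bsub>V\<^esub> x)" unfolding cs_eq by blast
    have "y = (k \<oplus>\<^bsub>V\<^esub> h) \<oplus>\<^bsub>V\<^esub> x" using k hV x W_sub(1) by (auto simp: a_assoc)
    thus "y \<in> cs x" unfolding cs_eq using W_sub(3)[OF k(1) h] by blast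
  qed
  show "cs x \<subseteq> cs (h \<oplus>\<^bsub>V\<^esub> x)"
  proof
    fix y assume "y \<in> cs x"
    then obtain k where k: "k \<in> W" "y = k \<oplus>\<^bsub>V\<^esub> x" unfolding cs_eq by blast
    have kV: "k \<in> carrier V" using k W_sub(1) by blast
    let ?h = "(- 1) \<odot>\<^bsub>V\<^esub> h"
    have "?h \<oplus>\<^bsub>V\<^esub> h = \<zero>\<^bsub>V\<^esub>" by (rule neg_char_free[OF hV])
    hence "y = (k \<oplus>\<^bsub>V\<^esub> ?h) \<oplus>\<^bsub>V\<^esub> (h \<oplus>\<^bsub>V\<^esub> x)"
      using k(2) kV hV x by (simp add: a_assoc) (simp add: a_assoc[symmetric])
    thus "y \<in> cs (h \<oplus>\<^bsub>V\<^esub> x)" unfolding cs_eq using W_sub(3)[OF k(1) W_sub(4)[OF h]] by blast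
  qed
qed

lemma cs_self: "x \<in> carrier V \<Longrightarrow> x \<in> cs x"
  unfolding cs_eq using W_sub(2) by (metis (mono_tags, lifting) l_zero mem_Collect_eq)

lemma cs_W: "x \<in> W \<Longrightarrow> cs x = W"
proof -
  assume x: "x \<in> W"
  have "cs (x \<oplus>\<^bsub>V\<^esub> \<zero>\<^bsub>V\<^esub>) = cs \<zero>\<^bsub>V\<^esub>" by (rule cs_absorb[OF x]) simp
  moreover have "cs \<zero>\<^bsub>V\<^esub> = (\<lambda>h. h \<oplus>\<^bsub>V\<^esub> \<zero>\<^bsub>V\<^esub>) ` W" unfolding cs_eq by blast
  moreover have "\<dots> = (\<lambda>h. h) ` W" by (rule image_cong) (use W_sub(1) in \<open>simp_all add: subset_iff\<close>)
  moreover have "x \<in> carrier V" using x W_sub(1) by blast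
  ultimately show ?thesis by simp
qed

lemma cs_eq_W_iff: "x \<in> carrier V \<Longrightarrow> cs x = W \<longleftrightarrow> x \<in> W"
  using cs_W cs_self by blast

lemma Q_carrier: "carrier Q = cs ` carrier V"
  unfolding quot_module_def cs_def A_RCOSETS_def' by auto

lemma Q_zero: "\<zero>\<^bsub>Q\<^esub> = W" by (simp add: quot_module_def)

lemma Q_add: "x \<in> carrier V \<Longrightarrow> y \<in> carrier V \<Longrightarrow> cs x \<oplus>\<^bsub>Q\<^esub> cs y = cs (x \<oplus>\<^bsub>V\<^esub> y)"
proof -
  assume x: "x \<in> carrier V" and y: "y \<in> carrier V"
  have "cs x <+>\<^bsub>V\<^esub> cs y = cs (x \<oplus>\<^bsub>V\<^esub> y)"
  proof
    show "cs x <+>\<^bsub>V\<^esub> cs y \<subseteq> cs (x \<oplus>\<^bsub>V\<^esub> y)"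
    proof
      fix z assume "z \<in> cs x <+>\<^bsub>V\<^esub> cs y"
      then obtain h k where hk: "h \<in> W" "k \<in> W" "z = (h \<oplus>\<^bsub>V\<^esub> x) \<oplus>\<^bsub>V\<^esub> (k \<oplus>\<^bsub>V\<^esub> y)"
        unfolding set_add_def' cs_eq by blast
      have "h \<in> carrier V" "k \<in> carrier V" using hk W_sub(1) by blast+
      hence "z = (h \<oplus>\<^bsub>V\<^esub> k) \<oplus>\<^bsub>V\<^esub> (x \<oplus>\<^bsub>V\<^esub> y)" using hk(3) x y by (simp add: a_ac)
      thus "z \<in> cs (x \<oplus>\<^bsub>V\<^esub> y)" unfolding cs_eq using W_sub(3)[OF hk(1,2)] by blast
    qed
    show "cs (x \<oplus>\<^bsub>V\<^esub> y) \<subseteq> cs x <+>\<^bsub>V\<^esub> cs y"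
    proof
      fix z assume "z \<in> cs (x \<oplus>\<^bsub>V\<^esub> y)"
      then obtain h where h: "h \<in> W" "z = h \<oplus>\<^bsub>V\<^esub> (x \<oplus>\<^bsub>V\<^esub> y)" unfolding cs_eq by blast
      have "h \<in> carrier V" using h W_sub(1) by blast
      hence "z = (h \<oplus>\<^bsub>V\<^esub> x) \<oplus>\<^bsub>V\<^esub> y" using h x y by (simp add: a_assoc)
      moreover have "h \<oplus>\<^bsub>V\<^esub> x \<in> cs x" unfolding cs_eq using h by blast
      ultimately show "z \<in> cs x <+>\<^bsub>V\<^esub> cs y" unfolding set_add_def' using cs_self[OF y] by blast
    qed
  qed
  thus ?thesis by (simp add: quot_module_def)
qed

lemma cs_union:
  assumes x: "x \<in> carrier V" and f: "\<And>u. u \<in> carrier V \<Longrightarrow> f u \<in> carrier V" "\<And>u. u \<in> W \<Longrightarrow> f u \<in> W"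
    "\<And>u v. u \<in> carrier V \<Longrightarrow> v \<in> carrier V \<Longrightarrow> f (u \<oplus>\<^bsub>V\<^esub> v) = f u \<oplus>\<^bsub>V\<^esub> f v"
  shows "(\<Union>a\<in>cs x. W +>\<^bsub>V\<^esub> f a) = cs (f x)"
proof -
  have "W +>\<^bsub>V\<^esub> f a = cs (f x)" if a: "a \<in> cs x" for a
  proof -
    obtain h where h: "h \<in> W" "a = h \<oplus>\<^bsub>V\<^esub> x" using a unfolding cs_eq by blast
    have "f a = f h \<oplus>\<^bsub>V\<^esub> f x" unfolding h(2) by (rule f(3)[OF subsetD[OF W_sub(1) h(1)] x])
    thus ?thesis using cs_absorb[OF f(2)[OF h(1)] f(1)[OF x]] unfolding cs_def by simp
  qed
  thus ?thesis using cs_self[OF x] by blast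
qed

lemma Q_smult: "x \<in> carrier V \<Longrightarrow> c \<odot>\<^bsub>Q\<^esub> cs x = cs (c \<odot>\<^bsub>V\<^esub> x)"
proof -
  assume x: "x \<in> carrier V"
  have "(\<Union>a\<in>cs x. W +>\<^bsub>V\<^esub> (c \<odot>\<^bsub>V\<^esub> a)) = cs (c \<odot>\<^bsub>V\<^esub> x)"
    by (rule cs_union[OF x]) (auto simp: smult_add W_sub(4))
  thus ?thesis by (simp add: quot_module_def)
qed

lemma Q_act: "g \<in> carrier G \<Longrightarrow> x \<in> carrier V \<Longrightarrow> act Q g (cs x) = cs (act V g x)"
proof -
  assume g: "g \<in> carrier G" and x: "x \<in> carrier V"
  have "(\<Union>a\<in>cs x. W +>\<^bsub>V\<^esub> act V g a) = cs (act V g x)"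
    by (rule cs_union[OF x]) (use g in \<open>auto simp: act_add W_sub(5)\<close>)
  thus ?thesis by (simp add: quot_module_def)
qed

lemma Q_module: "group_module G Q"
proof -
  have zero: "\<zero>\<^bsub>Q\<^esub> = cs \<zero>\<^bsub>V\<^esub>" using cs_W[OF W_sub(2)] Q_zero by simp
  have neg: "x \<oplus>\<^bsub>V\<^esub> (- 1) \<odot>\<^bsub>V\<^esub> x = \<zero>\<^bsub>V\<^esub>" if "x \<in> carrier V" for x
    using neg_char_free[OF that] that by (simp add: a_comm)
  have "vectorspace class_ring Q"
  proof (rule vs_criteria[OF class_field])
    show "\<forall>v\<in>carrier Q. \<exists>w\<in>carrier Q. v \<oplus>\<^bsub>Q\<^esub> w = \<zero>\<^bsub>Q\<^esub>"
    proof
      fix v assume "v \<in> carrier Q"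
      then obtain x where x: "x \<in> carrier V" "v = cs x" unfolding Q_carrier by blast
      thus "\<exists>w\<in>carrier Q. v \<oplus>\<^bsub>Q\<^esub> w = \<zero>\<^bsub>Q\<^esub>"
        unfolding Q_carrier zero by (intro bexI[of _ "cs ((- 1) \<odot>\<^bsub>V\<^esub> x)"]) (auto simp: Q_add neg)
    qed
  qed (auto simp: Q_carrier zero Q_add Q_smult smult_add smult_mult smult_plus a_ac)
  thus ?thesis
  proof (rule group_module.intro[OF _ G.is_group], intro group_module_axioms.intro)
    show "act Q g \<in> LinearCombinations.module_hom class_ring Q Q" if "g \<in> carrier G" for g
      using that unfolding LinearCombinations.module_hom_def
      by (auto simp: Q_carrier Q_add Q_smult Q_act act_add act_smult)
  qed (auto simp: Q_carrier Q_act act_one act_mult)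
qed

lemma Q_simple:
  assumes "W \<noteq> carrier V"
    and max: "\<And>U. grp_submodule G V U \<Longrightarrow> U \<subseteq> W \<or> U = carrier V"
  shows "simple_module G Q"
proof -
  interpret Q: group_module G Q by (rule Q_module)
  show ?thesis unfolding simple_module_def
  proof (intro conjI allI impI Q_module)
    obtain x where x: "x \<in> carrier V" "x \<notin> W" using assms(1) W_sub(1) by blast
    have "cs x \<in> carrier Q" "cs x \<noteq> \<zero>\<^bsub>Q\<^esub>" using x cs_eq_W_iff[OF x(1)] Q_zero by (auto simp: Q_carrier)
    thus "carrier Q \<noteq> {\<zero>\<^bsub>Q\<^esub>}" by blast
    fix U assume "grp_submodule G Q U"
    hence U: "U \<subseteq> carrier Q" "\<zero>\<^bsub>Q\<^esub> \<in> U" "\<And>x y. x \<in> U \<Longrightarrow> y \<in> U \<Longrightarrow> x \<oplus>\<^bsub>Q\<^esub> y \<in> U" "\<And>c x. x \<in> U \<Longrightarrow> c \<odot>\<^bsub>Q\<^esub> x \<in> U"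
      "\<And>g x. g \<in> carrier G \<Longrightarrow> x \<in> U \<Longrightarrow> act Q g x \<in> U"
      unfolding Q.grp_submodule_iff by blast+
    let ?P = "{x \<in> carrier V. cs x \<in> U}"
    have "grp_submodule G V ?P" unfolding grp_submodule_iff
    proof (intro conjI ballI allI)
      show "\<zero>\<^bsub>V\<^esub> \<in> ?P" using U(2) cs_W[OF W_sub(2)] Q_zero by simp
      show "x \<oplus>\<^bsub>V\<^esub> y \<in> ?P" if "x \<in> ?P" "y \<in> ?P" for x y using that U(3)[of "cs x" "cs y"] by (simp add: Q_add)
      show "c \<odot>\<^bsub>V\<^esub> x \<in> ?P" if "x \<in> ?P" for c x using that U(4)[of "cs x" c] by (simp add: Q_smult)
      show "act V g x \<in> ?P" if "g \<in> carrier G" "x \<in> ?P" for g x using that U(5)[of g "cs x"] by (simp add: Q_act)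
    qed auto
    from max[OF this] show "U = {\<zero>\<^bsub>Q\<^esub>} \<or> U = carrier Q"
    proof
      assume P: "?P \<subseteq> W"
      have "u = \<zero>\<^bsub>Q\<^esub>" if u: "u \<in> U" for u
      proof -
        obtain x where x: "x \<in> carrier V" "u = cs x" using U(1) u unfolding Q_carrier by blast
        hence "x \<in> W" using P u by blast
        thus ?thesis using x cs_W Q_zero by simp
      qed
      thus ?thesis using U(2) by blast
    next
      assume "?P = carrier V"
      hence "carrier Q \<subseteq> U" unfolding Q_carrier by blast
      thus ?thesis using U(1) by blast
    qed
  qed
qed

text \<open>A proper submodule that contains all proper submodules is the only maximal one.\<close>

lemma radical_eq:
  assumes "W \<noteq> carrier V"
    and max: "\<And>U. grp_submodule G V U \<Longrightarrow> U \<subseteq> W \<or> U = carrier V"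
  shows "module_radical G V = W"
proof -
  have "maximal_submodule G V U \<longleftrightarrow> U = W" for U
    unfolding maximal_submodule_def using assms W by blast
  thus ?thesis unfolding module_radical_def using W_sub(1) by blast
qed

end

section \<open>The head of the two-row Specht module\<close>

locale two_row_char2 = two_row +
  fixes F :: "'f::field itself"
  assumes char: "CHAR('f) = 2" and d: "d \<ge> 1"
begin

abbreviation G where "G \<equiv> sym_group n"

abbreviation X where "X \<equiv> tab ` subsets n d"

definition M :: "('f, nat \<Rightarrow> nat, (nat \<times> nat \<Rightarrow> nat) set \<Rightarrow> 'f) grp_module" where
  "M = tabloid_module la"

lemma M_eq: "M = perm_module G X (\<lambda>p T. tableau_act la p ` T)"
  by (simp only: M_def tabloid_module_def sum_la tabloids)

lemma M_module: "group_module G M"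
  unfolding M_eq
proof (rule perm_group_module[OF sym_group_is_group])
  show "tableau_act la g ` T \<in> X" if g: "g \<in> carrier G" and T: "T \<in> X" for g T
  proof -
    have p: "g permutes {1..n}" using g by (simp only: sym_group_carrier)
    obtain B where B: "B \<in> subsets n d" "T = tab B" using T by blast
    show ?thesis unfolding B(2) tab_act[OF p] using permutes_subsets[OF p B(1)] by (rule imageI)
  qed
  show "tableau_act la \<one>\<^bsub>G\<^esub> ` T = T" if T: "T \<in> X" for T
  proof -
    obtain B where B: "T = tab B" using T by blast
    show ?thesis unfolding B sym_group_one tab_act[OF permutes_id] by simp
  qed
  show "tableau_act la (g \<otimes>\<^bsub>G\<^esub> h) ` T = tableau_act la g ` (tableau_act la h ` T)"
    if g: "g \<in> carrier G" "h \<in> carrier G" and T: "T \<in> X" for g h T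
  proof -
    have p: "g permutes {1..n}" "h permutes {1..n}" using g by (simp_all only: sym_group_carrier)
    obtain B where B: "T = tab B" using T by blast
    show ?thesis
      unfolding B sym_group_mult tab_act[OF p(1)] tab_act[OF p(2)] tab_act[OF permutes_compose[OF p(2,1)]]
      by (simp add: image_comp)
  qed
qed

interpretation M: group_module G M by (rule M_module)

definition coef :: "((nat \<times> nat \<Rightarrow> nat) set \<Rightarrow> 'f) \<Rightarrow> nat set \<Rightarrow> 'f" where
  "coef f B = f (tab B)"

lemma M_carrier: "carrier M = extensional X" by (simp add: M_eq)

lemma coef_add: "B \<in> subsets n d \<Longrightarrow> coef (f \<oplus>\<^bsub>M\<^esub> g) B = coef f B + coef g B"
  and coef_smult: "B \<in> subsets n d \<Longrightarrow> coef (c \<odot>\<^bsub>M\<^esub> f) B = c * coef f B"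
  and coef_zero: "B \<in> subsets n d \<Longrightarrow> coef \<zero>\<^bsub>M\<^esub> B = 0"
  by (simp_all only: M_eq perm_module_sel coef_def restrict_apply' imageI)

lemma coef_act:
  assumes p: "p permutes {1..n}" and B: "B \<in> subsets n d"
  shows "coef (act M p f) B = coef f (Hilbert_Choice.inv p ` B)"
proof -
  have "p \<in> carrier G" using p by (simp only: sym_group_carrier)
  thus ?thesis using B
    by (simp only: M_eq perm_module_sel coef_def restrict_apply' imageI sym_group_inv_equality
        tab_act[OF permutes_inv[OF p]])
qed

lemma M_eqI:
  assumes "f \<in> carrier M" "g \<in> carrier M" "\<And>B. B \<in> subsets n d \<Longrightarrow> coef f B = coef g B"
  shows "f = g"
proof (rule extensionalityI[of _ X])
  show "f T = g T" if T: "T \<in> X" for T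
  proof -
    obtain B where B: "B \<in> subsets n d" "T = tab B" using T by blast
    show ?thesis using assms(3)[OF B(1)] unfolding B(2) coef_def .
  qed
qed (use assms(1,2) in \<open>simp_all only: M_carrier\<close>)

definition e :: "(nat \<times> nat \<Rightarrow> nat) \<Rightarrow> (nat \<times> nat \<Rightarrow> nat) set \<Rightarrow> 'f" where
  "e t = polytabloid la t"

definition col :: "(nat \<times> nat \<Rightarrow> nat) \<Rightarrow> nat set \<Rightarrow> 'f" where
  "col t = columns.col_fun d (col_a t) (col_b t)"

lemma col_eq:
  assumes "t \<in> tableaux la"
  shows "col t B = (if \<forall>j<d. (col_a t j \<in> B) \<noteq> (col_b t j \<in> B) then 1 else 0)"
proof -
  interpret columns n d "col_a t" "col_b t" by (rule columns_tableau[OF assms])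
  show ?thesis unfolding col_def col_fun_def transversal_def ..
qed

lemma e_carrier: "e t \<in> carrier M"
  unfolding M_carrier e_def polytabloid_def tabloids by (rule restrict_extensional)

lemma coef_e: "t \<in> tableaux la \<Longrightarrow> B \<in> subsets n d \<Longrightarrow> coef (e t) B = col t B"
  unfolding coef_def e_def col_def by (rule polytabloid_tab[OF char])

lemma act_e:
  assumes p: "p permutes {1..n}" and t: "t \<in> tableaux la"
  shows "act M p (e t) = e (tableau_act la p t)"
proof (rule M_eqI)
  have pG: "p \<in> carrier G" using p by (simp only: sym_group_carrier)
  show "act M p (e t) \<in> carrier M" by (rule M.act_closed[OF pG e_carrier])
  fix B assume B: "B \<in> subsets n d"
  let ?q = "Hilbert_Choice.inv p"
  have mem: "x \<in> ?q ` B \<longleftrightarrow> p x \<in> B" for x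
    using permutes_inverses[OF p] by (metis image_iff)
  have "tableau_act la p t (0, j) = p (t (0, j))" "tableau_act la p t (1, j) = p (t (1, j))" if "j < d" for j
    using that by (simp_all add: tableau_act(3)[OF p t] diagram_iff)
  hence "col t (?q ` B) = col (tableau_act la p t) B"
    unfolding col_eq[OF t] col_eq[OF tableau_act(1)[OF p t]] mem by simp
  thus "coef (act M p (e t)) B = coef (e (tableau_act la p t)) B"
    unfolding coef_act[OF p B] coef_e[OF t permutes_subsets[OF permutes_inv[OF p] B]]
      coef_e[OF tableau_act(1)[OF p t] B] .
qed (rule e_carrier)

definition S where "S = M.span (e ` tableaux la)"

lemma E_carrier: "e ` tableaux la \<subseteq> carrier M" using e_carrier by blast

lemma specht: "specht_module la = M\<lparr>carrier := S\<rparr>"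
  unfolding specht_module_def M_def[symmetric] S_def e_def by (rule refl)

lemma e_in_S: "t \<in> tableaux la \<Longrightarrow> e t \<in> S"
  unfolding S_def by (rule subsetD[OF M.in_own_span[OF E_carrier]]) (rule imageI)

lemma S_submodule: "grp_submodule G M S"
  unfolding S_def
proof (rule M.span_grp_submodule[OF E_carrier])
  fix g x assume g: "g \<in> carrier G" and "x \<in> e ` tableaux la"
  then obtain t where t: "t \<in> tableaux la" "x = e t" by blast
  have p: "g permutes {1..n}" using g by (simp only: sym_group_carrier)
  show "act M g x \<in> e ` tableaux la"
    unfolding t(2) act_e[OF p t(1)] by (rule imageI[OF tableau_act(1)[OF p t(1)]])
qed

lemma submoduleD:
  assumes "grp_submodule G M U"
  shows "U \<subseteq> carrier M" "\<zero>\<^bsub>M\<^esub> \<in> U" "x \<in> U \<Longrightarrow> y \<in> U \<Longrightarrow> x \<oplus>\<^bsub>M\<^esub> y \<in> U"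
    "x \<in> U \<Longrightarrow> c \<odot>\<^bsub>M\<^esub> x \<in> U" "g \<in> carrier G \<Longrightarrow> x \<in> U \<Longrightarrow> act M g x \<in> U"
  using assms unfolding M.grp_submodule_iff by simp_all

lemma S_annihilated: "f \<in> S \<Longrightarrow> annihilated n d (coef f)"
proof -
  let ?P = "{f \<in> carrier M. annihilated n d (coef f)}"
  have cong: "annihilated n d h" if "annihilated n d g" "\<And>B. B \<in> subsets n d \<Longrightarrow> h B = g B" for g h :: "nat set \<Rightarrow> 'f"
  proof -
    have "(\<Sum>B | B \<in> subsets n d \<and> A \<subseteq> B. h B) = (\<Sum>B | B \<in> subsets n d \<and> A \<subseteq> B. g B)" for A
      by (rule sum.cong) (use that(2) in blast)+
    thus ?thesis using that(1) unfolding annihilated_def by simp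
  qed
  have "S \<subseteq> ?P" unfolding S_def
  proof (rule M.span_minimal)
    show "e ` tableaux la \<subseteq> ?P"
    proof
      fix x assume "x \<in> e ` tableaux la"
      then obtain t where t: "t \<in> tableaux la" "x = e t" by blast
      interpret columns n d "col_a t" "col_b t" by (rule columns_tableau[OF t(1)])
      have "annihilated n d (col t)" unfolding col_def by (rule annihilated_col_fun[OF char])
      hence "annihilated n d (coef (e t))" by (rule cong) (rule coef_e[OF t(1)])
      thus "x \<in> ?P" using t(2) e_carrier by simp
    qed
    have "annihilated n d (coef \<zero>\<^bsub>M\<^esub>)" by (rule cong[OF _ coef_zero]) (simp_all add: annihilated_def)
    thus "\<zero>\<^bsub>M\<^esub> \<in> ?P" by simp
    show "x \<oplus>\<^bsub>M\<^esub> y \<in> ?P" if xy: "x \<in> ?P" "y \<in> ?P" for x y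
    proof -
      have "annihilated n d (\<lambda>B. coef x B + coef y B)" using xy by (intro annihilated_add) simp_all
      hence "annihilated n d (coef (x \<oplus>\<^bsub>M\<^esub> y))" by (rule cong) (rule coef_add)
      thus ?thesis using xy by simp
    qed
    show "c \<odot>\<^bsub>M\<^esub> x \<in> ?P" if x: "x \<in> ?P" for c x
    proof -
      have "annihilated n d (\<lambda>B. c * coef x B)" using x unfolding annihilated_def by (simp flip: sum_distrib_left)
      hence "annihilated n d (coef (c \<odot>\<^bsub>M\<^esub> x))" by (rule cong) (rule coef_smult)
      thus ?thesis using x by simp
    qed
  qed blast
  thus "f \<in> S \<Longrightarrow> annihilated n d (coef f)" by blast
qed

definition bf :: "((nat \<times> nat \<Rightarrow> nat) set \<Rightarrow> 'f) \<Rightarrow> ((nat \<times> nat \<Rightarrow> nat) set \<Rightarrow> 'f) \<Rightarrow> 'f" where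
  "bf f g = (\<Sum>B\<in>subsets n d. coef f B * coef g B)"

lemma bf_comm: "bf f g = bf g f" unfolding bf_def by (simp only: mult.commute)

lemma bf_add: "bf (f \<oplus>\<^bsub>M\<^esub> g) h = bf f h + bf g h"
  unfolding bf_def sum.distrib[symmetric] by (rule sum.cong) (simp_all only: coef_add distrib_right)

lemma bf_smult: "bf (c \<odot>\<^bsub>M\<^esub> f) h = c * bf f h"
  unfolding bf_def sum_distrib_left by (rule sum.cong) (simp_all only: coef_smult mult.assoc)

lemma bf_zero: "bf \<zero>\<^bsub>M\<^esub> h = 0"
proof -
  have "bf \<zero>\<^bsub>M\<^esub> h = (\<Sum>B\<in>subsets n d. 0)"
    unfolding bf_def by (rule sum.cong) (simp_all only: coef_zero mult_zero_left)
  thus ?thesis by simp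
qed

lemma bf_act:
  assumes p: "p permutes {1..n}"
  shows "bf (act M p f) (act M p g) = bf f g"
proof -
  have "bf (act M p f) (act M p g)
      = (\<Sum>B\<in>subsets n d. coef f (Hilbert_Choice.inv p ` B) * coef g (Hilbert_Choice.inv p ` B))"
    unfolding bf_def by (rule sum.cong) (simp_all only: coef_act[OF p])
  thus ?thesis unfolding bf_def using sum_perm_subsets[OF permutes_inv[OF p], of "\<lambda>B. coef f B * coef g B" d] by simp
qed

text \<open>Polytabloids span.\<close>

lemma bf_S_zero:
  assumes "\<And>t. t \<in> tableaux la \<Longrightarrow> bf f (e t) = 0" and g: "g \<in> S"
  shows "bf f g = 0"
proof -
  let ?P = "{g \<in> carrier M. bf g f = 0}"
  have "S \<subseteq> ?P" unfolding S_def
  proof (rule M.span_minimal)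
    show "e ` tableaux la \<subseteq> ?P" using assms(1) e_carrier bf_comm by auto
  qed (auto simp: bf_add bf_smult bf_zero)
  thus ?thesis using g bf_comm by auto
qed

definition R where "R = {f \<in> S. \<forall>g\<in>S. bf f g = 0}"

lemma R_submodule: "grp_submodule G M R"
  unfolding M.grp_submodule_iff
proof (intro conjI ballI allI)
  note S = submoduleD[OF S_submodule]
  show "R \<subseteq> carrier M" using S(1) unfolding R_def by blast
  show "\<zero>\<^bsub>M\<^esub> \<in> R" using S(2) by (simp add: R_def bf_zero)
  show "x \<oplus>\<^bsub>M\<^esub> y \<in> R" if "x \<in> R" "y \<in> R" for x y using that S(3) by (simp add: R_def bf_add)
  show "c \<odot>\<^bsub>M\<^esub> x \<in> R" if "x \<in> R" for c x using that S(4) by (simp add: R_def bf_smult)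
  fix p x assume pG: "p \<in> carrier G" and x: "x \<in> R"
  have p: "p permutes {1..n}" using pG by (simp only: sym_group_carrier)
  let ?q = "Hilbert_Choice.inv p"
  have qG: "?q \<in> carrier G" using permutes_inv[OF p] by (simp only: sym_group_carrier)
  have "bf (act M p x) g = 0" if g: "g \<in> S" for g
  proof -
    have "act M p (act M ?q g) = act M (p \<otimes>\<^bsub>G\<^esub> ?q) g"
      using M.act_mult[OF pG qG, of g] S(1) g by auto
    also have "\<dots> = g" using permutes_inv_o(1)[OF p] M.act_one[of g] S(1) g
      by (auto simp: sym_group_mult sym_group_one)
    finally have "bf (act M p x) g = bf x (act M ?q g)" using bf_act[OF p, of x "act M ?q g"] by simp
    thus ?thesis using x S(5)[OF qG g] unfolding R_def by simp
  qed
  thus "act M p x \<in> R" using x S(5)[OF pG] unfolding R_def by simp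
qed

text \<open>The sum of the images of \<open>f\<close> under the column stabilizer lies in \<open>U\<close> and is the multiple of the
  polytabloid by the nonzero factor \<open>bf f (e t)\<close>.\<close>

lemma polytabloid_mem:
  assumes U: "grp_submodule G M U" and f: "f \<in> U" and t: "t \<in> tableaux la" and nz: "bf f (e t) \<noteq> 0"
  shows "e t \<in> U"
proof -
  interpret columns n d "col_a t" "col_b t" by (rule columns_tableau[OF t])
  note UD = submoduleD[OF U]
  have PG: "psw J \<in> carrier G" for J using psw_permutes by (simp only: sym_group_carrier)
  have inv_psw: "Hilbert_Choice.inv (psw J) = psw J" for J
    by (rule inv_unique_comp) (simp_all add: fun_eq_iff)
  have "\<exists>u\<in>U. \<forall>B\<in>subsets n d. coef u B = (\<Sum>J\<in>\<J>. coef f (psw J ` B))" if "finite \<J>" for \<J>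
    using that
  proof (induction \<J> rule: finite_induct)
    case empty
    show ?case using UD(2) by (intro bexI[of _ "\<zero>\<^bsub>M\<^esub>"]) (simp_all add: coef_zero)
  next
    case (insert J \<J>)
    then obtain u where u: "u \<in> U" "\<forall>B\<in>subsets n d. coef u B = (\<Sum>J\<in>\<J>. coef f (psw J ` B))" by (elim bexE)
    have "\<forall>B\<in>subsets n d. coef (act M (psw J) f \<oplus>\<^bsub>M\<^esub> u) B = (\<Sum>J\<in>insert J \<J>. coef f (psw J ` B))"
    proof
      fix B assume B: "B \<in> subsets n d"
      show "coef (act M (psw J) f \<oplus>\<^bsub>M\<^esub> u) B = (\<Sum>J\<in>insert J \<J>. coef f (psw J ` B))"
        unfolding coef_add[OF B] coef_act[OF psw_permutes B] inv_psw bspec[OF u(2) B]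
        by (rule sum.insert[OF insert(1,2), symmetric])
    qed
    thus ?case using UD(3)[OF UD(5)[OF PG f] u(1)] by (intro bexI)
  qed
  from this[of "Pow {..<d}"] obtain u where u: "u \<in> U"
    "\<And>B. B \<in> subsets n d \<Longrightarrow> coef u B = (\<Sum>J\<in>Pow {..<d}. coef f (psw J ` B))" by auto
  have bf: "bf f (e t) = (\<Sum>B\<in>subsets n d. coef f B * col_fun B)"
    unfolding bf_def by (rule sum.cong) (simp_all only: coef_e[OF t] col_def)
  have eq: "e t = inverse (bf f (e t)) \<odot>\<^bsub>M\<^esub> u"
  proof (rule M_eqI)
    show "inverse (bf f (e t)) \<odot>\<^bsub>M\<^esub> u \<in> carrier M" using UD(1) UD(4)[OF u(1)] by blast
    fix B assume B: "B \<in> subsets n d"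
    have "coef u B = bf f (e t) * coef (e t) B"
      unfolding u(2)[OF B] sum_psw_bilinear[OF char B] bf coef_e[OF t B] col_def ..
    thus "coef (e t) B = coef (inverse (bf f (e t)) \<odot>\<^bsub>M\<^esub> u) B"
      unfolding coef_smult[OF B] using nz by simp
  qed (rule e_carrier)
  show ?thesis using UD(4)[OF u(1), of "inverse (bf f (e t))"] unfolding eq[symmetric] .
qed

text \<open>One polytabloid generates the Specht module, since all tableaux are conjugate.\<close>

lemma submodule_dichotomy:
  assumes U: "grp_submodule G M U" and US: "U \<subseteq> S"
  shows "U \<subseteq> R \<or> U = S"
proof (cases "\<exists>f\<in>U. \<exists>t\<in>tableaux la. bf f (e t) \<noteq> 0")
  case True
  then obtain f t where ft: "f \<in> U" "t \<in> tableaux la" "bf f (e t) \<noteq> 0" by blast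
  have et: "e t \<in> U" by (rule polytabloid_mem[OF U ft])
  have "e ` tableaux la \<subseteq> U"
  proof
    fix x assume "x \<in> e ` tableaux la"
    then obtain s where s: "s \<in> tableaux la" "x = e s" by blast
    obtain p where p: "p permutes {1..n}" "tableau_act la p t = s" by (rule tableaux_transitive[OF ft(2) s(1)])
    have "p \<in> carrier G" using p(1) by (simp only: sym_group_carrier)
    from submoduleD(5)[OF U this et] show "x \<in> U" using act_e[OF p(1) ft(2)] p(2) s(2) by simp
  qed
  hence "S \<subseteq> U" unfolding S_def by (rule M.span_minimal) (rule submoduleD[OF U]; assumption?)+
  thus ?thesis using US by blast
next
  case False
  hence "\<And>f t. f \<in> U \<Longrightarrow> t \<in> tableaux la \<Longrightarrow> bf f (e t) = 0" by blast
  hence "U \<subseteq> R" unfolding R_def using US bf_S_zero by blast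
  thus ?thesis ..
qed

lemma tableauI:
  assumes inj: "inj_on f (diagram la)" and range: "\<And>x. x \<in> diagram la \<Longrightarrow> f x \<in> {1..n}"
  shows "restrict f (diagram la) \<in> tableaux la"
proof -
  have "card (diagram la) = n"
    unfolding diagram_eq using n by (subst card_Un_disjoint) auto
  hence "card (f ` diagram la) = card {1..n}" using inj by (simp add: card_image)
  moreover have "f ` diagram la \<subseteq> {1..n}" using range by blast
  ultimately have "f ` diagram la = {1..n}" by (intro card_subset_eq) simp_all
  hence "bij_betw f (diagram la) {1..n}" using inj by (simp add: bij_betw_def)
  hence "bij_betw (restrict f (diagram la)) (diagram la) {1..n}"
    by (rule bij_betw_cong[THEN iffD1, rotated]) simp
  thus ?thesis unfolding tableaux_def sum_la by simp
qed

text \<open>The columns \<open>1 2, 3 4, \<dots>\<close> and \<open>2 3, 4 5, \<dots>\<close> have exactly one common transversal.\<close>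

lemma exists_nonorthogonal:
  obtains s t where "s \<in> tableaux la" "t \<in> tableaux la" "bf (e s) (e t) \<noteq> 0"
proof -
  define f :: "nat \<times> nat \<Rightarrow> nat" where
    "f x = (if fst x = 1 then 2 * snd x + 2 else if snd x < d then 2 * snd x + 1 else d + snd x + 1)" for x
  define g :: "nat \<times> nat \<Rightarrow> nat" where
    "g x = (if fst x = 1 then 2 * snd x + 3 else if snd x < d then 2 * snd x + 2 else if snd x = d then 1 else 2 * d + 2)" for x
  let ?s = "restrict f (diagram la)" and ?t = "restrict g (diagram la)"
  have s: "?s \<in> tableaux la"
  proof (rule tableauI)
    show "inj_on f (diagram la)"
    proof (rule inj_onI)
      fix x y assume "x \<in> diagram la" "y \<in> diagram la" "f x = f y"
      thus "x = y" unfolding f_def diagram_iff prod_eq_iff by (simp split: if_splits; presburger)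
    qed
    show "f x \<in> {1..n}" if "x \<in> diagram la" for x
      using that unfolding f_def diagram_iff n atLeastAtMost_iff by (auto split: if_splits)
  qed
  have t: "?t \<in> tableaux la"
  proof (rule tableauI)
    show "inj_on g (diagram la)"
    proof (rule inj_onI)
      fix x y assume "x \<in> diagram la" "y \<in> diagram la" "g x = g y"
      thus "x = y" unfolding g_def diagram_iff prod_eq_iff by (simp split: if_splits; presburger)
    qed
    show "g x \<in> {1..n}" if "x \<in> diagram la" for x
      using that unfolding g_def diagram_iff n atLeastAtMost_iff by (auto split: if_splits)
  qed
  have "bf (e ?s) (e ?t) = (\<Sum>B\<in>subsets n d. col ?s B * col ?t B)"
    unfolding bf_def by (rule sum.cong) (simp_all only: coef_e[OF s] coef_e[OF t])
  also have "\<dots> = (\<Sum>B\<in>subsets n d. columns.col_fun d (\<lambda>j. 2*j+1) (\<lambda>j. 2*j+2) B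
      * columns.col_fun d (\<lambda>j. 2*j+2) (\<lambda>j. 2*j+3) B)"
  proof (rule sum.cong)
    fix B
    interpret P: columns n d "\<lambda>j. 2*j+1" "\<lambda>j. 2*j+2" by (rule shifted_columns[OF n])
    interpret Q: columns n d "\<lambda>j. 2*j+2" "\<lambda>j. 2*j+3" by (rule shifted_columns[OF n])
    have vals: "?s (0, j) = 2*j+1" "?s (1, j) = 2*j+2" "?t (0, j) = 2*j+2" "?t (1, j) = 2*j+3" if "j < d" for j
      using that by (simp_all add: diagram_iff f_def g_def)
    show "col ?s B * col ?t B = P.col_fun B * Q.col_fun B"
      unfolding col_eq[OF s] col_eq[OF t] P.col_fun_def Q.col_fun_def P.transversal_def Q.transversal_def
      using vals by (simp cong: all_cong)
  qed (rule refl)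
  also have "\<dots> = 1" by (rule sum_shifted_columns[OF n])
  finally have "bf (e ?s) (e ?t) \<noteq> 0" by simp
  with s t show ?thesis by (rule that)
qed

lemma R_proper: "R \<noteq> S"
proof -
  obtain s t where st: "s \<in> tableaux la" "t \<in> tableaux la" "bf (e s) (e t) \<noteq> 0" by (rule exists_nonorthogonal)
  thus ?thesis using e_in_S[OF st(1)] e_in_S[OF st(2)] unfolding R_def by blast
qed

text \<open>This is where the shape \<open>(d + 2, d)\<close> matters: for \<open>n = 2d + 2\<close> triple sums are orthogonal to the
  Specht module.\<close>

lemma triple_sum_in_R:
  assumes x: "x \<in> S" and abc: "a \<in> {1..n}" "b \<in> {1..n}" "c \<in> {1..n}" "distinct [a, b, c]"
  shows "act M (swap a b) x \<oplus>\<^bsub>M\<^esub> act M (swap b c) x \<oplus>\<^bsub>M\<^esub> act M (swap a c) x \<in> R"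
proof -
  note P = permutes_swap_id[OF abc(1,2)] permutes_swap_id[OF abc(2,3)] permutes_swap_id[OF abc(1,3)]
  note T = transpose_in_sym_group[OF abc(1,2)] transpose_in_sym_group[OF abc(2,3)] transpose_in_sym_group[OF abc(1,3)]
  note SD = submoduleD[OF S_submodule]
  let ?y = "act M (swap a b) x \<oplus>\<^bsub>M\<^esub> act M (swap b c) x \<oplus>\<^bsub>M\<^esub> act M (swap a c) x"
  have "?y \<in> S" by (intro SD(3) SD(5) T x)
  moreover have "bf ?y g = 0" if g: "g \<in> S" for g
  proof -
    have "bf ?y g = (\<Sum>B\<in>subsets n d. triple_sum a b c (coef x) B * coef g B)"
      unfolding bf_def triple_sum_def
      by (rule sum.cong) (simp_all only: coef_add coef_act[OF P(1)] coef_act[OF P(2)] coef_act[OF P(3)]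
          inv_transpose_eq)
    also have "\<dots> = 0" by (rule triple_sum_orthogonal[OF char n d abc S_annihilated[OF x] S_annihilated[OF g]])
    finally show ?thesis .
  qed
  ultimately show ?thesis unfolding R_def by blast
qed

lemma spin_D: "spin_module n (D_module la :: ('f, nat \<Rightarrow> nat, _) grp_module)"
proof -
  let ?V = "M\<lparr>carrier := S\<rparr>"
  have sel: "carrier ?V = S" "zero ?V = zero M" "add ?V = add M" "smult ?V = smult M" "act ?V = act M"
    by simp_all
  have RS: "R \<subseteq> S" unfolding R_def by blast
  interpret V: group_module G ?V by (rule sub_group_module[OF M_module S_submodule])
  interpret V: quotient_setting G ?V R
    by unfold_locales (use RS R_submodule in \<open>simp only: sub_grp_submodule_iff[OF M_module S_submodule] simp_thms\<close>)
  have ne: "R \<noteq> carrier ?V" unfolding sel by (rule R_proper)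
  have max: "U \<subseteq> R \<or> U = carrier ?V" if "grp_submodule G ?V U" for U
    using that submodule_dichotomy unfolding sub_grp_submodule_iff[OF M_module S_submodule] sel by blast
  have rad: "module_radical G ?V = R" by (rule V.radical_eq[OF ne]) (rule max)
  have eq: "D_module la = quot_module ?V R"
    unfolding D_module_def head_def sum_la specht rad by (rule refl)
  show "spin_module n (D_module la :: ('f, nat \<Rightarrow> nat, _) grp_module)"
    unfolding eq spin_module_def
  proof (intro conjI ballI impI)
    show "simple_module G (quot_module ?V R)" by (rule V.Q_simple[OF ne]) (rule max)
    fix a b c v assume abc: "a \<in> {1..n}" "b \<in> {1..n}" "c \<in> {1..n}" "distinct [a, b, c]"
      and v: "v \<in> carrier (quot_module ?V R)"
    note T = transpose_in_sym_group[OF abc(1,2)] transpose_in_sym_group[OF abc(2,3)] transpose_in_sym_group[OF abc(1,3)]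
    note SD = submoduleD[OF S_submodule]
    obtain x where x: "x \<in> S" "v = V.cs x" using v unfolding V.Q_carrier sel by (elim imageE)
    hence xV: "x \<in> carrier ?V" unfolding sel by simp
    have cl: "act ?V (swap a b) x \<in> carrier ?V" "act ?V (swap b c) x \<in> carrier ?V" "act ?V (swap a c) x \<in> carrier ?V"
      unfolding sel by (rule SD(5)[OF T(1) x(1)] SD(5)[OF T(2) x(1)] SD(5)[OF T(3) x(1)])+
    have mem: "act ?V (swap a b) x \<oplus>\<^bsub>?V\<^esub> act ?V (swap b c) x \<oplus>\<^bsub>?V\<^esub> act ?V (swap a c) x \<in> R"
      unfolding sel by (rule triple_sum_in_R[OF x(1) abc])
    show "act (quot_module ?V R) (swap a b) v \<oplus>\<^bsub>quot_module ?V R\<^esub> act (quot_module ?V R) (swap b c) v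
        \<oplus>\<^bsub>quot_module ?V R\<^esub> act (quot_module ?V R) (swap a c) v = \<zero>\<^bsub>quot_module ?V R\<^esub>"
      unfolding x(2) V.Q_act[OF T(1) xV] V.Q_act[OF T(2) xV] V.Q_act[OF T(3) xV] V.Q_add[OF cl(1,2)]
        V.Q_add[OF V.add_closed[OF cl(1,2)] cl(3)] V.Q_zero
      by (rule V.cs_W[OF mem])
  qed
qed

end

section \<open>The classification\<close>

text \<open>Triple sums vanish modulo the radical of the form.\<close>

lemma spin_module_basic_spin:
  assumes char: "CHAR('f::field) = 2" and n: "n \<ge> 4" "even n"
  shows "spin_module n (D_module (basic_spin_partition n) :: ('f, nat \<Rightarrow> nat, _) grp_module)"
proof -
  define d where "d = n div 2 - 1"
  have nd: "n = 2 * d + 2" and d: "d \<ge> 1" using n unfolding d_def by presburger+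
  interpret two_row_char2 n d "TYPE('f)" by unfold_locales (fact nd char d)+
  have "basic_spin_partition n = la" unfolding basic_spin_partition_def la_def nd by simp
  thus ?thesis using spin_D by simp
qed

lemma spin_module_if_iso:
  fixes V :: "('f::field, nat \<Rightarrow> nat, 'v) grp_module" and W :: "('f, nat \<Rightarrow> nat, 'w) grp_module"
  assumes simple: "simple_module (sym_group n) V" and iso: "grp_iso (sym_group n) V W" and W: "spin_module n W"
  shows "spin_module n V"
proof -
  interpret V: group_module "sym_group n" V using simple unfolding simple_module_def by blast
  interpret W: group_module "sym_group n" W using W unfolding spin_module_def simple_module_def by blast
  obtain f where f: "f \<in> grp_hom (sym_group n) V W" "bij_betw f (carrier V) (carrier W)"
    using iso unfolding grp_iso_def by blast
  have lin: "f (x \<oplus>\<^bsub>V\<^esub> y) = f x \<oplus>\<^bsub>W\<^esub> f y" "f (c \<odot>\<^bsub>V\<^esub> x) = c \<odot>\<^bsub>W\<^esub> f x" "f x \<in> carrier W"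
    if "x \<in> carrier V" "y \<in> carrier V" for x y c
    using f(1) that unfolding grp_hom_def lin_maps_iff by auto
  have equi: "f (act V g x) = act W g (f x)" if "g \<in> carrier (sym_group n)" "x \<in> carrier V" for g x
    using f(1) that unfolding grp_hom_def by blast
  have "f (0 \<odot>\<^bsub>V\<^esub> \<zero>\<^bsub>V\<^esub>) = 0 \<odot>\<^bsub>W\<^esub> f \<zero>\<^bsub>V\<^esub>" by (rule lin(2)[OF V.zero_closed V.zero_closed])
  hence zero: "f \<zero>\<^bsub>V\<^esub> = \<zero>\<^bsub>W\<^esub>" using lin(3)[of "\<zero>\<^bsub>V\<^esub>" "\<zero>\<^bsub>V\<^esub>"] by simp
  show ?thesis unfolding spin_module_def
  proof (intro conjI simple ballI impI)
    fix a b c v assume D: "a \<in> {1..n}" "b \<in> {1..n}" "c \<in> {1..n}" and d: "distinct [a, b, c]" and v: "v \<in> carrier V"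
    note T = transpose_in_sym_group[OF D(1,2)] transpose_in_sym_group[OF D(2,3)] transpose_in_sym_group[OF D(1,3)]
    let ?s = "act V (swap a b) v \<oplus>\<^bsub>V\<^esub> act V (swap b c) v \<oplus>\<^bsub>V\<^esub> act V (swap a c) v"
    note cl = V.act_closed[OF T(1) v] V.act_closed[OF T(2) v] V.act_closed[OF T(3) v]
    have "f ?s = act W (swap a b) (f v) \<oplus>\<^bsub>W\<^esub> act W (swap b c) (f v) \<oplus>\<^bsub>W\<^esub> act W (swap a c) (f v)"
      by (simp only: lin(1)[OF V.add_closed[OF cl(1,2)] cl(3)] lin(1)[OF cl(1,2)] equi[OF T(1) v] equi[OF T(2) v] equi[OF T(3) v])
    also have "\<dots> = \<zero>\<^bsub>W\<^esub>" using W D d lin(3)[OF v v] unfolding spin_module_def by blast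
    finally have "f ?s = f \<zero>\<^bsub>V\<^esub>" by (simp only: zero)
    thus "?s = \<zero>\<^bsub>V\<^esub>"
      by (rule inj_onD[OF bij_betw_imp_inj_on[OF f(2)]]) (intro V.add_closed cl, rule V.zero_closed)
  qed
qed

theorem theorem3p2:
  fixes V :: "('f::alg_closed_field, nat \<Rightarrow> nat, 'v) grp_module" and n :: nat
  assumes "CHAR('f) = 2" and "n \<ge> 6" and "even n"
    and "simple_module (sym_group n) V"
  shows "(d_inv n 3 V > d_inv n 1 V
           \<or> grp_iso (sym_group n) V (D_module (basic_spin_partition n))
           \<or> grp_iso (sym_group n) V trivial_module)
       \<and> (grp_iso (sym_group n) V (D_module (basic_spin_partition n))
           \<or> grp_iso (sym_group n) V trivial_module
           \<longrightarrow> d_inv n 3 V = d_inv n 1 V)"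
proof (intro conjI impI)
  note char = assms(1) and simple = assms(4)
  obtain k where k: "n = 2 * k" "k \<ge> 2" using assms(2,3) by auto
  have D: "spin_module n (D_module (basic_spin_partition n) :: ('f, nat \<Rightarrow> nat, _) grp_module)"
    using spin_module_basic_spin[OF char] assms(2,3) by simp
  show "d_inv n 3 V > d_inv n 1 V \<or> grp_iso (sym_group n) V (D_module (basic_spin_partition n))
      \<or> grp_iso (sym_group n) V trivial_module"
  proof (cases "d_inv n 3 V > d_inv n 1 V")
    case False
    hence eq: "d_inv n 1 V = d_inv n 3 V" using d_inv_1_3(1)[OF simple char] assms(2) by simp
    have "spin_module n V \<or> (\<forall>p\<in>carrier (sym_group n). \<forall>v\<in>carrier V. act V p v = v)"
    proof (rule spin_or_trivial_action[OF simple char])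
      show n5: "n \<ge> 5" using assms(2) by simp
    qed (rule transposition_relation[OF simple char _ eq]; use assms(2) in simp)
    thus ?thesis
    proof
      assume "spin_module n V"
      thus ?thesis using spin_module_iso[OF _ D char k] by blast
    next
      assume "\<forall>p\<in>carrier (sym_group n). \<forall>v\<in>carrier V. act V p v = v"
      hence "grp_iso (sym_group n) V trivial_module" by (intro trivial_iso[OF simple]) blast
      thus ?thesis by blast
    qed
  qed simp
  assume "grp_iso (sym_group n) V (D_module (basic_spin_partition n)) \<or> grp_iso (sym_group n) V trivial_module"
  thus "d_inv n 3 V = d_inv n 1 V"
  proof
    assume "grp_iso (sym_group n) V (D_module (basic_spin_partition n))"
    hence spin: "spin_module n V" by (rule spin_module_if_iso[OF simple _ D])
    have "d_inv n 3 V = 1" "d_inv n 1 V = 1"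
      using assms(2) by (intro spin_module_d_inv[OF spin char k]; simp)+
    thus ?thesis by simp
  next
    assume iso: "grp_iso (sym_group n) V trivial_module"
    have "d_inv n 3 V = 1" "d_inv n 1 V = 1"
      using assms(2) by (intro trivial_d_inv[OF simple iso]; simp)+
    thus ?thesis by simp
  qed
qed

end
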